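(* Let $k$ be a field of characteristic zero, let $\boldsymbol{w}(x_1,\ldots,x_n)\in k[[x_1,\ldots,x_n]]$ be an isolated singularity, and let $t=(t_1,\ldots,t_n)\in (k^* )^n$ be a diagonal symmetry of $\boldsymbol{w}$, i.e. $\boldsymbol{w}(t_1x_1,\ldots,t_nx_n)=\boldsymbol{w}(x_1,\ldots,x_n)$, such that $t_i\neq 1$ for all $i$. Then for any pair of matrix factorizations $\bar{A}$, $\bar{B}$ of $\boldsymbol{w}$ equipped with closed morphisms $\alpha:\bar{A}\to t^*\bar{A}$ and $\beta:t^*\bar{B}\to\bar{B}$, one has $$\mathrm{str}\bigl((t^*,\alpha,\beta)_*,\mathrm{Hom}(\bar{A},\bar{B})\bigr)=\mathrm{str}(\alpha|_0,\bar{A}|_0)\cdot\mathrm{str}(\beta|_0,\bar{B}|_0)\cdot\prod_{i=1}^n (1-t_i)^{-1}.$$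
   Context: Set $R=k[[x_1,\ldots,x_n]]$ with maximal ideal $\mathfrak m$. "$\boldsymbol{w}$ is an isolated singularity" means $\boldsymbol{w}\in\mathfrak m$ and $R/(\partial_1\boldsymbol{w},\ldots,\partial_n\boldsymbol{w})$ is finite-dimensional over $k$. A matrix factorization $\bar{E}=(E,\delta_E)$ of $\boldsymbol{w}$ is a $\mathbb{Z}/2$-graded finitely generated free $R$-module $E$ with an odd $R$-linear endomorphism $\delta_E$ such that $\delta_E^2=\boldsymbol{w}\cdot\mathrm{id}$. The $\mathbb{Z}/2$-graded complex of morphisms from $\bar{E}_1$ to $\bar{E}_2$ is $\mathrm{Hom}_R(E_1,E_2)$ with the differential $\phi\mapsto \delta_{E_2}\phi-(-1)^{|\phi|}\phi\delta_{E_1}$; $\mathrm{Hom}(\bar{E}_1,\bar{E}_2)$ denotes its cohomology, a finite-dimensional $\mathbb{Z}/2$-graded $k$-vector space. A closed morphism is a closed degree-zero element of this complex, i.e. an even $R$-linear map commuting with the $\delta$'s. The functor $t^*$ on matrix factorizations of $\boldsymbol{w}$ is induced by the ring automorphism $f\mapsto f\circ t$ of $R$, where $t:(x_i)\mapsto (t_ix_i)$ (it acts as the identity on free modules with chosen bases and by substitution $f\mapsto f\circ t$ on matrix entries). The endomorphism $(t^*,\alpha,\beta)_*$ of $\mathrm{Hom}(\bar{A},\bar{B})$ is $\phi\mapsto \beta\circ t^*(\phi)\circ\alpha$. The symbol $|_0$ denotes reduction modulo $\mathfrak m$; since $(t^*\bar{E})|_0=\bar{E}|_0$, $\alpha|_0$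 and $\beta|_0$ are even endomorphisms of the $\mathbb{Z}/2$-graded vector spaces $\bar{A}|_0$ and $\bar{B}|_0$. $\mathrm{str}(T,V)$ is the supertrace (trace on the even part minus trace on the odd part). *)

theory Defs
  imports "HOL-Algebra.AbelCoset" "Jordan_Normal_Form.VS_Connect"
begin

text \<open>
  A series is the family of its coefficients, indexed by exponent vectors. For
  \<open>CARD('n) = n\<close> the type \<open>('n, 'k) mfps\<close> is $k[[x_1,\ldots,x_n]]$. Order and subtraction of
  exponent vectors are pointwise.
\<close>

typedef ('n, 'k) mfps = "UNIV :: (('n \<Rightarrow> nat) \<Rightarrow> 'k) set"
  morphisms mcoeff Abs_mfps ..

setup_lifting type_definition_mfps

lemma mfps_eqI: "(\<And>m. mcoeff f m = mcoeff g m) \<Longrightarrow> f = g"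
  by transfer auto

lemma mcoeff_Abs_mfps [simp]: "mcoeff (Abs_mfps c) = c"
  by (simp add: Abs_mfps_inverse)

lemma finite_exponents_le [simp, intro]: "finite {a. a \<le> (m :: 'n :: finite \<Rightarrow> nat)}"
proof -
  have "{a. a \<le> m} = (\<Pi>\<^sub>E i\<in>UNIV. {..m i})"
    by (auto simp: le_fun_def PiE_def)
  then show ?thesis
    by (simp add: finite_PiE)
qed

lemma diff_diff_exponent: "\<forall>i. a i \<le> m i \<Longrightarrow> m - (m - a) = (a :: 'n \<Rightarrow> nat)"
  by (simp add: fun_eq_iff)

instantiation mfps :: (finite, comm_ring_1) comm_ring_1
begin

lift_definition zero_mfps :: "('a, 'b) mfps" is "\<lambda>_. 0" .
lift_definition one_mfps :: "('a, 'b) mfps" is "\<lambda>m. if m = (\<lambda>_. 0) then 1 else 0" .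
lift_definition plus_mfps :: "('a, 'b) mfps \<Rightarrow> ('a, 'b) mfps \<Rightarrow> ('a, 'b) mfps"
  is "\<lambda>f g m. f m + g m" .
lift_definition minus_mfps :: "('a, 'b) mfps \<Rightarrow> ('a, 'b) mfps \<Rightarrow> ('a, 'b) mfps"
  is "\<lambda>f g m. f m - g m" .
lift_definition uminus_mfps :: "('a, 'b) mfps \<Rightarrow> ('a, 'b) mfps"
  is "\<lambda>f m. - f m" .
lift_definition times_mfps :: "('a, 'b) mfps \<Rightarrow> ('a, 'b) mfps \<Rightarrow> ('a, 'b) mfps"
  is "\<lambda>f g m. \<Sum>a | a \<le> m. f a * g (m - a)" .

instance
proof
  fix f g h :: "('a, 'b) mfps"
  show "f + g + h = f + (g + h)" by transfer (simp add: add.assoc)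
  show "f + g = g + f" by transfer (simp add: add.commute)
  show "0 + f = f" by transfer simp
  show "- f + f = 0" by transfer simp
  show "f - g = f + - g" by transfer simp
  show "(0 :: ('a, 'b) mfps) \<noteq> 1"
    by transfer (metis zero_neq_one)
  show "f * g = g * f"
  proof (transfer, rule ext)
    fix f g :: "('a \<Rightarrow> nat) \<Rightarrow> 'b" and m
    show "(\<Sum>a | a \<le> m. f a * g (m - a)) = (\<Sum>a | a \<le> m. g a * f (m - a))"
      by (rule sum.reindex_bij_witness[of _ "\<lambda>a. m - a" "\<lambda>a. m - a"])
        (auto simp: le_fun_def mult.commute diff_diff_exponent)
  qed
  show "(f + g) * h = f * h + g * h"
    by transfer (simp add: distrib_right sum.distrib)
  show "1 * f = f"
  proof (transfer, rule ext)
    fix f :: "('a \<Rightarrow> nat) \<Rightarrow> 'b" and m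
    have "(\<Sum>a | a \<le> m. (if a = (\<lambda>_. 0) then 1 else 0) * f (m - a)) =
          (\<Sum>a | a \<le> m. if a = (\<lambda>_. 0) then f (m - a) else 0)"
      by (intro sum.cong) auto
    also have "\<dots> = f (m - (\<lambda>_. 0))"
      by (subst sum.delta, rule finite_exponents_le) (simp add: le_fun_def)
    also have "m - (\<lambda>_. 0) = m" by (simp add: fun_eq_iff)
    finally show "(\<Sum>a | a \<le> m. (if a = (\<lambda>_. 0) then 1 else 0) * f (m - a)) = f m" .
  qed
  show "f * g * h = f * (g * h)"
  proof (transfer, rule ext)
    fix f g h :: "('a \<Rightarrow> nat) \<Rightarrow> 'b" and m
    have "(\<Sum>a | a \<le> m. (\<Sum>b | b \<le> a. f b * g (a - b)) * h (m - a)) =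
          (\<Sum>(a, b) \<in> (SIGMA a:{a. a \<le> m}. {b. b \<le> a}). f b * g (a - b) * h (m - a))"
      by (simp add: sum.Sigma sum_distrib_right)
    also have "\<dots> = (\<Sum>(b, c) \<in> (SIGMA b:{b. b \<le> m}. {c. c \<le> m - b}).
                       f b * (g c * h (m - b - c)))"
    proof (rule sum.reindex_bij_witness[of _ "\<lambda>(b, c). (\<lambda>i. b i + c i, b)" "\<lambda>(a, b). (b, a - b)"],
        goal_cases)
      case (1 x)
      then show ?case by (auto simp: le_fun_def fun_eq_iff)
    next
      case (2 x)
      then show ?case by (auto simp: le_fun_def intro: order_trans intro!: diff_le_mono)
    next
      case (3 x)
      then show ?case by (auto simp: le_fun_def fun_eq_iff)
    next
      case (4 x)
      then show ?case
        by (auto simp: le_fun_def Nat.le_diff_conv2 add.commute)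
    next
      case (5 x)
      obtain a b where x: "x = (a, b)" by (cases x)
      from 5 x have "m - b - (a - b) = m - a" by (auto simp: le_fun_def fun_eq_iff)
      then show ?case by (simp add: x mult.assoc)
    qed
    also have "\<dots> = (\<Sum>b | b \<le> m. f b * (\<Sum>c | c \<le> m - b. g c * h (m - b - c)))"
      by (simp add: sum.Sigma sum_distrib_left)
    finally show "(\<Sum>a | a \<le> m. (\<Sum>b | b \<le> a. f b * g (a - b)) * h (m - a)) =
          (\<Sum>b | b \<le> m. f b * (\<Sum>c | c \<le> m - b. g c * h (m - b - c)))" .
  qed
qed

end

lift_definition mconst :: "'k :: zero \<Rightarrow> ('n, 'k) mfps" is "\<lambda>c m. if m = (\<lambda>_. 0) then c else 0" .

text \<open>The residue map $R \to R/\mathfrak m = k$; \<open>f \<in> \<mm>\<close> means \<open>mresidue f = 0\<close>.\<close>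

definition mresidue :: "('n, 'k) mfps \<Rightarrow> 'k" where
  "mresidue f = mcoeff f (\<lambda>_. 0)"

lift_definition mpderiv :: "'n \<Rightarrow> ('n, 'k :: semiring_1) mfps \<Rightarrow> ('n, 'k) mfps"
  is "\<lambda>i f m. of_nat (Suc (m i)) * f (m(i := Suc (m i)))" .

text \<open>\<open>mscale t f\<close> is $f(t_1x_1,\ldots,t_nx_n)$.\<close>

lift_definition mscale :: "('n :: finite \<Rightarrow> 'k :: comm_semiring_1) \<Rightarrow> ('n, 'k) mfps \<Rightarrow> ('n, 'k) mfps"
  is "\<lambda>t f m. (\<Prod>i\<in>UNIV. t i ^ m i) * f m" .

text \<open>
  Vector spaces over the field \<open>'k\<close> are module records over \<open>class_ring\<close>; their ring
  multiplication and unit play no role.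
\<close>

definition quotient_space :: "('k, 'v) module \<Rightarrow> 'v set \<Rightarrow> ('k, 'v set) module" where
  "quotient_space V W =
    \<lparr>carrier = a_rcosets\<^bsub>V\<^esub> W, mult = undefined, one = undefined, zero = W, add = set_add V,
     smult = (\<lambda>c X. \<Union>x\<in>X. W +>\<^bsub>V\<^esub> (c \<odot>\<^bsub>V\<^esub> x))\<rparr>"

definition quotient_map :: "('k, 'v) module \<Rightarrow> 'v set \<Rightarrow> ('v \<Rightarrow> 'v) \<Rightarrow> 'v set \<Rightarrow> 'v set" where
  "quotient_map V W T X = (\<Union>x\<in>X. W +>\<^bsub>V\<^esub> T x)"

definition coordinate :: "('k :: field, 'v) module \<Rightarrow> 'v set \<Rightarrow> 'v \<Rightarrow> 'v \<Rightarrow> 'k" where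
  "coordinate V B x = (THE c. c \<in> B \<rightarrow>\<^sub>E UNIV \<and> module.lincomb V c B = x)"

text \<open>The trace in an arbitrary finite basis; nothing is specified if \<open>V\<close> is
  infinite-dimensional.\<close>

definition vs_trace :: "('k :: field, 'v) module \<Rightarrow> ('v \<Rightarrow> 'v) \<Rightarrow> 'k" where
  "vs_trace V T =
    (let B = SOME B. finite B \<and> vectorspace.basis class_ring V B
     in \<Sum>v\<in>B. coordinate V B (T v) v)"

definition mfps_space :: "('k :: comm_ring_1, ('n :: finite, 'k) mfps) module" where
  "mfps_space = \<lparr>carrier = UNIV, mult = (*), one = 1, zero = 0, add = (+),
     smult = (\<lambda>c f. mconst c * f)\<rparr>"

definition jacobian_ideal :: "('n :: finite, 'k :: comm_ring_1) mfps \<Rightarrow> ('n, 'k) mfps set" where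
  "jacobian_ideal w = {\<Sum>i\<in>UNIV. g i * mpderiv i w | g. True}"

definition isolated_singularity :: "('n :: finite, 'k :: field) mfps \<Rightarrow> bool" where
  "isolated_singularity w \<longleftrightarrow> mresidue w = 0 \<and>
     vectorspace.fin_dim class_ring (quotient_space mfps_space (jacobian_ideal w))"

text \<open>
  A \<open>\<int>/2\<close>-graded finitely generated free module with an endomorphism, in a homogeneous basis whose
  first \<open>rank_even\<close> members are even and whose remaining \<open>rank_odd\<close> members are odd. A morphism
  \<open>E \<rightarrow> F\<close> is a matrix with \<open>rank F\<close> rows and \<open>rank E\<close> columns. Degrees are natural numbers
  that matter only modulo 2, so the coboundaries in degree \<open>s\<close> come from degree \<open>s + 1\<close>.
\<close>

record 'r graded_module =
  rank_even :: nat
  rank_odd :: nat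
  differential :: "'r mat"

definition rank :: "'r graded_module \<Rightarrow> nat" where
  "rank E = rank_even E + rank_odd E"

definition basis_degree :: "'r graded_module \<Rightarrow> nat \<Rightarrow> nat" where
  "basis_degree E j = (if j < rank_even E then 0 else 1)"

definition homs :: "'r :: zero graded_module \<Rightarrow> 'r graded_module \<Rightarrow> nat \<Rightarrow> 'r mat set" where
  "homs E F s = {\<phi> \<in> carrier_mat (rank F) (rank E). \<forall>i < rank F. \<forall>j < rank E.
     \<phi> $$ (i, j) \<noteq> 0 \<longrightarrow> basis_degree F i mod 2 = (basis_degree E j + s) mod 2}"

definition matrix_factorization :: "'r :: comm_ring_1 \<Rightarrow> 'r graded_module \<Rightarrow> bool" where
  "matrix_factorization w E \<longleftrightarrow> differential E \<in> homs E E 1 \<and>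
     differential E * differential E = w \<cdot>\<^sub>m 1\<^sub>m (rank E)"

definition hom_diff ::
    "'r :: comm_ring_1 graded_module \<Rightarrow> 'r graded_module \<Rightarrow> nat \<Rightarrow> 'r mat \<Rightarrow> 'r mat" where
  "hom_diff E F s \<phi> = differential F * \<phi> - (-1) ^ s \<cdot>\<^sub>m (\<phi> * differential E)"

definition cocycles :: "'r :: comm_ring_1 graded_module \<Rightarrow> 'r graded_module \<Rightarrow> nat \<Rightarrow> 'r mat set" where
  "cocycles E F s = {\<phi> \<in> homs E F s. hom_diff E F s \<phi> = 0\<^sub>m (rank F) (rank E)}"

definition coboundaries ::
    "'r :: comm_ring_1 graded_module \<Rightarrow> 'r graded_module \<Rightarrow> nat \<Rightarrow> 'r mat set" where
  "coboundaries E F s = hom_diff E F (s + 1) ` homs E F (s + 1)"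

definition closed_morphism ::
    "'r :: comm_ring_1 graded_module \<Rightarrow> 'r graded_module \<Rightarrow> 'r mat \<Rightarrow> bool" where
  "closed_morphism E F \<phi> \<longleftrightarrow> \<phi> \<in> cocycles E F 0"

definition cocycle_space ::
    "('n :: finite, 'k :: comm_ring_1) mfps graded_module \<Rightarrow> ('n, 'k) mfps graded_module \<Rightarrow> nat \<Rightarrow>
     ('k, ('n, 'k) mfps mat) module" where
  "cocycle_space E F s = \<lparr>carrier = cocycles E F s, mult = undefined, one = undefined,
     zero = 0\<^sub>m (rank F) (rank E), add = (+), smult = (\<lambda>c \<phi>. mconst c \<cdot>\<^sub>m \<phi>)\<rparr>"

definition cohomology ::
    "('n :: finite, 'k :: comm_ring_1) mfps graded_module \<Rightarrow> ('n, 'k) mfps graded_module \<Rightarrow> nat \<Rightarrow>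
     ('k, ('n, 'k) mfps mat set) module" where
  "cohomology E F s = quotient_space (cocycle_space E F s) (coboundaries E F s)"

definition pullback ::
    "('n :: finite \<Rightarrow> 'k :: comm_ring_1) \<Rightarrow> ('n, 'k) mfps graded_module \<Rightarrow> ('n, 'k) mfps graded_module" where
  "pullback t E = E\<lparr>differential := map_mat (mscale t) (differential E)\<rparr>"

definition twisted_action ::
    "('n :: finite \<Rightarrow> 'k :: comm_ring_1) \<Rightarrow> ('n, 'k) mfps mat \<Rightarrow> ('n, 'k) mfps mat \<Rightarrow>
     ('n, 'k) mfps mat \<Rightarrow> ('n, 'k) mfps mat" where
  "twisted_action t \<alpha> \<beta> \<phi> = \<beta> * (map_mat (mscale t) \<phi> * \<alpha>)"

text \<open>\<open>T\<close> is an even endomorphism of the complex of morphisms; the traces are those of the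
  endomorphisms it induces on the two cohomology spaces.\<close>

definition cohomology_supertrace ::
    "('n :: finite, 'k :: field) mfps graded_module \<Rightarrow> ('n, 'k) mfps graded_module \<Rightarrow>
     (('n, 'k) mfps mat \<Rightarrow> ('n, 'k) mfps mat) \<Rightarrow> 'k" where
  "cohomology_supertrace E F T =
     (let tr = (\<lambda>s. vs_trace (cohomology E F s)
                 (quotient_map (cocycle_space E F s) (coboundaries E F s) T))
      in tr 0 - tr 1)"

text \<open>\<open>pullback t E\<close> and \<open>E\<close> have the same reduction modulo the maximal ideal, so the reduction
  of an even morphism between them is an endomorphism and has a supertrace.\<close>

definition residue_supertrace ::
    "('n, 'k :: comm_ring_1) mfps graded_module \<Rightarrow> ('n, 'k) mfps mat \<Rightarrow> 'k" where
  "residue_supertrace E \<phi> =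
     (let \<phi>\<^sub>0 = map_mat mresidue \<phi>
      in (\<Sum>i = 0..<rank_even E. \<phi>\<^sub>0 $$ (i, i)) - (\<Sum>i = rank_even E..<rank E. \<phi>\<^sub>0 $$ (i, i)))"

end

theory Submission
  imports Defs "HOL-Library.Function_Algebras"
begin

text \<open>
  Write $C = \mathrm{Hom}_R(A,B)$ for the complex of morphisms. It is a free $R$-module of finite
  rank, its differential is $R$-linear, and the operator $T = (t^*,\alpha,\beta)_*$ satisfies
  $T(x_i c) = t_i x_i T(c)$. Hence multiplication by $x_i$ gives an exact sequence
  $0 \to C \to C \to C/x_iC \to 0$ which is equivariant once $T$ is replaced by $t_iT$ on the first
  term. In the resulting exact triangle of cohomology, supertraces are additive, so
  $\mathrm{str}(T, H(C/x_iC)) = (1 - t_i)\,\mathrm{str}(T, H(C))$. After all variables have been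
  divided out in this way, the complex is the finite-dimensional space
  $\mathrm{Hom}(A|_0, B|_0)$. There the supertrace on cohomology is the supertrace on the complex
  itself, which for $\phi \mapsto \beta|_0\,\phi\,\alpha|_0$ is
  $\mathrm{str}(\alpha|_0)\,\mathrm{str}(\beta|_0)$. Since every $1 - t_i$ is invertible, the formula
  follows. The three steps are \<open>rel_trace_extend\<close>, \<open>hopf_trace\<close> and \<open>residue_trace\<close>.

  The argument needs $H(C)$ to be finite-dimensional. Differentiating $\delta_B^2 = w$ shows that
  $\partial_j w$ acts on $C$ by a null-homotopic map, with homotopy given by $\partial_j\delta_B$
  (\<open>jacobian_homotopy\<close>). The Jacobian ideal has finite codimension, so it contains a power $x_i^a$
  of every variable (\<open>var_power_in_ideal\<close>), and multiplication by $x_i^a$ is then zero on cohomology.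
  The exact triangle of $0 \to C \to C \to C/x_i^aC \to 0$ therefore embeds $H(C)$ into
  $H(C/x_i^aC)$ (\<open>finite_rel_homology_descends\<close>). Iterating over the variables embeds it into a
  subquotient of the finite-dimensional space $C/(x_1^a,\ldots,x_n^a)C$.

  Two devices keep the bookkeeping small. First, let $\epsilon$ be the parity operator on $C$ and
  $S = \epsilon T$. The supertrace of $T$ is the ordinary trace of $S$, and $S$ anticommutes with the
  differential. All exact sequences can then be treated without a grading, and the grading returns
  only at the end, when the trace of $S$ is split into the two cohomology groups. Secondly, no
  quotient complex is formed: the cohomology of $C/N$ is the subquotient $Z/B$ of $C$ with
  $Z = \{c \mid dc \in N\}$ and $B = dC + N$. The trace of an operator on such a subquotient is
  computed from a frame, which is a list of vectors $v \in Z$ with functionals $g$ on $Z/B$ such that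
  $z \equiv \sum g(z)v$ modulo $B$. Its value does not depend on the frame, it is additive along
  $B \subseteq Y \subseteq Z$, and it is transported by isomorphisms
  (\<open>frame_trace_unique\<close>, \<open>qtrace_additive\<close>, \<open>qtrace_iso\<close>).
\<close>

section \<open>Traces on subquotients\<close>

text \<open>A separate copy of the locale of vector spaces, so that the notions below are not also created for
  every interpretation that the original already has.\<close>

locale linear_space = vector_space scale
  for scale :: "'a :: field \<Rightarrow> 'b :: ab_group_add \<Rightarrow> 'b" (infixr "*s" 75)
begin

abbreviation linear_endo :: "('b \<Rightarrow> 'b) \<Rightarrow> bool" where
  "linear_endo \<equiv> module_hom scale scale"

definition subquotient :: "'b set \<Rightarrow> 'b set \<Rightarrow> bool" where
  "subquotient Z B \<longleftrightarrow> subspace Z \<and> subspace B \<and> B \<subseteq> Z"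

text \<open>For subspaces $B \subseteq Z$ this says that $Z/B$ is finite-dimensional. The formulation by a
  generating set that need not lie in \<open>Z\<close> makes it pass to smaller \<open>Z\<close> and larger \<open>B\<close> without
  further argument.\<close>

definition finite_codim :: "'b set \<Rightarrow> 'b set \<Rightarrow> bool" where
  "finite_codim Z B \<longleftrightarrow> (\<exists>E. finite E \<and> Z \<subseteq> span (E \<union> B))"

text \<open>Linearity is asked on \<open>Z\<close> only, because coordinates on a quotient of \<open>Z\<close> are not given outside \<open>Z\<close>.\<close>

definition functional_on :: "'b set \<Rightarrow> 'b set \<Rightarrow> ('b \<Rightarrow> 'a) \<Rightarrow> bool" where
  "functional_on Z B g \<longleftrightarrow> (\<forall>x\<in>Z. \<forall>y\<in>Z. g (x + y) = g x + g y) \<and>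
     (\<forall>c. \<forall>x\<in>Z. g (c *s x) = c * g x) \<and> (\<forall>b\<in>B. g b = 0)"

definition frame_sum :: "('b \<times> ('b \<Rightarrow> 'a)) list \<Rightarrow> 'b \<Rightarrow> 'b" where
  "frame_sum ps z = (\<Sum>(v, g)\<leftarrow>ps. g z *s v)"

text \<open>The vectors of a frame span $Z/B$ but may be linearly dependent there: the trace formula only uses
  that \<open>frame_sum\<close> is the identity of $Z/B$. Lists make it possible to put two frames together by
  concatenation.\<close>

definition frame :: "'b set \<Rightarrow> 'b set \<Rightarrow> ('b \<times> ('b \<Rightarrow> 'a)) list \<Rightarrow> bool" where
  "frame Z B ps \<longleftrightarrow> (\<forall>(v, g)\<in>set ps. v \<in> Z \<and> functional_on Z B g) \<and>
     (\<forall>z\<in>Z. z - frame_sum ps z \<in> B)"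

definition frame_trace :: "('b \<times> ('b \<Rightarrow> 'a)) list \<Rightarrow> ('b \<Rightarrow> 'b) \<Rightarrow> 'a" where
  "frame_trace ps T = (\<Sum>(v, g)\<leftarrow>ps. g (T v))"

text \<open>The trace of the operator induced by \<open>T\<close> on $Z/B$. The choice of the frame is immaterial by
  \<open>frame_trace_unique\<close> below.\<close>

definition qtrace :: "'b set \<Rightarrow> 'b set \<Rightarrow> ('b \<Rightarrow> 'b) \<Rightarrow> 'a" where
  "qtrace Z B T = frame_trace (SOME ps. frame Z B ps) T"

definition preserves :: "('b \<Rightarrow> 'b) \<Rightarrow> 'b set \<Rightarrow> 'b set \<Rightarrow> bool" where
  "preserves T Z B \<longleftrightarrow> linear_endo T \<and> (\<forall>z\<in>Z. T z \<in> Z) \<and> (\<forall>b\<in>B. T b \<in> B)"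

lemma linear_endoI:
  assumes "\<And>x y. T (x + y) = T x + T y" "\<And>c x. T (c *s x) = c *s T x"
  shows "linear_endo T"
  using assms by (simp add: module_hom_iff module_axioms)

lemma linear_endo_ident: "linear_endo (\<lambda>x. x)"
  by (rule linear_endoI) simp_all

lemma preservesD:
  assumes "preserves T Z B"
  shows "linear_endo T" "z \<in> Z \<Longrightarrow> T z \<in> Z" "z \<in> B \<Longrightarrow> T z \<in> B"
  using assms by (auto simp: preserves_def)

lemma functional_onD:
  assumes "functional_on Z B g"
  shows "x \<in> Z \<Longrightarrow> y \<in> Z \<Longrightarrow> g (x + y) = g x + g y"
    and "x \<in> Z \<Longrightarrow> g (c *s x) = c * g x"
    and "b \<in> B \<Longrightarrow> g b = 0"
  using assms by (auto simp: functional_on_def)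

lemma functional_on_diff:
  assumes "functional_on Z B g" "subspace Z" "x \<in> Z" "y \<in> Z"
  shows "g (x - y) = g x - g y"
proof -
  have "g x = g ((x - y) + y)" by simp
  also have "\<dots> = g (x - y) + g y"
    using assms by (intro functional_onD(1)[OF assms(1)] subspace_diff)
  finally show ?thesis by simp
qed

lemma frame_sum_simps [simp]:
  "frame_sum [] z = 0"
  "frame_sum ((v, g) # ps) z = g z *s v + frame_sum ps z"
  "frame_sum (ps @ qs) z = frame_sum ps z + frame_sum qs z"
  by (simp_all add: frame_sum_def)

lemma frame_sum_in:
  assumes "subspace Z" "\<forall>(v, g)\<in>set ps. v \<in> Z"
  shows "frame_sum ps z \<in> Z"
  using assms(2)
proof (induction ps)
  case Nil
  show ?case using subspace_0[OF assms(1)] by simp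
next
  case (Cons p ps)
  obtain v g where p: "p = (v, g)" by (cases p)
  show ?case
    using subspace_add[OF assms(1) subspace_scale[OF assms(1), of v "g z"] Cons.IH] Cons.prems
    by (simp add: p)
qed

lemma functional_on_frame_sum:
  assumes "functional_on Z B h" "subspace Z" "\<forall>(v, g)\<in>set ps. v \<in> Z"
  shows "h (frame_sum ps z) = (\<Sum>(v, g)\<leftarrow>ps. g z * h v)"
  using assms(3)
proof (induction ps)
  case Nil
  have "h 0 = h (0 *s 0)" by simp
  also have "\<dots> = 0" using functional_onD(2)[OF assms(1) subspace_0[OF assms(2)], of 0] by simp
  finally show ?case by simp
next
  case (Cons p ps)
  obtain v g where p: "p = (v, g)" by (cases p)
  show ?case
    using Cons frame_sum_in[OF assms(2), of ps z]
    by (simp add: p functional_onD[OF assms(1)] subspace_scale[OF assms(2)])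
qed

lemma functional_on_expand:
  assumes "functional_on Z B h" "subquotient Z B" "frame Z B ps" "z \<in> Z"
  shows "h z = (\<Sum>(v, g)\<leftarrow>ps. g z * h v)"
proof -
  have Z: "subspace Z" and BZ: "B \<subseteq> Z" using assms(2) by (auto simp: subquotient_def)
  have ps: "\<forall>(v, g)\<in>set ps. v \<in> Z" using assms(3) by (auto simp: frame_def)
  have "z - frame_sum ps z \<in> B" using assms(3,4) by (auto simp: frame_def)
  then have "h (z - frame_sum ps z) = 0" using functional_onD(3)[OF assms(1)] by auto
  then have "h z = h (frame_sum ps z)"
    using functional_on_diff[OF assms(1) Z assms(4) frame_sum_in[OF Z ps]] by simp
  then show ?thesis using functional_on_frame_sum[OF assms(1) Z ps] by simp
qed

lemma functional_on_comp:
  assumes "functional_on Z2 B2 g" "linear_endo T" "\<And>z. z \<in> Z1 \<Longrightarrow> T z \<in> Z2"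
    "\<And>b. b \<in> B1 \<Longrightarrow> T b \<in> B2"
  shows "functional_on Z1 B1 (\<lambda>z. g (T z))"
  using assms by (auto simp: functional_on_def module_hom.add module_hom.scale)

lemma sum_list_swap_pairs:
  fixes F :: "'c \<Rightarrow> 'd \<Rightarrow> 'e::comm_monoid_add"
  shows "(\<Sum>p\<leftarrow>ps. \<Sum>q\<leftarrow>qs. F p q) = (\<Sum>q\<leftarrow>qs. \<Sum>p\<leftarrow>ps. F p q)"
  by (induction ps) (simp_all add: sum_list_addf)

text \<open>If $(v,g)$ and $(u,h)$ run through the two frames, expanding $v$ in the second frame turns
  $\sum g(Tv)$ into $\sum h(v)\,g(Tu)$, and expanding $Tu$ in the first frame turns $\sum h(Tu)$ into
  the same double sum.\<close>

lemma frame_trace_unique: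
  assumes "subquotient Z B" "preserves T Z B" "frame Z B ps" "frame Z B qs"
  shows "frame_trace ps T = frame_trace qs T"
proof -
  have mem: "v \<in> Z" "functional_on Z B g" if "(v, g) \<in> set ps \<union> set qs" for v g
    using assms(3,4) that by (auto simp: frame_def)
  have T: "linear_endo T" "\<And>z. z \<in> Z \<Longrightarrow> T z \<in> Z" "\<And>b. b \<in> B \<Longrightarrow> T b \<in> B"
    using assms(2) by (auto simp: preserves_def)
  have "frame_trace ps T = (\<Sum>(v, g)\<leftarrow>ps. \<Sum>(u, h)\<leftarrow>qs. h v * g (T u))"
    unfolding frame_trace_def
    using functional_on_expand[OF functional_on_comp[OF mem(2) T] assms(1,4) mem(1)]
    by (intro arg_cong[of _ _ sum_list] map_cong refl) auto
  also have "\<dots> = (\<Sum>(u, h)\<leftarrow>qs. \<Sum>(v, g)\<leftarrow>ps. h v * g (T u))"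
    using sum_list_swap_pairs[of "\<lambda>p q. snd q (fst p) * snd p (T (fst q))" qs ps]
    by (simp add: case_prod_beta')
  also have "\<dots> = frame_trace qs T"
  proof -
    have "h (T u) = (\<Sum>(v, g)\<leftarrow>ps. h v * g (T u))" if "(u, h) \<in> set qs" for u h
      using functional_on_expand[OF mem(2) assms(1,3) T(2)[OF mem(1)], of u h u h] that
      by (simp add: mult.commute)
    then show ?thesis
      unfolding frame_trace_def by (intro arg_cong[of _ _ sum_list] map_cong refl) auto
  qed
  finally show ?thesis .
qed

lemma qtrace_eq:
  assumes "subquotient Z B" "preserves T Z B" "frame Z B ps"
  shows "qtrace Z B T = frame_trace ps T"
proof -
  have "frame Z B (SOME ps. frame Z B ps)" by (rule someI) (rule assms(3))
  then show ?thesis unfolding qtrace_def by (rule frame_trace_unique[OF assms(1,2) _ assms(3)])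
qed

text \<open>A functional on $Y/B$ is extended to $Z$ by first removing the component of $z$ along the frame of
  $Z/Y$. On \<open>Y\<close> this correction vanishes, which is why the two traces simply add up.\<close>

lemma frame_append:
  assumes "subquotient Z Y" "subquotient Y B" "frame Z Y qs" "frame Y B ps"
  defines "ps' \<equiv> map (\<lambda>(v, g). (v, \<lambda>z. g (z - frame_sum qs z))) ps"
  shows "frame Z B (qs @ ps')"
    and "\<lbrakk>\<And>z. z \<in> Y \<Longrightarrow> T z \<in> Y\<rbrakk> \<Longrightarrow> frame_trace (qs @ ps') T = frame_trace qs T + frame_trace ps T"
proof -
  have Z: "subspace Z" and Y: "subspace Y" and B: "subspace B" and YZ: "Y \<subseteq> Z" and BY: "B \<subseteq> Y"
    using assms(1,2) by (auto simp: subquotient_def)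
  have qs: "v \<in> Z" "functional_on Z Y g" if "(v, g) \<in> set qs" for v g
    using assms(3) that by (auto simp: frame_def)
  have ps: "v \<in> Y" "functional_on Y B g" if "(v, g) \<in> set ps" for v g
    using assms(4) that by (auto simp: frame_def)
  have red: "z - frame_sum qs z \<in> Y" if "z \<in> Z" for z using assms(3) that by (auto simp: frame_def)
  have fs0: "frame_sum rs y = 0" if "\<forall>(v,g)\<in>set rs. g y = 0" for rs y
    using that by (induction rs) auto
  have fsY: "frame_sum qs y = 0" if "y \<in> Y" for y
    using functional_onD(3)[OF qs(2)] that by (intro fs0) fastforce
  have fsadd: "frame_sum rs (x + y) = frame_sum rs x + frame_sum rs y"
    if "\<forall>(v,g)\<in>set rs. functional_on Z Y g" "x \<in> Z" "y \<in> Z" for rs x y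
    using that by (induction rs) (auto simp: functional_onD(1) scale_left_distrib algebra_simps)
  have fsscale: "frame_sum rs (c *s x) = c *s frame_sum rs x"
    if "\<forall>(v,g)\<in>set rs. functional_on Z Y g" "x \<in> Z" for rs x c
    using that by (induction rs) (auto simp: functional_onD(2) scale_right_distrib algebra_simps)
  have lift: "functional_on Z B (\<lambda>z. g (z - frame_sum qs z))" if g: "functional_on Y B g" for g
  proof -
    have "g (x + y - frame_sum qs (x + y)) = g (x - frame_sum qs x) + g (y - frame_sum qs y)"
      if "x \<in> Z" "y \<in> Z" for x y
    proof -
      have "x + y - frame_sum qs (x + y) = (x - frame_sum qs x) + (y - frame_sum qs y)"
        using that qs by (subst fsadd) (auto simp: algebra_simps)
      then show ?thesis using functional_onD(1)[OF g red[OF that(1)] red[OF that(2)]] by (simp only:)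
    qed
    moreover have "g (c *s x - frame_sum qs (c *s x)) = c * g (x - frame_sum qs x)"
      if "x \<in> Z" for x c
    proof -
      have "c *s x - frame_sum qs (c *s x) = c *s (x - frame_sum qs x)"
        using that qs by (subst fsscale) (auto simp: algebra_simps)
      then show ?thesis using functional_onD(2)[OF g red[OF that]] by (simp only:)
    qed
    moreover have "g (b - frame_sum qs b) = 0" if "b \<in> B" for b
      using that BY by (auto simp: fsY functional_onD(3)[OF g])
    ultimately show ?thesis by (auto simp: functional_on_def)
  qed
  have fs': "frame_sum ps' z = frame_sum ps (z - frame_sum qs z)" for z
    by (simp add: ps'_def frame_sum_def o_def case_prod_beta')
  show "frame Z B (qs @ ps')"
    unfolding frame_def
  proof (intro conjI ballI)
    fix p assume "p \<in> set (qs @ ps')"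
    moreover have "functional_on Z B g" if "(v, g) \<in> set qs" for v g
      using qs(2)[OF that] BY by (auto simp: functional_on_def)
    ultimately show "case p of (v, g) \<Rightarrow> v \<in> Z \<and> functional_on Z B g"
      using qs(1) ps YZ lift by (auto simp: ps'_def)
  next
    fix z assume "z \<in> Z"
    from assms(4) red[OF this] have "(z - frame_sum qs z) - frame_sum ps (z - frame_sum qs z) \<in> B"
      by (auto simp: frame_def)
    then show "z - frame_sum (qs @ ps') z \<in> B" by (simp add: fs' diff_diff_eq)
  qed
  assume T: "\<And>z. z \<in> Y \<Longrightarrow> T z \<in> Y"
  have "frame_trace ps' T = frame_trace ps T"
    unfolding frame_trace_def ps'_def
    using ps T by (intro arg_cong[of _ _ sum_list]) (auto simp: fsY)
  then show "frame_trace (qs @ ps') T = frame_trace qs T + frame_trace ps T"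
    by (simp add: frame_trace_def)
qed

text \<open>Here $Z/Y$ has dimension at most one. The functional is the coordinate along any \<open>z0\<close> of \<open>Z\<close>
  outside \<open>Y\<close>.\<close>

lemma span_insert_frame:
  assumes "subspace Z" "subspace Y" "Y \<subseteq> Z" "Z \<subseteq> span (insert e S)" "Z \<inter> span S \<subseteq> Y"
  shows "\<exists>ps. frame Z Y ps"
proof (cases "Z \<subseteq> Y")
  case True
  then have "frame Z Y []" by (auto simp: frame_def)
  then show ?thesis ..
next
  case False
  then obtain z0 where z0: "z0 \<in> Z" "z0 \<notin> Y" by auto
  have ex: "\<exists>c. z - c *s z0 \<in> Y" if z: "z \<in> Z" for z
  proof -
    obtain a where a: "z - a *s e \<in> span S" using z assms(4) span_breakdown_eq by blast
    obtain b where b: "z0 - b *s e \<in> span S" using z0 assms(4) span_breakdown_eq by blast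
    have "b \<noteq> 0" using b z0 assms(5) by auto
    have "z - (a / b) *s z0 = (z - a *s e) - (a / b) *s (z0 - b *s e)"
      using \<open>b \<noteq> 0\<close> by (simp add: algebra_simps)
    also have "\<dots> \<in> span S" by (rule span_diff[OF a span_scale[OF b]])
    finally have "z - (a / b) *s z0 \<in> Y"
      using assms(1,5) z z0 by (auto intro: subspace_diff subspace_scale)
    then show ?thesis ..
  qed
  have uniq: "c = d" if "z - c *s z0 \<in> Y" "z - d *s z0 \<in> Y" for z c d
  proof (rule ccontr)
    assume "c \<noteq> d"
    have "(z - d *s z0) - (z - c *s z0) = (c - d) *s z0" by (simp add: algebra_simps)
    then have "(c - d) *s z0 \<in> Y" using subspace_diff[OF assms(2) that(2,1)] by simp
    then have "inverse (c - d) *s ((c - d) *s z0) \<in> Y" by (rule subspace_scale[OF assms(2)])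
    then show False using \<open>c \<noteq> d\<close> z0 by simp
  qed
  define g where "g z = (THE c. z - c *s z0 \<in> Y)" for z
  have gI: "g z = c" if "z - c *s z0 \<in> Y" for z c
    unfolding g_def using that uniq by (intro the_equality) auto
  have g: "z - g z *s z0 \<in> Y" if "z \<in> Z" for z using ex[OF that] gI by auto
  have "functional_on Z Y g"
    unfolding functional_on_def
  proof (intro conjI ballI allI)
    fix x y assume "x \<in> Z" "y \<in> Z"
    then have "(x - g x *s z0) + (y - g y *s z0) \<in> Y" by (intro subspace_add assms g)
    then show "g (x + y) = g x + g y" by (intro gI) (simp add: algebra_simps)
  next
    fix c x assume "x \<in> Z"
    then have "c *s (x - g x *s z0) \<in> Y" by (intro subspace_scale assms g)
    then show "g (c *s x) = c * g x" by (intro gI) (simp add: algebra_simps)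
  qed (auto intro: gI)
  then have "frame Z Y [(z0, g)]" using g z0 by (auto simp: frame_def)
  then show ?thesis ..
qed

text \<open>Generators are removed one at a time; each of them contributes at most one member of the frame.\<close>

lemma frame_exists:
  assumes "subquotient Z B" "finite_codim Z B"
  shows "\<exists>ps. frame Z B ps"
proof -
  obtain E where "finite E" "Z \<subseteq> span (E \<union> B)" using assms(2) by (auto simp: finite_codim_def)
  then show ?thesis using assms(1)
  proof (induction E arbitrary: Z)
    case empty
    then have "span B = B" by (simp add: subquotient_def)
    with empty have "frame Z B []"
      using span_eq_iff by (auto simp: frame_def subquotient_def)
    then show ?case ..
  next
    case (insert e E)
    define Y where "Y = Z \<inter> span (E \<union> B)"
    have sq: "subquotient Z Y" "subquotient Y B"
      using insert.prems(2) by (auto simp: subquotient_def Y_def subspace_inter intro: span_base)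
    obtain ps where ps: "frame Y B ps" using insert.IH[of Y] sq by (auto simp: Y_def)
    obtain qs where qs: "frame Z Y qs"
      using span_insert_frame[of Z Y e "E \<union> B"] sq insert.prems
      by (auto simp: Y_def subquotient_def)
    show ?case using frame_append(1)[OF sq qs ps] by blast
  qed
qed

lemma finite_codim_if_frame:
  assumes "subquotient Z B" "frame Z B ps"
  shows "finite_codim Z B"
  unfolding finite_codim_def
proof (intro exI conjI subsetI)
  fix z assume "z \<in> Z"
  then have "z - frame_sum ps z \<in> span (fst ` set ps \<union> B)"
    using assms(2) by (intro span_base) (auto simp: frame_def)
  moreover have "frame_sum ps z \<in> span (fst ` set ps \<union> B)"
    by (rule frame_sum_in) (force intro: span_base)+
  ultimately have "(z - frame_sum ps z) + frame_sum ps z \<in> span (fst ` set ps \<union> B)"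
    by (rule span_add)
  then show "z \<in> span (fst ` set ps \<union> B)" by simp
qed simp

lemma finite_codim_mono:
  assumes "finite_codim Z B" "Z' \<subseteq> Z" "B \<subseteq> B'"
  shows "finite_codim Z' B'"
proof -
  obtain E where E: "finite E" "Z \<subseteq> span (E \<union> B)" using assms(1) by (auto simp: finite_codim_def)
  have "span (E \<union> B) \<subseteq> span (E \<union> B')" using assms(3) by (intro span_mono) auto
  with E assms(2) show ?thesis by (auto simp: finite_codim_def)
qed

lemma finite_codim_trans:
  assumes "finite_codim Z Y" "finite_codim Y B"
  shows "finite_codim Z B"
proof -
  obtain E where E: "finite E" "Z \<subseteq> span (E \<union> Y)" using assms(1) by (auto simp: finite_codim_def)
  obtain F where F: "finite F" "Y \<subseteq> span (F \<union> B)" using assms(2) by (auto simp: finite_codim_def)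
  have "span (F \<union> B) \<subseteq> span ((E \<union> F) \<union> B)" by (rule span_mono) auto
  then have "E \<union> Y \<subseteq> span ((E \<union> F) \<union> B)" using F by (auto intro: span_base)
  then have "span (E \<union> Y) \<subseteq> span ((E \<union> F) \<union> B)" by (rule span_minimal) simp
  with E F show ?thesis unfolding finite_codim_def by (intro exI[of _ "E \<union> F"]) auto
qed

lemma finite_codim_image:
  assumes "finite_codim Z B" "linear_endo f"
  shows "finite_codim (f ` Z) (f ` B)"
proof -
  obtain E where E: "finite E" "Z \<subseteq> span (E \<union> B)" using assms(1) by (auto simp: finite_codim_def)
  have "f ` Z \<subseteq> span (f ` E \<union> f ` B)"
    using E module_hom.span_image[OF assms(2)] by (metis image_Un image_mono)
  then show ?thesis using E(1) by (auto simp: finite_codim_def)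
qed

lemma finite_codim_plus:
  assumes "finite_codim Z B" "linear_endo f" "\<And>b. b \<in> B \<Longrightarrow> f b \<in> B'"
    "\<And>z'. z' \<in> Z' \<Longrightarrow> \<exists>z\<in>Z. z' - f z \<in> B'"
  shows "finite_codim Z' B'"
proof -
  have "finite_codim (f ` Z) B'"
    using finite_codim_mono[OF finite_codim_image[OF assms(1,2)] order_refl] assms(3) by blast
  then obtain E where E: "finite E" "f ` Z \<subseteq> span (E \<union> B')" by (auto simp: finite_codim_def)
  have "Z' \<subseteq> span (E \<union> B')"
  proof
    fix z' assume "z' \<in> Z'"
    then obtain z where z: "z \<in> Z" "z' - f z \<in> B'" using assms(4) by blast
    then have "(z' - f z) + f z \<in> span (E \<union> B')"
      using E(2) by (intro span_add) (auto intro: span_base)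
    then show "z' \<in> span (E \<union> B')" by simp
  qed
  with E(1) show ?thesis by (auto simp: finite_codim_def)
qed

lemma qtrace_additive:
  assumes "subquotient Z Y" "subquotient Y B" "finite_codim Z B"
    "preserves T Z Y" "preserves T Y B"
  shows "qtrace Z B T = qtrace Z Y T + qtrace Y B T"
proof -
  have sub: "subquotient Z B" "preserves T Z B"
    using assms by (auto simp: subquotient_def preserves_def)
  have "finite_codim Z Y" "finite_codim Y B"
    using finite_codim_mono[OF assms(3)] assms(1,2) by (auto simp: subquotient_def)
  then obtain qs ps where f: "frame Z Y qs" "frame Y B ps"
    using frame_exists assms(1,2) by blast
  note fa = frame_append[OF assms(1,2) f]
  show ?thesis
    unfolding qtrace_eq[OF sub fa(1)] qtrace_eq[OF assms(1,4) f(1)] qtrace_eq[OF assms(2,5) f(2)]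
    using assms(4) by (intro fa(2)) (auto simp: preserves_def)
qed

lemma frame_pullback:
  assumes "subquotient Z1 B1" "subquotient Z2 B2" "linear_endo f"
    "\<And>z. z \<in> Z1 \<Longrightarrow> f z \<in> Z2" "\<And>z. z \<in> Z1 \<Longrightarrow> f z \<in> B2 \<longleftrightarrow> z \<in> B1"
    "\<And>v g. (v, g) \<in> set ps \<Longrightarrow> r v \<in> Z1 \<and> v - f (r v) \<in> B2"
    "frame Z2 B2 ps"
  shows "frame Z1 B1 (map (\<lambda>(v, g). (r v, \<lambda>z. g (f z))) ps)"
proof -
  interpret f: module_hom scale scale f by (rule assms(3))
  have s: "subspace Z1" "subspace B1" "subspace Z2" "subspace B2" "B1 \<subseteq> Z1" "B2 \<subseteq> Z2"
    using assms(1,2) by (auto simp: subquotient_def)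
  let ?qs = "map (\<lambda>(v, g). (r v, \<lambda>z. g (f z))) ps"
  have diff: "frame_sum ps (f z) - f (frame_sum ?qs z) \<in> B2" for z
    using assms(6)
  proof (induction ps)
    case Nil
    then show ?case using subspace_0[OF s(4)] by simp
  next
    case (Cons p ps)
    obtain v g where p: "p = (v, g)" by (cases p)
    have "g (f z) *s (v - f (r v)) + (frame_sum ps (f z) -
      f (frame_sum (map (\<lambda>(v, g). (r v, \<lambda>z. g (f z))) ps) z)) \<in> B2"
      using Cons p by (intro subspace_add[OF s(4)] subspace_scale[OF s(4)] Cons.IH) auto
    then show ?case by (simp add: p f.add f.scale algebra_simps)
  qed
  have fs: "frame_sum ?qs z \<in> Z1" for z
    using assms(6) by (intro frame_sum_in s) force
  show ?thesis
    unfolding frame_def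
  proof (intro conjI ballI)
    fix p assume "p \<in> set ?qs"
    then obtain v g where p: "p = (r v, \<lambda>z. g (f z))" "(v, g) \<in> set ps" by auto
    then have g: "functional_on Z2 B2 g" using assms(7) by (auto simp: frame_def)
    have "functional_on Z1 B1 (\<lambda>z. g (f z))"
      by (rule functional_on_comp[OF g assms(3)]) (use assms(4,5) s in auto)
    then show "case p of (v, g) \<Rightarrow> v \<in> Z1 \<and> functional_on Z1 B1 g"
      using p assms(6) by auto
  next
    fix z assume z: "z \<in> Z1"
    have "f (z - frame_sum ?qs z) = (f z - frame_sum ps (f z)) + (frame_sum ps (f z) - f (frame_sum ?qs z))"
      by (simp add: f.diff)
    also have "\<dots> \<in> B2"
      using z assms(4,7) diff by (intro subspace_add[OF s(4)]) (auto simp: frame_def)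
    finally show "z - frame_sum ?qs z \<in> B1"
      using assms(5) z fs s(1) by (auto intro: subspace_diff)
  qed
qed

text \<open>The hypotheses say that \<open>f\<close> induces an injection $Z_1/B_1 \to Z_2/B_2$. A frame of its image is
  pulled back along \<open>f\<close>.\<close>

lemma finite_codim_pullback:
  assumes "subquotient Z1 B1" "subquotient Z2 B2" "linear_endo f"
    "\<And>z. z \<in> Z1 \<Longrightarrow> f z \<in> Z2" "\<And>z. z \<in> Z1 \<Longrightarrow> f z \<in> B2 \<longleftrightarrow> z \<in> B1"
    "finite_codim Z2 B2"
  shows "finite_codim Z1 B1"
proof -
  interpret f: module_hom scale scale f by (rule assms(3))
  have s: "subspace Z1" "subspace B1" "subspace Z2" "subspace B2" "B1 \<subseteq> Z1" "B2 \<subseteq> Z2"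
    using assms(1,2) by (auto simp: subquotient_def)
  define Z where "Z = {x + y | x y. x \<in> f ` Z1 \<and> y \<in> B2}"
  have "subspace Z" unfolding Z_def by (intro subspace_sums f.subspace_image s)
  moreover have "B2 \<subseteq> Z" unfolding Z_def using f.zero subspace_0[OF s(1)] by force
  moreover have ZZ2: "Z \<subseteq> Z2" using assms(4) s(6) subspace_add[OF s(3)] by (auto simp: Z_def)
  ultimately have sq: "subquotient Z B2" using s by (auto simp: subquotient_def)
  have fZ: "f z \<in> Z" if "z \<in> Z1" for z using that subspace_0[OF s(4)] unfolding Z_def by force
  obtain ps where ps: "frame Z B2 ps"
    using frame_exists[OF sq finite_codim_mono[OF assms(6) ZZ2]] by auto
  have "\<forall>v\<in>Z. \<exists>u. u \<in> Z1 \<and> v - f u \<in> B2" unfolding Z_def by force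
  then obtain r where r: "\<And>v. v \<in> Z \<Longrightarrow> r v \<in> Z1 \<and> v - f (r v) \<in> B2" by metis
  have "frame Z1 B1 (map (\<lambda>(v, g). (r v, \<lambda>z. g (f z))) ps)"
    by (rule frame_pullback[OF assms(1) sq assms(3) fZ assms(5) _ ps])
      (use ps r in \<open>auto simp: frame_def\<close>)
  then show ?thesis by (rule finite_codim_if_frame[OF assms(1)])
qed

text \<open>A frame of the target is pulled back along the isomorphism $Z_1/B_1 \to Z_2/B_2$ induced by \<open>f\<close>.
  The scalars allow \<open>f\<close> to intertwine the operators only up to a factor. Multiplication by a variable $x_i$ brings in the factor $t_i$, and the
  differential the factor $-1$.\<close>

lemma qtrace_iso:
  assumes "subquotient Z1 B1" "subquotient Z2 B2" "linear_endo f"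
    "\<And>z. z \<in> Z1 \<Longrightarrow> f z \<in> Z2" "\<And>z. z \<in> Z1 \<Longrightarrow> f z \<in> B2 \<longleftrightarrow> z \<in> B1"
    "\<And>y. y \<in> Z2 \<Longrightarrow> \<exists>z\<in>Z1. y - f z \<in> B2"
    "finite_codim Z2 B2" "preserves T1 Z1 B1" "preserves T2 Z2 B2"
    "\<And>z. z \<in> Z1 \<Longrightarrow> a *s f (T1 z) - b *s T2 (f z) \<in> B2"
  shows "a * qtrace Z1 B1 T1 = b * qtrace Z2 B2 T2"
proof -
  interpret T2: module_hom scale scale T2 using assms(9) by (simp add: preserves_def)
  have s: "subspace Z2" using assms(2) by (auto simp: subquotient_def)
  obtain ps where ps: "frame Z2 B2 ps" using frame_exists assms(2,7) by blast
  obtain r where r: "\<And>v. v \<in> Z2 \<Longrightarrow> r v \<in> Z1 \<and> v - f (r v) \<in> B2" using assms(6) by metis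
  have psD: "v \<in> Z2" "functional_on Z2 B2 g" if "(v, g) \<in> set ps" for v g
    using ps that by (auto simp: frame_def)
  let ?qs = "map (\<lambda>(v, g). (r v, \<lambda>z. g (f z))) ps"
  have fr: "frame Z1 B1 ?qs"
    by (rule frame_pullback[OF assms(1-5) _ ps]) (use psD r in auto)
  have eq: "a * g (f (T1 (r v))) = b * g (T2 v)" if vg: "(v, g) \<in> set ps" for v g
  proof -
    note v = psD(1)[OF vg] and g = psD(2)[OF vg]
    note rv = conjunct1[OF r[OF v]] and rv' = conjunct2[OF r[OF v]]
    have m: "f (T1 (r v)) \<in> Z2" "T2 (f (r v)) \<in> Z2" "T2 v \<in> Z2"
      using rv v assms(4,8,9) by (auto simp: preserves_def)
    have "g (T2 v - T2 (f (r v))) = 0"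
      using rv' assms(9) functional_onD(3)[OF g] by (metis T2.diff preserves_def)
    then have 1: "g (T2 v) = g (T2 (f (r v)))" by (simp add: functional_on_diff[OF g s] m)
    have "0 = g (a *s f (T1 (r v)) - b *s T2 (f (r v)))"
      using assms(10)[OF rv] functional_onD(3)[OF g] by simp
    also have "\<dots> = g (a *s f (T1 (r v))) - g (b *s T2 (f (r v)))"
      by (intro functional_on_diff[OF g s] subspace_scale[OF s] m)
    finally show ?thesis using 1 functional_onD(2)[OF g] m by auto
  qed
  have "a * frame_trace ?qs T1 = (\<Sum>(v, g)\<leftarrow>ps. a * g (f (T1 (r v))))"
    by (simp add: frame_trace_def sum_list_const_mult[symmetric] o_def case_prod_beta')
  also have "\<dots> = (\<Sum>(v, g)\<leftarrow>ps. b * g (T2 v))"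
    by (intro arg_cong[of _ _ sum_list] map_cong refl) (use eq in auto)
  also have "\<dots> = b * frame_trace ps T2"
    by (simp add: frame_trace_def sum_list_const_mult[symmetric] o_def case_prod_beta')
  finally show ?thesis
    using qtrace_eq[OF assms(1,8) fr] qtrace_eq[OF assms(2,9) ps] by simp
qed

text \<open>Traces add up over a decomposition: $Z/B$ is the direct sum of the image and the kernel of the
  projector \<open>P\<close>. With $Y = \{z \in Z \mid Pz \in B\}$, the map \<open>P\<close> identifies $Z/Y$ with the first
  summand, and the inclusion identifies the second summand with $Y/B$.\<close>

lemma qtrace_eigenspaces:
  assumes "subquotient Z B" "finite_codim Z B" "preserves T Z B" "preserves P Z B"
    "\<And>z. z \<in> Z \<Longrightarrow> P (P z) = P z" "\<And>z. z \<in> Z \<Longrightarrow> P (T z) = T (P z)"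
  shows "qtrace Z B T =
    qtrace {z \<in> Z. P z = z} {b \<in> B. P b = b} T + qtrace {z \<in> Z. P z = 0} {b \<in> B. P b = 0} T"
proof -
  interpret P: module_hom scale scale P using assms(4) by (simp add: preserves_def)
  interpret T: module_hom scale scale T using assms(3) by (simp add: preserves_def)
  have s: "subspace Z" "subspace B" "B \<subseteq> Z" using assms(1) by (auto simp: subquotient_def)
  note PD = preservesD[OF assms(4)] and TD = preservesD[OF assms(3)]
  define Y where "Y = {z \<in> Z. P z \<in> B}"
  have sub: "subspace {z \<in> W. P z = z}" "subspace {z \<in> W. P z = 0}" "subspace {z \<in> W. P z \<in> B}"
    if "subspace W" for W
    using that s(2) by (auto simp: subspace_def P.add P.scale)
  have sq: "subquotient Z Y" "subquotient Y B"
    "subquotient {z \<in> Z. P z = z} {b \<in> B. P b = b}"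
    "subquotient {z \<in> Z. P z = 0} {b \<in> B. P b = 0}"
    using s sub PD by (auto simp: subquotient_def Y_def)
  have pr: "preserves T Z Y" "preserves T Y B"
    "preserves T {z \<in> Z. P z = z} {b \<in> B. P b = b}"
    "preserves T {z \<in> Z. P z = 0} {b \<in> B. P b = 0}"
    using TD s assms(6) by (auto simp: preserves_def Y_def)
  have fin: "finite_codim {z \<in> Z. P z = z} {b \<in> B. P b = b}" "finite_codim Y B"
    "finite_codim Z Y"
  proof -
    show "finite_codim {z \<in> Z. P z = z} {b \<in> B. P b = b}"
      by (rule finite_codim_pullback[OF sq(3) assms(1) linear_endo_ident _ _ assms(2)]) auto
    show "finite_codim Y B" "finite_codim Z Y"
      using finite_codim_mono[OF assms(2)] sq(1,2) by (auto simp: subquotient_def)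
  qed
  have "1 * qtrace Z Y T = 1 * qtrace {z \<in> Z. P z = z} {b \<in> B. P b = b} T"
  proof (rule qtrace_iso[OF sq(1,3) PD(1) _ _ _ fin(1) pr(1,3)])
    show "\<exists>z\<in>Z. y - P z \<in> {b \<in> B. P b = b}" if "y \<in> {z \<in> Z. P z = z}" for y
      using that subspace_0[OF s(2)] by (intro bexI[of _ y]) auto
    show "1 *s P (T z) - 1 *s T (P z) \<in> {b \<in> B. P b = b}" if "z \<in> Z" for z
      using that subspace_0[OF s(2)] assms(6) by simp
  qed (use assms(5) PD Y_def in auto)
  moreover have "1 * qtrace {z \<in> Z. P z = 0} {b \<in> B. P b = 0} T = 1 * qtrace Y B T"
  proof (rule qtrace_iso[OF sq(4,2) linear_endo_ident _ _ _ fin(2) pr(4,2)])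
    show "\<exists>z\<in>{z \<in> Z. P z = 0}. y - z \<in> B" if "y \<in> Y" for y
      using that assms(5) PD s by (intro bexI[of _ "y - P y"])
        (auto simp: Y_def P.diff intro: subspace_diff)
    show "1 *s T z - 1 *s T z \<in> B" for z using subspace_0[OF s(2)] by simp
  qed (use Y_def subspace_0[OF s(2)] in auto)
  ultimately show ?thesis using qtrace_additive[OF sq(1,2) assms(2) pr(1,2)] by simp
qed

text \<open>Let $Y$ be the span of \<open>B\<close> and of all generators but one. If some \<open>W c\<close> lies in $Y$, one generator
  fewer suffices from there on. Otherwise the induction is applied to the subspaces $W_a \cap Y$: as
  $W_{a+1}$ has an element \<open>z0\<close> outside $Y$, every element of $W_a$ is the sum of a multiple of \<open>z0\<close>
  and an element of $W_a \cap Y$.\<close>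

lemma finite_codim_stable:
  assumes "finite_codim (W 0) B" "subspace B"
    "\<And>a. subspace (W a)" "\<And>a. B \<subseteq> W a" "\<And>a. W (Suc a) \<subseteq> W a"
  shows "\<exists>a. W (Suc a) = W a"
proof -
  obtain E where E: "finite E" "W 0 \<subseteq> span (E \<union> B)" using assms(1) by (auto simp: finite_codim_def)
  then show ?thesis using assms(3-5)
  proof (induction E arbitrary: W)
    case empty
    have "span ({} \<union> B) = B" using assms(2) by simp
    moreover have "W (Suc 0) \<subseteq> W 0" using empty by blast
    ultimately have "W (Suc 0) = W 0" using empty by (metis subset_antisym)
    then show ?case ..
  next
    case (insert e E)
    define Y where "Y = span (E \<union> B)"
    have Y: "subspace Y" "B \<subseteq> Y" by (auto simp: Y_def intro: span_base)
    have W0: "W a \<subseteq> W 0" for a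
      by (induction a) (use insert.prems(4) in blast)+
    show ?case
    proof (cases "\<exists>c. W c \<subseteq> Y")
      case True
      then obtain c where "W c \<subseteq> Y" ..
      then have "\<exists>a. W (Suc a + c) = W (a + c)"
        using insert.IH[of "\<lambda>a. W (a + c)"] insert.prems by (simp add: Y_def)
      then show ?thesis by auto
    next
      case False
      have "\<exists>a. W (Suc a) \<inter> Y = W a \<inter> Y"
      proof (rule insert.IH)
        show "W 0 \<inter> Y \<subseteq> span (E \<union> B)" by (simp add: Y_def)
        show "subspace (W a \<inter> Y)" "B \<subseteq> W a \<inter> Y" "W (Suc a) \<inter> Y \<subseteq> W a \<inter> Y" for a
          using insert.prems(2)[of a] insert.prems(3)[of a] insert.prems(4)[of a] Y
          by (blast intro: subspace_inter)+
      qed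
      then obtain a where a: "W (Suc a) \<inter> Y = W a \<inter> Y" ..
      obtain z0 where z0: "z0 \<in> W (Suc a)" "z0 \<notin> Y" using False by blast
      have "W a \<subseteq> W (Suc a)"
      proof
        fix z assume z: "z \<in> W a"
        have ins: "v \<in> span (insert e (E \<union> B))" if "v \<in> W b" for v b
          using that W0[of b] insert.prems(1) by auto
        obtain p where p: "z - p *s e \<in> Y"
          using ins[OF z] unfolding span_breakdown_eq Y_def by blast
        obtain r where r: "z0 - r *s e \<in> Y"
          using ins[OF z0(1)] unfolding span_breakdown_eq Y_def by blast
        have "r \<noteq> 0" using r z0 by auto
        have "z - (p / r) *s z0 = (z - p *s e) - (p / r) *s (z0 - r *s e)"
          using \<open>r \<noteq> 0\<close> by (simp add: algebra_simps)
        also have "\<dots> \<in> Y" by (rule subspace_diff[OF Y(1) p subspace_scale[OF Y(1) r]])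
        finally have "z - (p / r) *s z0 \<in> W a \<inter> Y"
          using z subsetD[OF insert.prems(4) z0(1)] insert.prems(2)[of a]
          by (blast intro: subspace_diff subspace_scale)
        then have "(z - (p / r) *s z0) + (p / r) *s z0 \<in> W (Suc a)"
          using a z0 insert.prems(2) by (intro subspace_add subspace_scale) auto
        then show "z \<in> W (Suc a)" by simp
      qed
      then show ?thesis using insert.prems(4) by blast
    qed
  qed
qed

end

section \<open>Traces on quotient records\<close>

text \<open>The vector spaces of the theorem are records over a carrier, and their quotients consist of cosets,
  whereas frames live in a subspace \<open>Z\<close> of a space whose addition is that of a type class. The map
  \<open>to_V\<close> is an isomorphism from \<open>Z\<close> to \<open>V\<close> which carries \<open>B\<close> to the subspace divided out.\<close>

locale quotient_presentation = linear_space scale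
  for scale :: "'a :: field \<Rightarrow> 'b :: ab_group_add \<Rightarrow> 'b" (infixr "*s" 75) +
  fixes V :: "('a, 'v) module" and Z B :: "'b set" and to_V :: "'b \<Rightarrow> 'v"
  assumes sub: "subquotient Z B"
    and inj: "inj_on to_V Z" and surj: "to_V ` Z = carrier V"
    and to_V_add: "x \<in> Z \<Longrightarrow> y \<in> Z \<Longrightarrow> to_V (x + y) = to_V x \<oplus>\<^bsub>V\<^esub> to_V y"
    and to_V_scale: "x \<in> Z \<Longrightarrow> to_V (c *s x) = c \<odot>\<^bsub>V\<^esub> to_V x"
begin

definition quot :: "('a, 'v set) module" where
  "quot = quotient_space V (to_V ` B)"

text \<open>The coset of \<open>to_V z\<close>, described inside \<open>Z\<close>.\<close>

definition coset :: "'b \<Rightarrow> 'v set" where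
  "coset z = to_V ` (\<lambda>b. b + z) ` B"

lemma subspaces: "subspace Z" "subspace B" "B \<subseteq> Z"
  using sub by (auto simp: subquotient_def)

lemma coset_eq: "z \<in> Z \<Longrightarrow> to_V ` B +>\<^bsub>V\<^esub> to_V z = coset z"
  using subspaces by (auto simp: a_r_coset_def' coset_def to_V_add[symmetric] subset_eq)

lemma coset_eq_iff:
  assumes "x \<in> Z" "y \<in> Z"
  shows "coset x = coset y \<longleftrightarrow> x - y \<in> B"
proof
  assume "coset x = coset y"
  moreover have "to_V x \<in> coset x" using subspace_0[OF subspaces(2)] by (force simp: coset_def)
  ultimately obtain b where b: "b \<in> B" "to_V x = to_V (b + y)" by (auto simp: coset_def)
  then have "x = b + y"
    using inj_onD[OF inj b(2)] assms subspaces by (auto intro: subspace_add)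
  then show "x - y \<in> B" using b by simp
next
  have half: "coset x \<subseteq> coset y" if "x - y \<in> B" for x y
  proof -
    have "b + x = (b + (x - y)) + y" for b by simp
    then show ?thesis using that subspace_add[OF subspaces(2)] unfolding coset_def by blast
  qed
  assume "x - y \<in> B"
  moreover from this have "y - x \<in> B" using subspace_neg[OF subspaces(2)] by fastforce
  ultimately show "coset x = coset y" using half by blast
qed

lemma carrier_quot: "carrier quot = coset ` Z"
  by (auto simp: quot_def quotient_space_def A_RCOSETS_def' surj[symmetric] coset_eq)

lemma coset_mem [simp]: "z \<in> Z \<Longrightarrow> coset z \<in> carrier quot"
  by (simp add: carrier_quot)

lemma zero_quot: "\<zero>\<^bsub>quot\<^esub> = coset 0"
  by (simp add: quot_def quotient_space_def coset_def)

lemma add_quot: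
  assumes "x \<in> Z" "y \<in> Z"
  shows "coset x \<oplus>\<^bsub>quot\<^esub> coset y = coset (x + y)"
proof -
  have sum: "to_V (b + x) \<oplus>\<^bsub>V\<^esub> to_V (c + y) = to_V ((b + c) + (x + y))" if "b \<in> B" "c \<in> B" for b c
  proof -
    have "b + x \<in> Z" "c + y \<in> Z" using that assms subspaces by (auto intro: subspace_add)
    then show ?thesis by (simp add: to_V_add[symmetric] algebra_simps)
  qed
  have "coset x \<oplus>\<^bsub>quot\<^esub> coset y = (\<Union>b\<in>B. \<Union>c\<in>B. {to_V ((b + c) + (x + y))})"
    by (simp add: quot_def quotient_space_def set_add_def' coset_def sum cong: SUP_cong)
  also have "\<dots> = coset (x + y)"
  proof
    show "(\<Union>b\<in>B. \<Union>c\<in>B. {to_V ((b + c) + (x + y))}) \<subseteq> coset (x + y)"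
      unfolding coset_def using subspace_add[OF subspaces(2)] by blast
    show "coset (x + y) \<subseteq> (\<Union>b\<in>B. \<Union>c\<in>B. {to_V ((b + c) + (x + y))})"
      using subspace_0[OF subspaces(2)] by (force simp: coset_def)
  qed
  finally show ?thesis .
qed

lemma UN_cosets:
  assumes "z \<in> Z" "\<And>b. b \<in> B \<Longrightarrow> to_V ` B +>\<^bsub>V\<^esub> f (to_V (b + z)) = c"
  shows "(\<Union>x\<in>coset z. to_V ` B +>\<^bsub>V\<^esub> f x) = c"
  using assms subspace_0[OF subspaces(2)] by (auto simp: coset_def)

lemma smult_quot:
  assumes z: "z \<in> Z"
  shows "c \<odot>\<^bsub>quot\<^esub> coset z = coset (c *s z)"
proof -
  have "(\<Union>x\<in>coset z. to_V ` B +>\<^bsub>V\<^esub> (c \<odot>\<^bsub>V\<^esub> x)) = coset (c *s z)"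
  proof (rule UN_cosets[OF z])
    fix b assume b: "b \<in> B"
    have m: "b + z \<in> Z" using b z subspaces by (auto intro: subspace_add)
    then have "to_V ` B +>\<^bsub>V\<^esub> (c \<odot>\<^bsub>V\<^esub> to_V (b + z)) = coset (c *s (b + z))"
      using subspace_scale[OF subspaces(1)] by (simp add: to_V_scale[symmetric] coset_eq)
    also have "\<dots> = coset (c *s z)"
      using subspace_scale[OF subspaces(2) b, of c]
        coset_eq_iff[OF subspace_scale[OF subspaces(1) m, of c] subspace_scale[OF subspaces(1) z, of c]]
      by (simp add: scale_right_distrib)
    finally show "to_V ` B +>\<^bsub>V\<^esub> (c \<odot>\<^bsub>V\<^esub> to_V (b + z)) = coset (c *s z)" .
  qed
  then show ?thesis by (simp add: quot_def quotient_space_def)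
qed

lemma map_quot:
  assumes z: "z \<in> Z" and T: "preserves T Z B" "\<And>z. z \<in> Z \<Longrightarrow> TV (to_V z) = to_V (T z)"
  shows "quotient_map V (to_V ` B) TV (coset z) = coset (T z)"
  unfolding quotient_map_def
proof (rule UN_cosets[OF z])
  fix b assume b: "b \<in> B"
  have m: "b + z \<in> Z" "T (b + z) \<in> Z" "T z \<in> Z" "T b \<in> B"
    using b z subspaces T(1) by (auto simp: preserves_def intro: subspace_add)
  have "T (b + z) = T b + T z" by (rule module_hom.add[OF preservesD(1)[OF T(1)]])
  then show "to_V ` B +>\<^bsub>V\<^esub> TV (to_V (b + z)) = coset (T z)"
    using m by (simp add: T(2) coset_eq coset_eq_iff)
qed

lemma vectorspace_quot: "vectorspace class_ring quot"
proof -
  have cl: "x + y \<in> Z" "c *s x \<in> Z" "- x \<in> Z" "0 \<in> Z" if "x \<in> Z" "y \<in> Z" for x y c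
    using that subspaces subspace_add subspace_scale subspace_neg subspace_0 by auto
  have f: "field (class_ring :: 'a ring)" by (rule class_field.field_axioms)
  have "abelian_group quot"
  proof (rule abelian_groupI)
    show "\<exists>y\<in>carrier quot. y \<oplus>\<^bsub>quot\<^esub> x = \<zero>\<^bsub>quot\<^esub>" if "x \<in> carrier quot" for x
    proof -
      from that obtain z where z: "z \<in> Z" "x = coset z" by (auto simp: carrier_quot)
      then show ?thesis
        using cl by (intro bexI[of _ "coset (- z)"]) (auto simp: add_quot zero_quot)
    qed
  qed (use subspace_0[OF subspaces(1)] in \<open>auto simp: carrier_quot add_quot zero_quot cl algebra_simps\<close>)
  moreover have "cring (class_ring :: 'a ring)" by (rule class_cring.cring_axioms)
  ultimately have "Module.module (class_ring :: 'a ring) quot"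
    by (intro moduleI) (auto simp: carrier_quot add_quot smult_quot cl scale_left_distrib
        scale_right_distrib)
  then show ?thesis using f by (simp add: vectorspace_def)
qed

sublocale Q: vectorspace class_ring quot by (rule vectorspace_quot)

lemma lincomb_quot:
  assumes "finite S" "\<And>v. v \<in> S \<Longrightarrow> r v \<in> Z \<and> coset (r v) = v"
  shows "Q.lincomb c S = coset (\<Sum>v\<in>S. c v *s r v)" "(\<Sum>v\<in>S. c v *s r v) \<in> Z"
proof -
  have "Q.lincomb c S = coset (\<Sum>v\<in>S. c v *s r v) \<and> (\<Sum>v\<in>S. c v *s r v) \<in> Z"
    using assms unfolding Q.lincomb_def
  proof (induction S)
    case empty
    then show ?case using subspace_0[OF subspaces(1)] by (simp add: zero_quot)
  next
    case (insert v S)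
    have m: "c u *s r u \<in> Z" "c u \<odot>\<^bsub>quot\<^esub> u = coset (c u *s r u)" if "u \<in> insert v S" for u
      using insert.prems[OF that] smult_quot[of "r u" "c u"] subspace_scale[OF subspaces(1)] by auto
    have "(\<Oplus>\<^bsub>quot\<^esub>u\<in>insert v S. c u \<odot>\<^bsub>quot\<^esub> u) =
        (c v \<odot>\<^bsub>quot\<^esub> v) \<oplus>\<^bsub>quot\<^esub> (\<Oplus>\<^bsub>quot\<^esub>u\<in>S. c u \<odot>\<^bsub>quot\<^esub> u)"
      using insert.hyps m by (intro Q.finsum_insert) auto
    then show ?case
      using insert m add_quot subspace_add[OF subspaces(1)] by simp
  qed
  then show "Q.lincomb c S = coset (\<Sum>v\<in>S. c v *s r v)" "(\<Sum>v\<in>S. c v *s r v) \<in> Z" by auto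
qed

lemma representatives: "\<exists>r. \<forall>v\<in>carrier quot. r v \<in> Z \<and> coset (r v) = v"
  by (intro bchoice) (auto simp: carrier_quot)

lemma finite_codim_if_fin_dim:
  assumes "Q.fin_dim"
  shows "finite_codim Z B"
proof -
  obtain G where G: "finite G" "G \<subseteq> carrier quot" "Q.span G = carrier quot"
    using assms by (auto simp: Q.fin_dim_def)
  obtain r where r: "\<And>v. v \<in> carrier quot \<Longrightarrow> r v \<in> Z \<and> coset (r v) = v"
    using representatives by auto
  have "Z \<subseteq> span (r ` G \<union> B)"
  proof
    fix z assume z: "z \<in> Z"
    then have "coset z \<in> Q.span G" using G by simp
    then obtain c S where S: "finite S" "S \<subseteq> G" "coset z = Q.lincomb c S" by (auto simp: Q.span_def)
    have rS: "\<And>v. v \<in> S \<Longrightarrow> r v \<in> Z \<and> coset (r v) = v" using S G r by blast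
    have "coset z = coset (\<Sum>v\<in>S. c v *s r v)" "(\<Sum>v\<in>S. c v *s r v) \<in> Z"
      using lincomb_quot[OF S(1) rS] S(3) by simp_all
    then have "z - (\<Sum>v\<in>S. c v *s r v) \<in> B" using coset_eq_iff z by simp
    moreover have "(\<Sum>v\<in>S. c v *s r v) \<in> span (r ` G \<union> B)"
      using S by (intro span_sum span_scale span_base) auto
    ultimately have "(z - (\<Sum>v\<in>S. c v *s r v)) + (\<Sum>v\<in>S. c v *s r v) \<in> span (r ` G \<union> B)"
      by (intro span_add) (auto intro: span_base)
    then show "z \<in> span (r ` G \<union> B)" by simp
  qed
  then show ?thesis using G by (auto simp: finite_codim_def)
qed

lemma fin_dim_if_finite_codim:
  assumes "finite_codim Z B"
  shows "Q.fin_dim"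
proof -
  obtain ps where ps: "frame Z B ps" using frame_exists[OF sub assms] by blast
  define G where "G = (\<lambda>p. coset (fst p)) ` set ps"
  have psZ: "v \<in> Z" if "(v, g) \<in> set ps" for v g using ps that by (auto simp: frame_def)
  have G: "G \<subseteq> carrier quot" using psZ by (auto simp: G_def)
  interpret span: submodule class_ring "Q.span G" quot by (rule Q.span_is_submodule[OF G])
  have "coset (frame_sum qs z) \<in> Q.span G \<and> frame_sum qs z \<in> Z" if "set qs \<subseteq> set ps" for qs z
    using that
  proof (induction qs)
    case Nil
    then show ?case using span.zero_closed subspace_0[OF subspaces(1)] by (simp add: zero_quot)
  next
    case (Cons p qs)
    obtain v g where p: "p = (v, g)" by (cases p)
    then have v: "v \<in> Z" "coset v \<in> Q.span G"
      using Cons.prems psZ Q.in_own_span[OF G] by (force simp: G_def)+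
    then have "coset (g z *s v) \<in> Q.span G" "g z *s v \<in> Z"
      using span.smult_closed[of "g z" "coset v"] smult_quot subspace_scale[OF subspaces(1)] by auto
    then show ?case
      using Cons span.m_closed[of "coset (g z *s v)" "coset (frame_sum qs z)"]
      by (auto simp: p add_quot intro: subspace_add[OF subspaces(1)])
  qed
  then have fs: "coset (frame_sum ps z) \<in> Q.span G" "frame_sum ps z \<in> Z" for z by auto
  have "carrier quot \<subseteq> Q.span G"
  proof
    fix x assume "x \<in> carrier quot"
    then obtain z where z: "z \<in> Z" "x = coset z" by (auto simp: carrier_quot)
    have "z - frame_sum ps z \<in> B" using ps z by (auto simp: frame_def)
    then show "x \<in> Q.span G" using coset_eq_iff[OF z(1) fs(2), of z] fs(1)[of z] z(2) by simp
  qed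
  then show ?thesis
    unfolding Q.fin_dim_def using G span.subset by (intro exI[of _ G]) (auto simp: G_def)
qed

text \<open>Lifting the members of a basis of the quotient to \<open>Z\<close>, together with the coordinate functionals,
  gives a frame of $Z/B$, and its trace is by definition the basis-dependent sum in \<open>vs_trace\<close>.\<close>

lemma vs_trace_quot:
  assumes fin: "finite_codim Z B" and T: "preserves T Z B" "\<And>z. z \<in> Z \<Longrightarrow> TV (to_V z) = to_V (T z)"
  shows "vs_trace quot (quotient_map V (to_V ` B) TV) = qtrace Z B T"
proof -
  define Bs where "Bs = (SOME S. finite S \<and> Q.basis S)"
  have Bs: "finite Bs" "Q.basis Bs"
    using someI_ex[OF Q.finite_basis_exists[OF fin_dim_if_finite_codim[OF fin]]]
    by (auto simp: Bs_def)
  then have BC: "Bs \<subseteq> carrier quot" by (simp add: Q.basis_def)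
  obtain r where r: "\<And>v. v \<in> Bs \<Longrightarrow> r v \<in> Z \<and> coset (r v) = v"
    using representatives BC by (metis subsetD)
  have uniq: "\<exists>!a. a \<in> Bs \<rightarrow>\<^sub>E UNIV \<and> Q.lincomb a Bs = x" if "x \<in> carrier quot" for x
    using Q.basis_criterion[OF Bs(1) BC] Bs(2) that by simp
  define co where "co z v = coordinate quot Bs (coset z) v" for z v
  have co: "co z \<in> Bs \<rightarrow>\<^sub>E UNIV" "Q.lincomb (co z) Bs = coset z" if "z \<in> Z" for z
    using theI'[OF uniq[OF coset_mem[OF that]]] by (auto simp: co_def[abs_def] coordinate_def)
  have lc: "Q.lincomb a Bs = coset (\<Sum>v\<in>Bs. a v *s r v)" "(\<Sum>v\<in>Bs. a v *s r v) \<in> Z" for a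
    using lincomb_quot[OF Bs(1) r] by auto
  have expand: "z - (\<Sum>v\<in>Bs. co z v *s r v) \<in> B" if "z \<in> Z" for z
    using co(2)[OF that] coset_eq_iff[OF that lc(2)[of "co z"]] lc(1)[of "co z"] by metis
  have coI: "co z v = a v" if "z \<in> Z" "z - (\<Sum>v\<in>Bs. a v *s r v) \<in> B" "v \<in> Bs" for z a v
  proof -
    have "Q.lincomb (restrict a Bs) Bs = coset (\<Sum>v\<in>Bs. a v *s r v)"
      unfolding lc(1) by (intro arg_cong[of _ _ coset] sum.cong) auto
    then have "restrict a Bs \<in> Bs \<rightarrow>\<^sub>E UNIV \<and> Q.lincomb (restrict a Bs) Bs = coset z"
      using that coset_eq_iff[OF that(1) lc(2)] by auto
    with uniq[OF coset_mem[OF that(1)]] co[OF that(1)] have "co z = restrict a Bs" by blast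
    then show ?thesis using that(3) by simp
  qed
  have co_fun: "functional_on Z B (\<lambda>z. co z v)" if v: "v \<in> Bs" for v
    unfolding functional_on_def
  proof (intro conjI ballI allI)
    fix x y assume xy: "x \<in> Z" "y \<in> Z"
    have "(x + y) - (\<Sum>v\<in>Bs. (co x v + co y v) *s r v) =
        (x - (\<Sum>v\<in>Bs. co x v *s r v)) + (y - (\<Sum>v\<in>Bs. co y v *s r v))"
      by (simp add: scale_left_distrib sum.distrib)
    also have "\<dots> \<in> B" using xy by (intro subspace_add[OF subspaces(2)] expand)
    finally show "co (x + y) v = co x v + co y v"
      using xy v subspace_add[OF subspaces(1)] by (intro coI[of "x + y" "\<lambda>v. co x v + co y v" v])
  next
    fix c x assume x: "x \<in> Z"
    have "c *s x - (\<Sum>v\<in>Bs. (c * co x v) *s r v) = c *s (x - (\<Sum>v\<in>Bs. co x v *s r v))"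
      by (simp add: scale_right_diff_distrib scale_sum_right)
    also have "\<dots> \<in> B" using x by (intro subspace_scale[OF subspaces(2)] expand)
    finally show "co (c *s x) v = c * co x v"
      using x v subspace_scale[OF subspaces(1)] by (intro coI[of "c *s x" "\<lambda>v. c * co x v" v])
  next
    fix b assume "b \<in> B"
    then show "co b v = 0" using v subspaces by (intro coI[of b "\<lambda>_. 0" v]) auto
  qed
  obtain bs where bs: "set bs = Bs" "distinct bs" using finite_distinct_list[OF Bs(1)] by blast
  let ?ps = "map (\<lambda>v. (r v, \<lambda>z. co z v)) bs"
  have "frame_sum ?ps z = (\<Sum>v\<in>Bs. co z v *s r v)" for z
    using bs by (simp add: frame_sum_def o_def sum_list_distinct_conv_sum_set)
  then have "frame Z B ?ps" using co_fun r expand bs by (auto simp: frame_def)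
  then have "qtrace Z B T = frame_trace ?ps T" by (rule qtrace_eq[OF sub T(1)])
  also have "\<dots> = (\<Sum>v\<in>Bs. co (T (r v)) v)"
    using bs by (simp add: frame_trace_def o_def sum_list_distinct_conv_sum_set)
  also have "\<dots> = (\<Sum>v\<in>Bs. coordinate quot Bs (quotient_map V (to_V ` B) TV v) v)"
  proof (intro sum.cong refl)
    fix v assume v: "v \<in> Bs"
    have "quotient_map V (to_V ` B) TV (coset (r v)) = coset (T (r v))"
      by (rule map_quot[OF _ T]) (use r[OF v] in auto)
    then show "co (T (r v)) v = coordinate quot Bs (quotient_map V (to_V ` B) TV v) v"
      using r[OF v] by (simp add: co_def)
  qed
  also have "\<dots> = vs_trace quot (quotient_map V (to_V ` B) TV)"
    by (simp add: vs_trace_def Bs_def Let_def)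
  finally show ?thesis ..
qed

end

section \<open>Lefschetz numbers of differential spaces\<close>

text \<open>A complex without its grading. The space \<open>U\<close> is a proper subspace of the ambient type in the
  application, so that the properties of \<open>D\<close> are asked on \<open>U\<close> only.\<close>

locale differential_space = linear_space scale
  for scale :: "'a :: field \<Rightarrow> 'b :: ab_group_add \<Rightarrow> 'b" (infixr "*s" 75) +
  fixes U :: "'b set" and D :: "'b \<Rightarrow> 'b"
  assumes subspace_U: "subspace U"
    and linear_D: "linear_endo D"
    and D_in: "u \<in> U \<Longrightarrow> D u \<in> U"
    and D_D: "u \<in> U \<Longrightarrow> D (D u) = 0"
begin

sublocale D: module_hom scale scale D by (rule linear_D)

definition subcomplex :: "'b set \<Rightarrow> bool" where
  "subcomplex N \<longleftrightarrow> subspace N \<and> N \<subseteq> U \<and> (\<forall>n\<in>N. D n \<in> N)"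

text \<open>For a subcomplex \<open>N\<close>, the quotient of \<open>rel_cycles N\<close> by \<open>rel_boundaries N\<close> is the cohomology of
  $U/N$.\<close>

definition rel_cycles :: "'b set \<Rightarrow> 'b set" where
  "rel_cycles N = {c \<in> U. D c \<in> N}"

definition rel_boundaries :: "'b set \<Rightarrow> 'b set" where
  "rel_boundaries N = {D u + n | u n. u \<in> U \<and> n \<in> N}"

text \<open>The parity operator times an even chain map has this property. Its trace on cohomology is the
  supertrace of the chain map.\<close>

definition anticommuting :: "('b \<Rightarrow> 'b) \<Rightarrow> bool" where
  "anticommuting S \<longleftrightarrow> linear_endo S \<and> (\<forall>u\<in>U. S u \<in> U) \<and> (\<forall>u\<in>U. S (D u) = - D (S u))"

lemma subspace_plus_image:
  assumes "subspace N" "subspace W" "linear_endo f"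
  shows "subspace {n + f u | n u. n \<in> N \<and> u \<in> W}"
proof -
  have "{n + f u | n u. n \<in> N \<and> u \<in> W} = {n + v | n v. n \<in> N \<and> v \<in> f ` W}" by blast
  then show ?thesis
    using subspace_sums[OF assms(1) module_hom.subspace_image[OF assms(3,2)]] by simp
qed

lemma rel_subquotient:
  assumes "subcomplex N"
  shows "subquotient (rel_cycles N) (rel_boundaries N)"
    and "N \<subseteq> rel_boundaries N" "rel_cycles N \<subseteq> U"
proof -
  have N: "subspace N" "N \<subseteq> U" "\<And>n. n \<in> N \<Longrightarrow> D n \<in> N"
    using assms by (auto simp: subcomplex_def)
  have "rel_boundaries N = {n + D u | n u. n \<in> N \<and> u \<in> U}"
    by (auto simp: rel_boundaries_def add.commute)
  then have "subspace (rel_boundaries N)"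
    using subspace_plus_image[OF N(1) subspace_U linear_D] by simp
  moreover have "subspace (rel_cycles N)"
    using N(1) subspace_U by (auto simp: rel_cycles_def subspace_def D.add D.scale)
  moreover have "rel_boundaries N \<subseteq> rel_cycles N"
    using N D_in D_D by (auto simp: rel_boundaries_def rel_cycles_def D.add
        intro: subspace_add[OF subspace_U])
  ultimately show "subquotient (rel_cycles N) (rel_boundaries N)" by (simp add: subquotient_def)
  show "N \<subseteq> rel_boundaries N"
    using subspace_0[OF subspace_U] D.zero by (force simp: rel_boundaries_def)
  show "rel_cycles N \<subseteq> U" by (auto simp: rel_cycles_def)
qed

lemma anticommuting_preserves:
  assumes "anticommuting S" "subcomplex N" "\<And>n. n \<in> N \<Longrightarrow> S n \<in> N"
  shows "preserves S (rel_cycles N) (rel_boundaries N)"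
proof -
  interpret S: module_hom scale scale S using assms(1) by (simp add: anticommuting_def)
  have N: "subspace N" "N \<subseteq> U" using assms(2) by (auto simp: subcomplex_def)
  have SU: "S u \<in> U" "S (D u) = - D (S u)" if "u \<in> U" for u
    using that assms(1) by (auto simp: anticommuting_def)
  have "D (S c) \<in> N" if "c \<in> U" "D c \<in> N" for c
    using assms(3)[OF that(2)] subspace_neg[OF N(1)] SU(2)[OF that(1)] by fastforce
  moreover have "S (D u + n) \<in> rel_boundaries N" if "u \<in> U" "n \<in> N" for u n
  proof -
    have "S (D u + n) = D (- S u) + S n" using SU that by (simp add: S.add D.neg)
    moreover have "- S u \<in> U" using SU that subspace_neg[OF subspace_U] by auto
    ultimately show ?thesis using assms(3) that by (auto simp: rel_boundaries_def)
  qed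
  ultimately show ?thesis
    using SU S.module_hom_axioms by (auto simp: preserves_def rel_cycles_def rel_boundaries_def)
qed

text \<open>The differential induces an isomorphism from $U/Z$ to $B/N$ under which \<open>S\<close> becomes $-S$. So these
  two pieces of $N \subseteq B \subseteq Z \subseteq U$ cancel, and $Z/B$ alone remains.\<close>

lemma hopf_trace:
  assumes "subcomplex N" "anticommuting S" "\<And>n. n \<in> N \<Longrightarrow> S n \<in> N" "finite_codim U N"
  shows "qtrace (rel_cycles N) (rel_boundaries N) S = qtrace U N S"
proof -
  interpret S: module_hom scale scale S using assms(2) by (simp add: anticommuting_def)
  have N: "subspace N" "N \<subseteq> U" "\<And>n. n \<in> N \<Longrightarrow> D n \<in> N"
    using assms(1) by (auto simp: subcomplex_def)
  have SU: "S u \<in> U" "S (D u) = - D (S u)" if "u \<in> U" for u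
    using that assms(2) by (auto simp: anticommuting_def)
  let ?Z = "rel_cycles N" and ?B = "rel_boundaries N"
  note rs = rel_subquotient[OF assms(1)] and ap = anticommuting_preserves[OF assms(2,1,3)]
  have sq: "subquotient U ?Z" "subquotient U N" "subquotient ?Z N" "subquotient ?B N"
    using rs subspace_U N by (auto simp: subquotient_def)
  have pr: "preserves S U ?Z" "preserves S ?Z N" "preserves S ?B N"
    using ap assms(3) SU by (auto simp: preserves_def)
  have fin: "finite_codim ?Z N" "finite_codim ?B N"
    using finite_codim_mono[OF assms(4)] rs by (auto simp: subquotient_def)
  have "1 * qtrace U ?Z S = (-1) * qtrace ?B N S"
  proof (rule qtrace_iso[OF sq(1,4) linear_D _ _ _ fin(2) pr(1,3)])
    show "D z \<in> ?B" if "z \<in> U" for z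
      unfolding rel_boundaries_def using that subspace_0[OF N(1)] by force
    show "\<exists>z\<in>U. y - D z \<in> N" if "y \<in> ?B" for y
      using that by (force simp: rel_boundaries_def)
    show "1 *s D (S z) - (- 1) *s S (D z) \<in> N" if "z \<in> U" for z
      using that SU subspace_0[OF N(1)] by simp
  qed (auto simp: rel_cycles_def)
  moreover have "qtrace ?Z N S = qtrace ?Z ?B S + qtrace ?B N S"
    using qtrace_additive[OF rs(1) sq(4) fin(1) ap pr(3)] .
  moreover have "qtrace U N S = qtrace U ?Z S + qtrace ?Z N S"
    using qtrace_additive[OF sq(1,3) assms(4) pr(1,2)] .
  ultimately show ?thesis by simp
qed

text \<open>Multiplication by a non-zero-divisor of $U/N$. The left inverse \<open>q\<close> is required to preserve \<open>N\<close>,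
  and this makes \<open>x\<close> injective modulo \<open>N\<close>; it also turns the connecting map $c \mapsto x^{-1}dc$ of
  the exact triangle into the globally defined linear map $q \circ d$.\<close>

definition regular_modulo :: "'b set \<Rightarrow> ('b \<Rightarrow> 'b) \<Rightarrow> ('b \<Rightarrow> 'b) \<Rightarrow> bool" where
  "regular_modulo N x q \<longleftrightarrow> linear_endo x \<and> linear_endo q \<and> (\<forall>u\<in>U. x u \<in> U \<and> q u \<in> U) \<and>
     (\<forall>n\<in>N. x n \<in> N \<and> q n \<in> N) \<and> (\<forall>u\<in>U. q (x u) = u) \<and> (\<forall>u\<in>U. x (D u) = D (x u))"

definition extend :: "'b set \<Rightarrow> ('b \<Rightarrow> 'b) \<Rightarrow> 'b set" where
  "extend N x = {n + x u | n u. n \<in> N \<and> u \<in> U}"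

lemma subcomplex_extend:
  assumes "subcomplex N" "regular_modulo N x q"
  shows "subcomplex (extend N x)"
proof -
  have N: "subspace N" "N \<subseteq> U" "\<And>n. n \<in> N \<Longrightarrow> D n \<in> N"
    using assms(1) by (auto simp: subcomplex_def)
  have x: "linear_endo x" "\<And>u. u \<in> U \<Longrightarrow> x u \<in> U" "\<And>u. u \<in> U \<Longrightarrow> D (x u) = x (D u)"
    using assms(2) by (auto simp: regular_modulo_def)
  show ?thesis
    unfolding subcomplex_def
  proof (intro conjI ballI)
    show "subspace (extend N x)"
      unfolding extend_def by (rule subspace_plus_image[OF N(1) subspace_U x(1)])
    show "extend N x \<subseteq> U" using N x(2) subspace_add[OF subspace_U] by (auto simp: extend_def)
    fix n assume "n \<in> extend N x"
    then obtain m u where "m \<in> N" "u \<in> U" "D n = D m + x (D u)"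
      using x(3) by (auto simp: extend_def D.add)
    then show "D n \<in> extend N x" using N(3) D_in by (auto simp: extend_def)
  qed
qed

text \<open>Since \<open>x\<close> is null-homotopic, it is zero on $H(U/N)$, so the exact triangle of
  $0 \to U/N \to U/N \to U/(N + xU) \to 0$ makes $H(U/N)$ a subspace of $H(U/(N + xU))$.\<close>

lemma finite_rel_homology_descends:
  assumes "subcomplex N" "regular_modulo N x q" "linear_endo h"
    "\<And>u. u \<in> U \<Longrightarrow> h u \<in> U" "\<And>n. n \<in> N \<Longrightarrow> h n \<in> N"
    "\<And>u. u \<in> U \<Longrightarrow> x u = D (h u) + h (D u)"
    "finite_codim (rel_cycles (extend N x)) (rel_boundaries (extend N x))"
  shows "finite_codim (rel_cycles N) (rel_boundaries N)"
proof (rule finite_codim_pullback[OF rel_subquotient(1)[OF assms(1)]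
      rel_subquotient(1)[OF subcomplex_extend[OF assms(1,2)]] linear_endo_ident _ _ assms(7)])
  have N: "subspace N" "N \<subseteq> U" "\<And>n. n \<in> N \<Longrightarrow> D n \<in> N"
    using assms(1) by (auto simp: subcomplex_def)
  interpret x: module_hom scale scale x using assms(2) by (simp add: regular_modulo_def)
  have x: "x u \<in> U" "q u \<in> U" "D (x u) = x (D u)" "q (x u) = u" if "u \<in> U" for u
    using assms(2) that by (auto simp: regular_modulo_def)
  have q: "q n \<in> N" if "n \<in> N" for n using assms(2) that by (auto simp: regular_modulo_def)
  have Next: "N \<subseteq> extend N x"
    unfolding extend_def using subspace_0[OF subspace_U] x.zero by force
  fix z assume z: "z \<in> rel_cycles N"
  then show "z \<in> rel_cycles (extend N x)" using Next by (auto simp: rel_cycles_def)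
  show "z \<in> rel_boundaries (extend N x) \<longleftrightarrow> z \<in> rel_boundaries N"
  proof
    assume "z \<in> rel_boundaries N"
    then show "z \<in> rel_boundaries (extend N x)" using Next by (auto simp: rel_boundaries_def)
  next
    assume "z \<in> rel_boundaries (extend N x)"
    then obtain v n u where v: "v \<in> U" "n \<in> N" "u \<in> U" "z = D v + (n + x u)"
      by (auto simp: rel_boundaries_def extend_def)
    have "D z = D n + x (D u)" using v D_D by (simp add: D.add x(3))
    moreover have "D z \<in> N" using z by (auto simp: rel_cycles_def)
    ultimately have "x (D u) \<in> N" using subspace_diff[OF N(1) \<open>D z \<in> N\<close> N(3)[OF v(2)]] by simp
    then have Du: "D u \<in> N" using q[of "x (D u)"] x(4) D_in v(3) by simp
    have "z = D (v + h u) + (n + h (D u))"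
      using v assms(6) by (simp add: D.add algebra_simps)
    moreover have "v + h u \<in> U" "n + h (D u) \<in> N"
      using v Du assms(4,5) subspace_add[OF subspace_U] subspace_add[OF N(1)] by auto
    ultimately show "z \<in> rel_boundaries N" by (auto simp: rel_boundaries_def)
  qed
qed

text \<open>The exact triangle of $0 \to U/N \to U/N \to U/(N + xU) \to 0$, taken apart into isomorphisms of
  subquotients. Let $Z/B = H(U/N)$ and $Z'/B' = H(U/(N + xU))$, let $K/B$ be the kernel and $M/B$ the
  image of \<open>x\<close> on $Z/B$, and let $L = Z + xU$. Then \<open>x\<close> induces $Z/K \cong M/B$, the inclusion
  induces $Z/M \cong L/B'$, and the connecting map induces $Z'/L \cong K/B$. They yield
  $\mathrm{tr}(S, M/B) = t\,\mathrm{tr}(S, Z/K)$,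
  $\mathrm{tr}(S, L/B') = \mathrm{tr}(S, Z/M)$ and
  $\mathrm{tr}(S, Z'/L) = -t\,\mathrm{tr}(S, K/B)$. With $k = \mathrm{tr}(S, Z/K)$ and $h = \mathrm{tr}(S, Z/B)$ the
  trace on $Z'/B'$ is $(h - tk) - t(h - k) = (1 - t)h$.\<close>

lemma rel_trace_extend:
  assumes N: "subcomplex N" and x: "regular_modulo N x q"
    and S: "anticommuting S" "\<And>n. n \<in> N \<Longrightarrow> S n \<in> N"
    and t: "t \<noteq> 0" "\<And>u. u \<in> U \<Longrightarrow> S (x u) = t *s x (S u)"
    and fin: "finite_codim (rel_cycles N) (rel_boundaries N)"
  shows "finite_codim (rel_cycles (extend N x)) (rel_boundaries (extend N x))"
    and "qtrace (rel_cycles (extend N x)) (rel_boundaries (extend N x)) S =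
      (1 - t) * qtrace (rel_cycles N) (rel_boundaries N) S"
proof -
  interpret x: module_hom scale scale x using x by (simp add: regular_modulo_def)
  interpret q: module_hom scale scale q using x by (simp add: regular_modulo_def)
  interpret S: module_hom scale scale S using S by (simp add: anticommuting_def)
  have sN: "subspace N" and NU: "N \<subseteq> U" and DN: "\<And>n. n \<in> N \<Longrightarrow> D n \<in> N"
    using N by (auto simp: subcomplex_def)
  have xU: "x u \<in> U" "q u \<in> U" "q (x u) = u" "D (x u) = x (D u)" if "u \<in> U" for u
    using x that by (auto simp: regular_modulo_def)
  have xN: "x n \<in> N" "q n \<in> N" if "n \<in> N" for n
    using x that by (auto simp: regular_modulo_def)
  have reg: "u \<in> N" if "u \<in> U" "x u \<in> N" for u using xN(2)[OF that(2)] xU(3)[OF that(1)] by simp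
  have SU: "S u \<in> U" "S (D u) = - D (S u)" if "u \<in> U" for u
    using that S by (auto simp: anticommuting_def)
  note U = subspace_U
  define N' where "N' = extend N x"
  have N': "subcomplex N'" using subcomplex_extend[OF N x] by (simp add: N'_def)
  have N'I: "n + x u \<in> N'" if "n \<in> N" "u \<in> U" for n u
    using that by (auto simp: N'_def extend_def)
  have N'E: "\<exists>n u. n \<in> N \<and> u \<in> U \<and> c = n + x u" if "c \<in> N'" for c
    using that by (auto simp: N'_def extend_def)
  have NN': "N \<subseteq> N'" using N'I[OF _ subspace_0[OF U]] by auto
  have xN': "x u \<in> N'" if "u \<in> U" for u using N'I[OF subspace_0[OF sN] that] by simp
  have SN': "S c \<in> N'" if "c \<in> N'" for c
  proof -
    from N'E[OF that] obtain n u where c: "n \<in> N" "u \<in> U" "c = n + x u" by blast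
    then have "S c = S n + x (t *s S u)" by (simp add: S.add t(2) x.scale)
    then show ?thesis using c N'I S(2) SU subspace_scale[OF U] by simp
  qed
  define Z B Z' B' where "Z = rel_cycles N" and "B = rel_boundaries N"
    and "Z' = rel_cycles N'" and "B' = rel_boundaries N'"
  note defs = Z_def B_def Z'_def B'_def
  have ZI: "c \<in> Z \<longleftrightarrow> c \<in> U \<and> D c \<in> N" for c by (simp add: Z_def rel_cycles_def)
  have Z'I: "c \<in> Z' \<longleftrightarrow> c \<in> U \<and> D c \<in> N'" for c by (simp add: Z'_def rel_cycles_def)
  have BI: "c \<in> B \<longleftrightarrow> (\<exists>u n. c = D u + n \<and> u \<in> U \<and> n \<in> N)" for c
    by (simp add: B_def rel_boundaries_def)
  have B'I: "c \<in> B' \<longleftrightarrow> (\<exists>u n. c = D u + n \<and> u \<in> U \<and> n \<in> N')" for c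
    by (simp add: B'_def rel_boundaries_def)
  have sZB: "subquotient Z B" "N \<subseteq> B" and sZB': "subquotient Z' B'" "N' \<subseteq> B'"
    using rel_subquotient[OF N] rel_subquotient[OF N'] by (simp_all add: defs)
  have ss: "subspace Z" "subspace B" "subspace Z'" "subspace B'" "B \<subseteq> Z" "B' \<subseteq> Z'"
    using sZB sZB' by (auto simp: subquotient_def)
  have pZB: "preserves S Z B" using anticommuting_preserves[OF S(1) N S(2)] by (simp add: defs)
  have pZB': "preserves S Z' B'" using anticommuting_preserves[OF S(1) N' SN'] by (simp add: defs)
  note SZ = preservesD(2,3)[OF pZB] and SZ' = preservesD(2,3)[OF pZB']
  have finZB: "finite_codim Z B" using fin by (simp add: defs)
  have xZ: "x z \<in> Z" if "z \<in> Z" for z using that xU xN by (auto simp: ZI)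
  have xB: "x b \<in> B" if "b \<in> B" for b
  proof -
    from that obtain u n where "b = D u + n" "u \<in> U" "n \<in> N" by (auto simp: BI)
    then have "x b = D (x u) + x n" by (simp add: x.add xU)
    then have "x b = D (x u) + x n" using xU(4)[OF \<open>u \<in> U\<close>] by simp
    then show ?thesis using xU(1)[OF \<open>u \<in> U\<close>] xN(1)[OF \<open>n \<in> N\<close>] by (auto simp only: BI)
  qed
  define K M L where "K = {y \<in> Z. x y \<in> B}" and "M = {b + x z | b z. b \<in> B \<and> z \<in> Z}"
    and "L = {z + x u | z u. z \<in> Z \<and> u \<in> U}"
  have KI: "y \<in> K \<longleftrightarrow> y \<in> Z \<and> x y \<in> B" for y by (simp add: K_def)
  have MI: "b + x z \<in> M" if "b \<in> B" "z \<in> Z" for b z using that by (auto simp: M_def)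
  have LI: "z + x u \<in> L" if "z \<in> Z" "u \<in> U" for z u using that by (auto simp: L_def)
  have sub: "subspace K" "subspace M" "subspace L"
    using ss U subspace_plus_image[OF ss(2,1)] subspace_plus_image[OF ss(1) U]
    by (auto simp: K_def M_def L_def subspace_def x.add x.scale x.module_hom_axioms)
  have BM: "B \<subseteq> M" using MI[OF _ subspace_0[OF ss(1)]] by auto
  have ZL: "Z \<subseteq> L" using LI[OF _ subspace_0[OF U]] by auto
  have MZ: "M \<subseteq> Z" using ss xZ subspace_add[OF ss(1)] by (auto simp: M_def)
  have BK: "B \<subseteq> K" using ss xB by (auto simp: K_def)
  have xL: "x u \<in> L" if "u \<in> U" for u using LI[OF subspace_0[OF ss(1)] that] by simp
  have B'L: "B' \<subseteq> L"
  proof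
    fix c assume "c \<in> B'"
    then obtain v n u where c: "c = D v + (n + x u)" "v \<in> U" "n \<in> N" "u \<in> U"
      using N'E by (auto simp: B'I) blast
    then have "c = (D v + n) + x u" "D v + n \<in> B" by (auto simp: BI algebra_simps)
    then show "c \<in> L" using LI c(4) ss(5) by auto
  qed
  have LZ': "L \<subseteq> Z'"
  proof
    fix c assume "c \<in> L"
    then obtain z u where c: "c = z + x u" "z \<in> Z" "u \<in> U" by (auto simp: L_def)
    then have "D c = D z + x (D u)" by (simp add: D.add xU)
    then show "c \<in> Z'" using c N'I D_in xU subspace_add[OF U] by (auto simp: ZI Z'I)
  qed
  have sq: "subquotient Z M" "subquotient M B" "subquotient Z K" "subquotient K B"
    "subquotient L B'" "subquotient Z' L"
    using sub ss BM MZ BK B'L LZ' by (auto simp: subquotient_def K_def)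
  have pr: "preserves S Z M" "preserves S M B" "preserves S Z K" "preserves S K B"
    "preserves S L B'" "preserves S Z' L"
  proof -
    have "S c \<in> M" if "c \<in> M" for c
    proof -
      from that obtain b z where c: "b \<in> B" "z \<in> Z" "c = b + x z" by (auto simp: M_def)
      then have "z \<in> U" by (simp add: ZI)
      then have "S c = S b + x (t *s S z)" using c by (simp add: S.add t(2) x.scale)
      then show ?thesis using MI SZ c subspace_scale[OF ss(1)] by simp
    qed
    moreover have "S c \<in> L" if "c \<in> L" for c
    proof -
      from that obtain z u where c: "z \<in> Z" "u \<in> U" "c = z + x u" by (auto simp: L_def)
      then have "S c = S z + x (t *s S u)" using c by (simp add: S.add t(2) x.scale)
      then show ?thesis using LI SZ c SU subspace_scale[OF U] by simp
    qed
    moreover have "S y \<in> K" if "y \<in> K" for y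
    proof -
      have "y \<in> U" using that by (simp add: KI ZI)
      \<comment> \<open>invariance of the kernel of \<open>x\<close> is where \<open>t\<close> must be invertible\<close>
      then have "x (S y) = inverse t *s S (x y)" using t by simp
      also have "\<dots> \<in> B" using that SZ subspace_scale[OF ss(2)] by (auto simp: KI)
      finally show ?thesis using that SZ by (auto simp: KI)
    qed
    ultimately show "preserves S Z M" "preserves S M B" "preserves S Z K" "preserves S K B"
      "preserves S L B'" "preserves S Z' L"
      using pZB pZB' by (auto simp: preserves_def)
  qed
  have fins: "finite_codim Z M" "finite_codim M B" "finite_codim Z K" "finite_codim K B"
    using finite_codim_mono[OF finZB] BM MZ BK by (auto simp: K_def)
  have id0: "c - c \<in> W" if "subspace W" for c W using subspace_0[OF that] by simp

  \<comment> \<open>multiplication by \<open>x\<close> from the coimage to the image\<close>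
  have x_iso: "t * qtrace Z K S = 1 * qtrace M B S"
  proof (rule qtrace_iso[OF sq(3,2) x.module_hom_axioms _ _ _ fins(2) pr(3,2)])
    show "x z \<in> M" if "z \<in> Z" for z using MI[OF subspace_0[OF ss(2)] that] by simp
    show "x z \<in> B \<longleftrightarrow> z \<in> K" if "z \<in> Z" for z using that by (simp add: KI)
    show "\<exists>z\<in>Z. y - x z \<in> B" if "y \<in> M" for y using that by (force simp: M_def)
    show "t *s x (S z) - 1 *s S (x z) \<in> B" if "z \<in> Z" for z
      using that t(2) id0[OF ss(2)] by (simp add: ZI)
  qed

  \<comment> \<open>the cokernel of \<open>x\<close> as a subspace of the cohomology of the quotient\<close>
  have inter: "z \<in> B' \<longleftrightarrow> z \<in> M" if z: "z \<in> Z" for z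
  proof
    assume "z \<in> B'"
    then obtain v n u where c: "z = D v + (n + x u)" "v \<in> U" "n \<in> N" "u \<in> U"
      using N'E by (auto simp: B'I) blast
    have "D z = D n + x (D u)" using c D_D by (simp add: D.add xU)
    moreover have "D z \<in> N" using z by (simp add: ZI)
    ultimately have "x (D u) \<in> N" using subspace_diff[OF sN \<open>D z \<in> N\<close> DN[OF c(3)]] by simp
    then have "u \<in> Z" using reg D_in c(4) by (simp add: ZI)
    moreover have "D v + n \<in> B" using c by (auto simp: BI)
    moreover have "z = (D v + n) + x u" using c by (simp add: algebra_simps)
    ultimately show "z \<in> M" using MI by blast
  next
    assume "z \<in> M"
    then obtain b y where c: "b \<in> B" "y \<in> Z" "z = b + x y" by (auto simp: M_def)
    from c(1) obtain u n where b: "b = D u + n" "u \<in> U" "n \<in> N" by (auto simp: BI)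
    have "z = D u + (n + x y)" using b c by (simp add: algebra_simps)
    moreover have "n + x y \<in> N'" using b c N'I by (simp add: ZI)
    ultimately show "z \<in> B'" using b by (auto simp: B'I)
  qed
  have Lsurj: "\<exists>z\<in>Z. y - z \<in> B'" if "y \<in> L" for y
  proof -
    from that obtain z u where c: "z \<in> Z" "u \<in> U" "y = z + x u" by (auto simp: L_def)
    then have "y - z \<in> B'" using xN'[OF c(2)] sZB'(2) by auto
    then show ?thesis using c(1) by blast
  qed
  have finL: "finite_codim L B'"
    using finite_codim_plus[OF fins(1) linear_endo_ident _ Lsurj] inter MZ by blast
  have id_iso: "1 * qtrace Z M S = 1 * qtrace L B' S"
    by (rule qtrace_iso[OF sq(1,5) linear_endo_ident _ inter Lsurj finL pr(1,5)])
      (use ZL id0[OF ss(4)] in auto)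

  \<comment> \<open>the connecting map\<close>
  define f where "f c = q (D c)" for c
  have f: "linear_endo f" unfolding f_def
    by (intro linear_endoI) (simp_all add: D.add D.scale q.add q.scale)
  have Z'E: "\<exists>n u. n \<in> N \<and> u \<in> U \<and> D c = n + x u \<and> f c = q n + u" if c: "c \<in> Z'" for c
  proof -
    obtain n u where "n \<in> N" "u \<in> U" "D c = n + x u" using N'E[of "D c"] c by (auto simp: Z'I)
    then show ?thesis by (auto simp: f_def q.add xU)
  qed
  have fK: "f c \<in> K" if c: "c \<in> Z'" for c
  proof -
    obtain n u where d: "n \<in> N" "u \<in> U" "D c = n + x u" "f c = q n + u" using Z'E[OF c] by blast
    have cU: "c \<in> U" using c by (simp add: Z'I)
    \<comment> \<open>\<open>D c\<close> is divisible by \<open>x\<close> only modulo \<open>N\<close>; this is the error of \<open>x (q (D c))\<close>\<close>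
    have m: "x (q n) - n \<in> N" using d xN subspace_diff[OF sN] by simp
    have fU: "f c \<in> U" using d subspace_add[OF U subsetD[OF NU xN(2)[OF d(1)]] d(2)] by simp
    have xf: "x (f c) = D c + (x (q n) - n)" using d by (simp add: x.add algebra_simps)
    then have "x (D (f c)) = D (x (q n) - n)"
      using xU(4)[OF fU, symmetric] D_D[OF cU] by (simp add: D.add)
    then have "x (D (f c)) \<in> N" using DN[OF m] by simp
    then have "D (f c) \<in> N" using reg D_in fU by simp
    moreover have "x (f c) \<in> B" using xf cU m by (auto simp: BI)
    ultimately show ?thesis using fU by (simp add: KI ZI)
  qed
  have fker: "f c \<in> B \<longleftrightarrow> c \<in> L" if c: "c \<in> Z'" for c
  proof
    obtain n u where d: "n \<in> N" "u \<in> U" "D c = n + x u" "f c = q n + u" using Z'E[OF c] by blast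
    have cU: "c \<in> U" using c by (simp add: Z'I)
    assume "f c \<in> B"
    then obtain v m where v: "f c = D v + m" "v \<in> U" "m \<in> N" by (auto simp: BI)
    have u: "u = D v + (m - q n)" using d v by (simp add: algebra_simps)
    have "D (c - x v) = n + x (m - q n)" using d v xU by (simp add: D.diff u x.add)
    also have "\<dots> \<in> N" using d v xN by (intro subspace_add[OF sN] xN(1) subspace_diff[OF sN])
    finally have "c - x v \<in> Z" using cU v xU subspace_diff[OF U] by (simp add: ZI)
    then show "c \<in> L" using LI[of "c - x v" v] v by simp
  next
    assume "c \<in> L"
    then obtain z u where d: "c = z + x u" "z \<in> Z" "u \<in> U" by (auto simp: L_def)
    then have "f c = D u + q (D z)" by (simp add: f_def D.add q.add xU D_in)
    then show "f c \<in> B" using d xN by (auto simp: BI ZI)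
  qed
  have fsurj: "\<exists>c\<in>Z'. y - f c \<in> B" if y: "y \<in> K" for y
  proof -
    obtain u n where u: "x y = D u + n" "u \<in> U" "n \<in> N" using y by (auto simp: KI BI)
    have yU: "y \<in> U" using y by (simp add: KI ZI)
    have Du: "D u = - n + x y" using u by simp
    then have "u \<in> Z'" using u yU N'I[of "- n" y] subspace_neg[OF sN] by (auto simp: Z'I)
    moreover have "y - f u = q n" using yU by (simp add: f_def Du q.diff q.add q.neg xU)
    then have "y - f u \<in> B" using u xN sZB(2) by auto
    ultimately show ?thesis by blast
  qed
  have finZ'L: "finite_codim Z' L"
    by (rule finite_codim_pullback[OF sq(6,4) f fK fker fins(4)])
  have f_iso: "1 * qtrace Z' L S = (- t) * qtrace K B S"
  proof (rule qtrace_iso[OF sq(6,4) f fK fker fsurj fins(4) pr(6,4)])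
    fix c assume c: "c \<in> Z'"
    obtain n u where d: "n \<in> N" "u \<in> U" "D c = n + x u" "f c = q n + u" using Z'E[OF c] by blast
    have cU: "c \<in> U" using c by (simp add: Z'I)
    have "D (S c) = - S (D c)" using SU[OF cU] by simp
    also have "\<dots> = - S n - t *s x (S u)" using d by (simp add: S.add t(2))
    finally have fS: "f (S c) = - q (S n) - t *s S u"
      using d SU by (simp add: f_def q.diff q.neg q.scale xU)
    have Sf: "S (f c) = S (q n) + S u" using d by (simp add: S.add)
    have "1 *s f (S c) - (- t) *s S (f c) = t *s S (q n) - q (S n)"
      unfolding fS Sf by (simp add: algebra_simps)
    also have "\<dots> \<in> N" using d xN S(2) by (intro subspace_diff[OF sN] subspace_scale[OF sN]) auto
    finally show "1 *s f (S c) - (- t) *s S (f c) \<in> B" using sZB(2) by auto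
  qed

  have finZ'B': "finite_codim Z' B'" by (rule finite_codim_trans[OF finZ'L finL])
  then show "finite_codim (rel_cycles (extend N x)) (rel_boundaries (extend N x))"
    by (simp add: defs N'_def)
  have "qtrace Z' B' S = qtrace Z' L S + qtrace L B' S"
    by (rule qtrace_additive[OF sq(6,5) finZ'B' pr(6,5)])
  also have "\<dots> = qtrace Z M S - t * qtrace K B S" using id_iso f_iso by simp
  also have "qtrace Z M S = qtrace Z B S - t * qtrace Z K S"
    using qtrace_additive[OF sq(1,2) finZB pr(1,2)] x_iso by simp
  also have "qtrace K B S = qtrace Z B S - qtrace Z K S"
    using qtrace_additive[OF sq(3,4) finZB pr(3,4)] by simp
  finally have "qtrace Z' B' S = (1 - t) * qtrace Z B S" by (simp add: algebra_simps)
  then show "qtrace (rel_cycles (extend N x)) (rel_boundaries (extend N x)) S =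
      (1 - t) * qtrace (rel_cycles N) (rel_boundaries N) S"
    by (simp add: defs N'_def)
qed

end

section \<open>Formal power series\<close>

lemma mcoeff_simps [simp]:
  "mcoeff 0 m = 0" "mcoeff (f + g) m = mcoeff f m + mcoeff g m"
  "mcoeff (f - g) m = mcoeff f m - mcoeff g m" "mcoeff (- f) m = - mcoeff f m"
  for f g :: "('n :: finite, 'k :: comm_ring_1) mfps"
  by (simp_all add: zero_mfps.rep_eq plus_mfps.rep_eq minus_mfps.rep_eq uminus_mfps.rep_eq)

lemma mcoeff_sum: "mcoeff (\<Sum>i\<in>I. f i) m = (\<Sum>i\<in>I. mcoeff (f i) m)"
  for f :: "'i \<Rightarrow> ('n :: finite, 'k :: comm_ring_1) mfps"
  by (induction I rule: infinite_finite_induct) auto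

lemma mcoeff_one: "mcoeff (1 :: ('n :: finite, 'k :: comm_ring_1) mfps) m = (if m = (\<lambda>_. 0) then 1 else 0)"
  by (simp add: one_mfps.rep_eq)

lemma mcoeff_mult: "mcoeff (f * g) m = (\<Sum>a | a \<le> m. mcoeff f a * mcoeff g (m - a))"
  for f g :: "('n :: finite, 'k :: comm_ring_1) mfps"
  by (simp add: times_mfps.rep_eq)

lemma mcoeff_mult_cong:
  fixes f g h :: "('n :: finite, 'k :: comm_ring_1) mfps"
  assumes "\<And>b. b \<le> m \<Longrightarrow> mcoeff g b = mcoeff h b"
  shows "mcoeff (f * g) m = mcoeff (f * h) m"
  unfolding mcoeff_mult
  by (intro sum.cong refl arg_cong2[of _ _ _ _ "(*)"] assms) (auto simp: le_fun_def)

definition var_power :: "'n \<Rightarrow> nat \<Rightarrow> ('n :: finite, 'k :: comm_ring_1) mfps" where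
  "var_power i a = Abs_mfps (\<lambda>m. if m = (\<lambda>_. 0)(i := a) then 1 else 0)"

lemma mcoeff_single_mult:
  fixes g :: "('n :: finite, 'k :: comm_ring_1) mfps"
  shows "mcoeff (Abs_mfps (\<lambda>m. if m = s then c else 0) * g) m = (if s \<le> m then c * mcoeff g (m - s) else 0)"
proof -
  have "mcoeff (Abs_mfps (\<lambda>m. if m = s then c else 0) * g) m =
    (\<Sum>a | a \<le> m. if a = s then c * mcoeff g (m - a) else 0)"
    unfolding mcoeff_mult by (intro sum.cong) auto
  also have "\<dots> = (if s \<le> m then c * mcoeff g (m - s) else 0)"
    by (subst sum.delta) auto
  finally show ?thesis .
qed

lemma mcoeff_var_power_mult:
  fixes f :: "('n :: finite, 'k :: comm_ring_1) mfps"
  shows "mcoeff (var_power i a * f) m = (if a \<le> m i then mcoeff f (m(i := m i - a)) else 0)"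
proof -
  have "((\<lambda>_. 0)(i := a) \<le> m) = (a \<le> m i)" by (auto simp: le_fun_def)
  moreover have "m - (\<lambda>_. 0)(i := a) = m(i := m i - a)" by auto
  ultimately show ?thesis unfolding var_power_def mcoeff_single_mult by simp
qed

lemma mconst_eq: "mconst c = Abs_mfps (\<lambda>m. if m = (\<lambda>_. 0) then c else 0)"
  by (rule mfps_eqI) (simp add: mconst.rep_eq)

lemma mcoeff_mconst_mult [simp]: "mcoeff (mconst c * f) m = c * mcoeff f m"
  for f :: "('n :: finite, 'k :: comm_ring_1) mfps"
  unfolding mconst_eq mcoeff_single_mult by (simp add: le_fun_def fun_diff_def)

lemma var_power_add: "var_power i (a + b) = var_power i a * (var_power i b :: ('n :: finite, 'k :: comm_ring_1) mfps)"
proof (rule mfps_eqI)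
  fix m :: "'n \<Rightarrow> nat"
  have "m = (\<lambda>_. 0)(i := a + b) \<longleftrightarrow> a \<le> m i \<and> m(i := m i - a) = (\<lambda>_. 0)(i := b)"
    by (auto simp: fun_eq_iff)
  then show "mcoeff (var_power i (a + b)) m = mcoeff (var_power i a * (var_power i b :: ('n, 'k) mfps)) m"
    unfolding mcoeff_var_power_mult by (simp add: var_power_def)
qed

text \<open>The quotient of \<open>f\<close> by $x_i^a$ when the terms that are not divisible by $x_i^a$ are dropped. It is
  additive and a left inverse of multiplication by $x_i^a$.\<close>

definition var_quotient :: "'n \<Rightarrow> nat \<Rightarrow> ('n, 'k) mfps \<Rightarrow> ('n, 'k) mfps" where
  "var_quotient i a f = Abs_mfps (\<lambda>m. mcoeff f (m(i := m i + a)))"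

lemma mcoeff_var_quotient [simp]: "mcoeff (var_quotient i a f) m = mcoeff f (m(i := m i + a))"
  by (simp add: var_quotient_def)

lemma var_quotient_var_power_mult: "var_quotient i a (var_power i a * f) = (f :: ('n :: finite, 'k :: comm_ring_1) mfps)"
  by (rule mfps_eqI) (simp add: mcoeff_var_power_mult)

lemma mscale_hom:
  fixes f g :: "('n :: finite, 'k :: comm_ring_1) mfps"
  shows "mscale t (f + g) = mscale t f + mscale t g"
    and "mscale t (f * g) = mscale t f * mscale t g"
    and "mscale t 0 = (0 :: ('n, 'k) mfps)"
    and "mscale t (mconst c * f) = mconst c * mscale t f"
    and "mscale t (var_power i a) = mconst (t i ^ a) * var_power i a"
proof -
  show "mscale t (f * g) = mscale t f * mscale t g"
  proof (rule mfps_eqI)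
    fix m
    have "(\<Prod>i\<in>UNIV. t i ^ m i) = (\<Prod>i\<in>UNIV. t i ^ a i) * (\<Prod>i\<in>UNIV. t i ^ (m - a) i)" if "a \<le> m" for a
      using that by (auto simp: prod.distrib[symmetric] power_add[symmetric] le_fun_def)
    then show "mcoeff (mscale t (f * g)) m = mcoeff (mscale t f * mscale t g) m"
      by (auto simp: mscale.rep_eq mcoeff_mult sum_distrib_left intro!: sum.cong)
  qed
  have "(\<Prod>j\<in>UNIV. t j ^ ((\<lambda>_. 0)(i := a)) j) = (\<Prod>j\<in>UNIV. if j = i then t j ^ a else 1)"
    by (intro prod.cong) auto
  then have "(\<Prod>j\<in>UNIV. t j ^ ((\<lambda>_. 0)(i := a)) j) = t i ^ a" by simp
  then show "mscale t (var_power i a) = mconst (t i ^ a) * var_power i a"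
    by (intro mfps_eqI) (auto simp: mscale.rep_eq var_power_def)
  show "mscale t (mconst c * f) = mconst c * mscale t f"
    by (rule mfps_eqI) (simp add: mscale.rep_eq mult.left_commute)
qed (auto intro!: mfps_eqI simp: mscale.rep_eq distrib_left mresidue_def)

lemma mconst_hom:
  "mconst (a + b) = mconst a + (mconst b :: ('n :: finite, 'k :: comm_ring_1) mfps)"
  "mconst (a * b) = mconst a * (mconst b :: ('n :: finite, 'k :: comm_ring_1) mfps)"
  "mconst 1 = (1 :: ('n :: finite, 'k :: comm_ring_1) mfps)"
  by (rule mfps_eqI; simp add: mconst.rep_eq mcoeff_one)+

lemma mresidue_hom:
  fixes f g :: "('n :: finite, 'k :: comm_ring_1) mfps"
  shows "mresidue (f * g) = mresidue f * mresidue g" "mresidue (- f) = - mresidue f"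
proof -
  have "{a. a \<le> (\<lambda>_. 0)} = {(\<lambda>_. 0) :: 'n \<Rightarrow> nat}" by (auto simp: le_fun_def)
  then show "mresidue (f * g) = mresidue f * mresidue g"
    by (simp add: mresidue_def mcoeff_mult zero_fun_def)
qed (simp_all add: mresidue_def)

text \<open>The coefficient at $m$ of a derivative by $x_i$ involves the exponent $m + e_i$. Both products on
  the right become sums over the exponents $a \le m + e_i$, with factors $a_i$ and $m_i + 1 - a_i$.\<close>

lemma mpderiv_mult:
  fixes f g :: "('n :: finite, 'k :: comm_ring_1) mfps"
  shows "mpderiv i (f * g) = mpderiv i f * g + f * mpderiv i g"
proof (rule mfps_eqI)
  fix m :: "'n \<Rightarrow> nat"
  \<comment> \<open>the shift $a \<mapsto> a + e_i$ of exponents\<close>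
  define s where "s = (\<lambda>a :: 'n \<Rightarrow> nat. a(i := Suc (a i)))"
  define F where "F a = mcoeff f a * mcoeff g (s m - a)" for a
  have fin: "finite {a. a \<le> s m}" by simp
  have "mcoeff (mpderiv i f * g) m = (\<Sum>a | a \<le> m. of_nat (Suc (a i)) * mcoeff f (s a) * mcoeff g (m - a))"
    by (simp add: mcoeff_mult mpderiv.rep_eq s_def)
  also have "\<dots> = (\<Sum>a | a \<le> s m \<and> a i \<noteq> 0. of_nat (a i) * F a)"
  proof (rule sum.reindex_bij_witness[of _ "\<lambda>a. a(i := a i - 1)" s], goal_cases)
    case (5 a)
    have "s m - s a = m - a" by (auto simp: s_def)
    then show ?case by (simp add: F_def s_def mult.assoc)
  next
    case (4 a)
    then have "(a(i := a i - 1)) j \<le> m j" for j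
      using le_funD[of a "s m" j] by (cases "j = i") (auto simp: s_def)
    then show ?case by (auto simp: le_fun_def)
  qed (auto simp: s_def le_fun_def)
  also have "\<dots> = (\<Sum>a | a \<le> s m. of_nat (a i) * F a)"
    by (rule sum.mono_neutral_left) auto
  finally have 1: "mcoeff (mpderiv i f * g) m = (\<Sum>a | a \<le> s m. of_nat (a i) * F a)" .
  have "mcoeff (f * mpderiv i g) m =
    (\<Sum>a | a \<le> m. of_nat (Suc (m i) - a i) * F a)"
    unfolding mcoeff_mult
  proof (intro sum.cong refl)
    fix a assume "a \<in> {a. a \<le> m}"
    then have le: "\<And>j. a j \<le> m j" by (auto simp: le_fun_def)
    have "(m - a)(i := Suc ((m - a) i)) = s m - a" using le[of i] by (auto simp: s_def fun_eq_iff)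
    moreover have "Suc ((m - a) i) = Suc (m i) - a i" using le[of i] by simp
    ultimately show "mcoeff f a * mcoeff (mpderiv i g) (m - a) = of_nat (Suc (m i) - a i) * F a"
      by (simp only: F_def mpderiv.rep_eq mult.left_commute)
  qed
  also have "\<dots> = (\<Sum>a | a \<le> s m. of_nat (Suc (m i) - a i) * F a)"
  proof (rule sum.mono_neutral_left)
    show "{a. a \<le> m} \<subseteq> {a. a \<le> s m}" by (auto simp: s_def le_fun_def le_SucI)
    show "\<forall>a\<in>{a. a \<le> s m} - {a. a \<le> m}. of_nat (Suc (m i) - a i) * F a = 0"
    proof
      fix a assume a: "a \<in> {a. a \<le> s m} - {a. a \<le> m}"
      then obtain j where "\<not> a j \<le> m j" by (auto simp: le_fun_def)
      moreover have "a j \<le> s m j" using a by (auto simp: le_fun_def)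
      ultimately have "a i = Suc (m i)" by (cases "j = i") (auto simp: s_def)
      then show "of_nat (Suc (m i) - a i) * F a = 0" by simp
    qed
  qed simp
  finally have "mcoeff (mpderiv i f * g + f * mpderiv i g) m =
    (\<Sum>a | a \<le> s m. (of_nat (a i) + of_nat (Suc (m i) - a i)) * F a)"
    using 1 by (simp add: sum.distrib distrib_right)
  also have "\<dots> = (\<Sum>a | a \<le> s m. of_nat (Suc (m i)) * F a)"
  proof (intro sum.cong refl)
    fix a assume "a \<in> {a. a \<le> s m}"
    then have "a i \<le> s m i" by (simp add: le_fun_def)
    then have "a i + (Suc (m i) - a i) = Suc (m i)" by (simp add: s_def)
    then show "(of_nat (a i) + of_nat (Suc (m i) - a i)) * F a = of_nat (Suc (m i)) * F a"
      by (metis of_nat_add)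
  qed
  also have "\<dots> = mcoeff (mpderiv i (f * g)) m"
    by (simp only: mpderiv.rep_eq mcoeff_mult F_def s_def sum_distrib_left)
  finally show "mcoeff (mpderiv i (f * g)) m = mcoeff (mpderiv i f * g + f * mpderiv i g) m" ..
qed

lemma mpderiv_0 [simp]: "mpderiv i 0 = (0 :: ('n :: finite, 'k :: comm_ring_1) mfps)"
  by (rule mfps_eqI) (simp add: mpderiv.rep_eq)

lemma mpderiv_sum: "mpderiv i (\<Sum>j\<in>I. f j) = (\<Sum>j\<in>I. mpderiv i (f j))"
  for f :: "'i \<Rightarrow> ('n :: finite, 'k :: comm_ring_1) mfps"
  by (rule mfps_eqI) (simp add: mpderiv.rep_eq mcoeff_sum sum_distrib_left)

text \<open>The inverse is the geometric series in $y = x_iu$. The coefficient of $y^k$ at $m$ vanishes for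
  $m_i < k$, so each coefficient of the series is that of a partial sum.\<close>

lemma one_minus_var_unit:
  fixes u :: "('n :: finite, 'k :: comm_ring_1) mfps"
  shows "\<exists>v. (1 - var_power i 1 * u) * v = 1"
proof -
  define y where "y = var_power i 1 * u"
  define G where "G K = (\<Sum>k\<le>K. y ^ k)" for K
  have pow: "mcoeff (y ^ k) m = 0" if "m i < k" for k m
    using that
  proof (induction k arbitrary: m)
    case (Suc k)
    have "y ^ Suc k = var_power i 1 * (y ^ k * u)" by (simp add: y_def algebra_simps)
    moreover have "mcoeff (y ^ k * u) b = 0" if "b i < k" for b
      unfolding mcoeff_mult
    proof (intro sum.neutral ballI)
      fix a assume "a \<in> {a. a \<le> b}"
      then have "a i < k" using that by (auto simp: le_fun_def intro: le_less_trans)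
      then show "mcoeff (y ^ k) a * mcoeff u (b - a) = 0" using Suc.IH by simp
    qed
    ultimately show ?case using Suc.prems by (auto simp: mcoeff_var_power_mult)
  qed simp
  have stable: "mcoeff (G K) m = mcoeff (G (m i)) m" if "m i \<le> K" for K m
    using that
  proof (induction K rule: dec_induct)
    case (step K)
    then show ?case using pow[of m "Suc K"] by (simp add: G_def)
  qed simp
  define v where "v = Abs_mfps (\<lambda>m. mcoeff (G (m i)) m)"
  have "(1 - y) * v = 1"
  proof (rule mfps_eqI)
    fix m
    have "mcoeff ((1 - y) * v) m = mcoeff ((1 - y) * G (m i)) m"
    proof (rule mcoeff_mult_cong)
      fix b assume "b \<le> m"
      then have "b i \<le> m i" by (simp add: le_fun_def)
      from stable[of b "m i", OF this] show "mcoeff v b = mcoeff (G (m i)) b" by (simp add: v_def)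
    qed
    also have "(1 - y) * G K = 1 - y ^ Suc K" for K
      using one_diff_power_eq[of y "Suc K"] by (simp add: G_def lessThan_Suc_atMost)
    also have "mcoeff (1 - y ^ Suc (m i)) m = mcoeff 1 m" using pow[of m "Suc (m i)"] by simp
    finally show "mcoeff ((1 - y) * v) m = mcoeff 1 m" .
  qed
  then show ?thesis by (auto simp: y_def)
qed

interpretation mfps: linear_space "\<lambda>(c :: 'k :: field) (f :: ('n :: finite, 'k) mfps). mconst c * f"
  by standard (simp_all add: mconst_hom algebra_simps)

text \<open>The subspaces $(x_i^a) + J$ decrease with $a$, so two consecutive ones agree and
  $x_i^a(1 - x_iu) \in J$ for some $u$, where the second factor is a unit. The sum of the exponents
  obtained for the single variables serves for all of them.\<close>

lemma var_power_in_ideal: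
  fixes J :: "('n :: finite, 'k :: field) mfps set"
  assumes "mfps.finite_codim UNIV J" "0 \<in> J" "\<And>f g. f \<in> J \<Longrightarrow> g \<in> J \<Longrightarrow> f + g \<in> J"
    "\<And>f g. f \<in> J \<Longrightarrow> g * f \<in> J"
  shows "\<exists>a. \<forall>i. var_power i a \<in> J"
proof -
  have "\<exists>a. var_power i a \<in> J" for i
  proof -
    define W where "W a = {var_power i a * f + j | f j. j \<in> J}" for a
    have WI: "var_power i a * f + j \<in> W a" if "j \<in> J" for a f j using that by (auto simp: W_def)
    have J: "mfps.subspace J" using assms by (auto simp: mfps.subspace_def)
    have "\<exists>a. W (Suc a) = W a"
    proof (rule mfps.finite_codim_stable)
      show "mfps.finite_codim (W 0) J" by (rule mfps.finite_codim_mono[OF assms(1)]) auto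
      show "mfps.subspace J" by (rule J)
      show "J \<subseteq> W a" for a using WI[of _ a 0] by auto
      show "mfps.subspace (W a)" for a
        unfolding mfps.subspace_def
      proof (intro conjI ballI allI)
        show "0 \<in> W a" using WI[OF assms(2), of a 0] by simp
        fix x y assume "x \<in> W a" "y \<in> W a"
        then obtain f j g l where "x = var_power i a * f + j" "j \<in> J"
          "y = var_power i a * g + l" "l \<in> J" by (auto simp: W_def)
        then have "x + y = var_power i a * (f + g) + (j + l)" "j + l \<in> J"
          using assms(3) by (auto simp: algebra_simps)
        then show "x + y \<in> W a" using WI by metis
      next
        fix c x assume "x \<in> W a"
        then obtain f j where "x = var_power i a * f + j" "j \<in> J" by (auto simp: W_def)
        then have "mconst c * x = var_power i a * (mconst c * f) + mconst c * j" "mconst c * j \<in> J"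
          using assms(4) by (auto simp: algebra_simps)
        then show "mconst c * x \<in> W a" using WI by metis
      qed
      show "W (Suc a) \<subseteq> W a" for a
      proof
        fix x assume "x \<in> W (Suc a)"
        then obtain f j where x: "x = var_power i (Suc a) * f + j" "j \<in> J" by (auto simp: W_def)
        have "x = var_power i a * (var_power i 1 * f) + j"
          using var_power_add[of i a 1, where ?'k = 'k] by (simp add: x(1) mult.assoc)
        then show "x \<in> W a" using WI[OF x(2)] by simp
      qed
    qed
    then obtain a where a: "W (Suc a) = W a" ..
    have "var_power i a \<in> W (Suc a)" using WI[OF assms(2), of a 1] by (simp add: a)
    then obtain u j where u: "var_power i a = var_power i (Suc a) * u + j" "j \<in> J"
      by (auto simp: W_def)
    obtain v where v: "(1 - var_power i 1 * u) * v = 1" using one_minus_var_unit by blast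
    have "var_power i (Suc a) * u = var_power i a * (var_power i 1 * u)"
      using var_power_add[of i a 1, where ?'k = 'k] by (simp add: mult.assoc)
    then have "var_power i a * (1 - var_power i 1 * u) = j"
      using u(1) by (metis add_diff_cancel_left' mult.right_neutral right_diff_distrib')
    then have "v * j = var_power i a * ((1 - var_power i 1 * u) * v)"
      by (metis mult.assoc mult.commute)
    then have "var_power i a = v * j" using v by simp
    then show ?thesis using assms(4)[OF u(2), of v] by metis
  qed
  then obtain a where a: "\<And>i. var_power i (a i) \<in> J" by metis
  have "var_power i (\<Sum>j\<in>UNIV. a j) \<in> J" for i
  proof -
    have "(\<Sum>j\<in>UNIV. a j) = (\<Sum>j\<in>UNIV - {i}. a j) + a i"
      by (simp add: sum.remove[of UNIV i] add.commute)
    then show ?thesis using assms(4)[OF a] by (simp only: var_power_add)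
  qed
  then show ?thesis by blast
qed

lemma mscale_sign: "mscale t ((-1) ^ d * f) = (-1) ^ d * mscale t f"
  for f :: "('n :: finite, 'k :: comm_ring_1) mfps"
proof -
  have "mscale t (- f) = - mscale t f" for f :: "('n, 'k) mfps"
    by (rule mfps_eqI) (simp add: mscale.rep_eq)
  then show ?thesis by (simp add: minus_one_power_iff)
qed

text \<open>The ideal generated by the powers $x_i^a$ with $i \in I$.\<close>

definition power_ideal :: "nat \<Rightarrow> 'n set \<Rightarrow> ('n :: finite, 'k :: comm_ring_1) mfps set" where
  "power_ideal a I = {g. \<forall>m. (\<forall>i\<in>I. m i < a) \<longrightarrow> mcoeff g m = 0}"

lemma power_ideal_closed:
  fixes f g :: "('n :: finite, 'k :: comm_ring_1) mfps"
  shows "0 \<in> (power_ideal a I :: ('n, 'k) mfps set)" "f \<in> power_ideal a I \<Longrightarrow> g \<in> power_ideal a I \<Longrightarrow> f + g \<in> power_ideal a I"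
    and "f \<in> power_ideal a I \<Longrightarrow> g \<in> power_ideal a I \<Longrightarrow> f - g \<in> power_ideal a I"
    and "g \<in> power_ideal a I \<Longrightarrow> f * g \<in> power_ideal a I" "g \<in> power_ideal a I \<Longrightarrow> g * f \<in> power_ideal a I"
    and "g \<in> power_ideal a I \<Longrightarrow> mscale t g \<in> power_ideal a I"
proof -
  show *: "f * g \<in> power_ideal a I" if "g \<in> power_ideal a I" for f g :: "('n, 'k) mfps"
    unfolding power_ideal_def
  proof (intro CollectI allI impI)
    fix m assume m: "\<forall>i\<in>I. m i < a"
    show "mcoeff (f * g) m = 0"
      unfolding mcoeff_mult
    proof (intro sum.neutral ballI)
      fix b
      have "\<forall>i\<in>I. (m - b) i < a" using m by (auto intro: le_less_trans)
      then show "mcoeff f b * mcoeff g (m - b) = 0" using that by (simp add: power_ideal_def)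
    qed
  qed
  show "g * f \<in> power_ideal a I" if "g \<in> power_ideal a I" using *[OF that, of f] by (simp add: mult.commute)
qed (auto simp: power_ideal_def mscale.rep_eq)

lemma power_ideal_sum:
  fixes f :: "'i \<Rightarrow> ('n :: finite, 'k :: comm_ring_1) mfps"
  shows "(\<And>l. l \<in> L \<Longrightarrow> f l \<in> power_ideal a I) \<Longrightarrow> (\<Sum>l\<in>L. f l) \<in> power_ideal a I"
  by (induction L rule: infinite_finite_induct) (simp_all add: power_ideal_closed)

lemma mscale_sum: "mscale t (\<Sum>l\<in>L. f l) = (\<Sum>l\<in>L. mscale t (f l))"
  for f :: "'i \<Rightarrow> ('n :: finite, 'k :: comm_ring_1) mfps"
  by (induction L rule: infinite_finite_induct) (simp_all add: mscale_hom)

lemma jacobian_ideal_closed: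
  fixes w :: "('n :: finite, 'k :: field) mfps"
  shows "0 \<in> jacobian_ideal w" "f \<in> jacobian_ideal w \<Longrightarrow> g \<in> jacobian_ideal w \<Longrightarrow> f + g \<in> jacobian_ideal w"
    "f \<in> jacobian_ideal w \<Longrightarrow> h * f \<in> jacobian_ideal w"
proof -
  have J: "(\<Sum>i\<in>UNIV. g i * mpderiv i w) \<in> jacobian_ideal w" for g by (auto simp: jacobian_ideal_def)
  show "0 \<in> jacobian_ideal w" using J[of "\<lambda>_. 0"] by simp
  show "f + g \<in> jacobian_ideal w" if "f \<in> jacobian_ideal w" "g \<in> jacobian_ideal w"
  proof -
    from that obtain a b where "f = (\<Sum>i\<in>UNIV. a i * mpderiv i w)" "g = (\<Sum>i\<in>UNIV. b i * mpderiv i w)"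
      by (auto simp: jacobian_ideal_def)
    then show ?thesis using J[of "\<lambda>i. a i + b i"] by (simp add: distrib_right sum.distrib)
  qed
  show "h * f \<in> jacobian_ideal w" if "f \<in> jacobian_ideal w"
  proof -
    from that obtain a where "f = (\<Sum>i\<in>UNIV. a i * mpderiv i w)" by (auto simp: jacobian_ideal_def)
    then show ?thesis using J[of "\<lambda>i. h * a i"] by (simp add: sum_distrib_left mult.assoc)
  qed
qed

lemma isolated_singularity_var_power:
  fixes w :: "('n :: finite, 'k :: field) mfps"
  assumes "isolated_singularity w"
  shows "\<exists>a. \<forall>i. var_power i a \<in> jacobian_ideal w"
proof -
  note J = jacobian_ideal_closed[where w = w]
  interpret P: quotient_presentation "\<lambda>(c :: 'k) (f :: ('n, 'k) mfps). mconst c * f" mfps_space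
    UNIV "jacobian_ideal w" "\<lambda>f. f"
    by unfold_locales
      (use J in \<open>auto simp: mfps.subquotient_def mfps.subspace_def mfps_space_def inj_on_def\<close>)
  have "P.Q.fin_dim" using assms by (simp add: isolated_singularity_def P.quot_def)
  then show ?thesis using J by (intro var_power_in_ideal P.finite_codim_if_fin_dim) auto
qed

section \<open>The complex of morphisms\<close>

text \<open>The parity operator of the graded module of morphisms. It is multiplicative, and so it absorbs the
  sign $(-1)^{|\phi|}$ of the differential for all degrees at once.\<close>

definition sign_twist :: "'r :: comm_ring_1 graded_module \<Rightarrow> 'r graded_module \<Rightarrow> 'r mat \<Rightarrow> 'r mat" where
  "sign_twist E F \<phi> =
    mat (rank F) (rank E) (\<lambda>(i, j). (-1) ^ (basis_degree F i + basis_degree E j) * \<phi> $$ (i, j))"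

lemma sign_twist_carrier [simp]: "sign_twist E F \<phi> \<in> carrier_mat (rank F) (rank E)"
  by (simp add: sign_twist_def)

lemma sign_twist_mult:
  assumes "\<psi> \<in> carrier_mat (rank G) (rank F)" "\<phi> \<in> carrier_mat (rank F) (rank E)"
  shows "sign_twist E G (\<psi> * \<phi>) = sign_twist F G \<psi> * sign_twist E F \<phi>"
proof (rule eq_matI)
  fix i j assume "i < dim_row (sign_twist F G \<psi> * sign_twist E F \<phi>)"
    "j < dim_col (sign_twist F G \<psi> * sign_twist E F \<phi>)"
  then have ij: "i < rank G" "j < rank E" by (auto simp: sign_twist_def)
  have sign: "(-1) ^ (a + c) * (x * y) = ((-1) ^ (a + b) * x) * ((-1) ^ (b + c) * y)"
    for a b c :: nat and x y :: 'a
    by (auto simp: minus_one_power_iff)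
  have "(-1) ^ (basis_degree G i + basis_degree E j) * (\<Sum>l<rank F. \<psi> $$ (i, l) * \<phi> $$ (l, j)) =
      (\<Sum>l<rank F. ((-1) ^ (basis_degree G i + basis_degree F l) * \<psi> $$ (i, l)) *
        ((-1) ^ (basis_degree F l + basis_degree E j) * \<phi> $$ (l, j)))"
    unfolding sum_distrib_left by (intro sum.cong refl sign)
  then show "sign_twist E G (\<psi> * \<phi>) $$ (i, j) = (sign_twist F G \<psi> * sign_twist E F \<phi>) $$ (i, j)"
    using ij assms by (simp add: sign_twist_def scalar_prod_def lessThan_atLeast0)
qed (use assms in \<open>auto simp: sign_twist_def\<close>)

lemma sign_twist_homogeneous:
  assumes "\<phi> \<in> homs E F s"
  shows "sign_twist E F \<phi> = (-1) ^ s \<cdot>\<^sub>m \<phi>"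
proof (rule eq_matI)
  fix i j assume "i < dim_row ((-1) ^ s \<cdot>\<^sub>m \<phi>)" "j < dim_col ((-1) ^ s \<cdot>\<^sub>m \<phi>)"
  then have ij: "i < rank F" "j < rank E" using assms by (auto simp: homs_def)
  show "sign_twist E F \<phi> $$ (i, j) = ((-1) ^ s \<cdot>\<^sub>m \<phi>) $$ (i, j)"
  proof (cases "\<phi> $$ (i, j) = 0")
    case False
    then have "basis_degree F i mod 2 = (basis_degree E j + s) mod 2"
      using assms ij by (auto simp: homs_def)
    then have "even (basis_degree F i + basis_degree E j) = even s" by presburger
    then have "(-1) ^ (basis_degree F i + basis_degree E j) = ((-1) ^ s :: 'a)"
      by (simp add: minus_one_power_iff)
    then show ?thesis using ij assms by (auto simp: sign_twist_def homs_def)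
  qed (use ij assms in \<open>auto simp: sign_twist_def homs_def\<close>)
qed (use assms in \<open>auto simp: sign_twist_def homs_def\<close>)

lemma rank_pullback: "rank (pullback t E) = rank E" "basis_degree (pullback t E) = basis_degree E"
  "differential (pullback t E) = map_mat (mscale t) (differential E)"
  by (auto simp: rank_def pullback_def basis_degree_def)

lemma minus_eq_0_mat: "X - Y = 0\<^sub>m p q \<Longrightarrow> X \<in> carrier_mat p q \<Longrightarrow> Y \<in> carrier_mat p q \<Longrightarrow> X = Y"
  for X Y :: "'a :: ab_group_add mat"
proof (rule eq_matI)
  fix i j assume "X - Y = 0\<^sub>m p q" "X \<in> carrier_mat p q" "Y \<in> carrier_mat p q" "i < dim_row Y" "j < dim_col Y"
  then have "X $$ (i, j) - Y $$ (i, j) = 0"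
    by (metis carrier_matD index_minus_mat(1) index_zero_mat(1))
  then show "X $$ (i, j) = Y $$ (i, j)" by simp
qed auto

text \<open>Written as a single signed sum, the supertraces of \<open>\<alpha>\<close> and \<open>\<beta>\<close> can be multiplied out.\<close>

lemma supertrace_residue:
  "residue_supertrace E \<phi> = (\<Sum>i<rank E. (-1) ^ basis_degree E i * mresidue (\<phi> $$ (i, i)))"
  if "\<phi> \<in> carrier_mat (rank E) (rank E)" for E :: "('n :: finite, 'k :: comm_ring_1) mfps graded_module" and \<phi>
proof -
  have e: "rank_even E \<le> rank E" by (simp add: rank_def)
  have "(\<Sum>i<rank E. (-1) ^ basis_degree E i * mresidue (\<phi> $$ (i, i))) =
    (\<Sum>i = 0..<rank_even E. (-1) ^ basis_degree E i * mresidue (\<phi> $$ (i, i))) +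
    (\<Sum>i = rank_even E..<rank E. (-1) ^ basis_degree E i * mresidue (\<phi> $$ (i, i)))"
    using e by (simp add: lessThan_atLeast0 sum.atLeastLessThan_concat)
  also have "\<dots> = residue_supertrace E \<phi>"
    using e that by (simp add: residue_supertrace_def basis_degree_def sum_negf)
  finally show ?thesis by simp
qed

definition fn_scale :: "'k :: field \<Rightarrow> (nat \<times> nat \<Rightarrow> ('n :: finite, 'k) mfps) \<Rightarrow> nat \<times> nat \<Rightarrow> ('n, 'k) mfps" where
  "fn_scale c f = (\<lambda>p. mconst c * f p)"

interpretation fn: linear_space "fn_scale :: 'k :: field \<Rightarrow> _ \<Rightarrow> nat \<times> nat \<Rightarrow> ('n :: finite, 'k) mfps"
  by standard (simp_all add: fn_scale_def fun_eq_iff mconst_hom algebra_simps)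

definition mult_by :: "('n :: finite, 'k :: field) mfps \<Rightarrow> (nat \<times> nat \<Rightarrow> ('n, 'k) mfps) \<Rightarrow> nat \<times> nat \<Rightarrow> ('n, 'k) mfps" where
  "mult_by r f = (\<lambda>p. r * f p)"

lemma fn_scale_apply: "fn_scale c f p = mconst c * f p"
  by (simp add: fn_scale_def)

lemma mcoeff_fn_scale: "mcoeff (fn_scale c f p) m = c * mcoeff (f p) m"
  by (simp add: fn_scale_def)

lemma mult_by_apply: "mult_by r f p = r * f p"
  by (simp add: mult_by_def)

lemma fn_scale_eq: "fn_scale c = mult_by (mconst c)"
  by (simp add: fn_scale_def mult_by_def fun_eq_iff)

text \<open>Matrices of a fixed size are not a type with an addition, so morphisms are represented by functions
  on pairs of indices, extended by zero.\<close>

locale hom_space =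
  fixes A B :: "('n :: finite, 'k :: field) mfps graded_module"
begin

definition of_mat :: "('n, 'k) mfps mat \<Rightarrow> nat \<times> nat \<Rightarrow> ('n, 'k) mfps" where
  "of_mat \<phi> = (\<lambda>(i, j). if i < rank B \<and> j < rank A then \<phi> $$ (i, j) else 0)"

definition to_mat :: "(nat \<times> nat \<Rightarrow> ('n, 'k) mfps) \<Rightarrow> ('n, 'k) mfps mat" where
  "to_mat f = mat (rank B) (rank A) f"

definition U :: "(nat \<times> nat \<Rightarrow> ('n, 'k) mfps) set" where
  "U = {f. \<forall>i j. \<not> (i < rank B \<and> j < rank A) \<longrightarrow> f (i, j) = 0}"

lemma to_mat_carrier [simp]: "to_mat f \<in> carrier_mat (rank B) (rank A)"
  and dim_to_mat [simp]: "dim_row (to_mat f) = rank B" "dim_col (to_mat f) = rank A"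
  by (simp_all add: to_mat_def)

lemma to_mat_index [simp]: "i < rank B \<Longrightarrow> j < rank A \<Longrightarrow> to_mat f $$ (i, j) = f (i, j)"
  by (simp add: to_mat_def)

lemma to_mat_of_mat: "\<phi> \<in> carrier_mat (rank B) (rank A) \<Longrightarrow> to_mat (of_mat \<phi>) = \<phi>"
  by (auto simp: of_mat_def to_mat_def intro!: eq_matI)

lemma of_mat_to_mat: "f \<in> U \<Longrightarrow> of_mat (to_mat f) = f"
  by (auto simp: of_mat_def U_def fun_eq_iff)

lemma of_mat_in_U [simp]: "of_mat \<phi> \<in> U"
  by (auto simp: of_mat_def U_def)

lemma to_mat_linear:
  "to_mat (f + g) = to_mat f + to_mat g" "to_mat (f - g) = to_mat f - to_mat g" "to_mat (mult_by r f) = r \<cdot>\<^sub>m to_mat f"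
  "to_mat (fn_scale c f) = mconst c \<cdot>\<^sub>m to_mat f" "to_mat 0 = 0\<^sub>m (rank B) (rank A)"
  by (auto simp: to_mat_def mult_by_def fn_scale_def intro!: eq_matI)

lemma of_mat_smult:
  "\<phi> \<in> carrier_mat (rank B) (rank A) \<Longrightarrow> of_mat (r \<cdot>\<^sub>m \<phi>) = mult_by r (of_mat \<phi>)"
  by (auto simp: of_mat_def mult_by_def fun_eq_iff)

lemma subspace_U: "fn.subspace U"
  by (auto simp: fn.subspace_def U_def fn_scale_def)

lemma mult_by_U: "f \<in> U \<Longrightarrow> mult_by r f \<in> U"
  by (auto simp: U_def mult_by_def)

definition left_mult :: "('n, 'k) mfps mat \<Rightarrow> (nat \<times> nat \<Rightarrow> ('n, 'k) mfps) \<Rightarrow> nat \<times> nat \<Rightarrow> ('n, 'k) mfps" where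
  "left_mult M f = of_mat (M * to_mat f)"

definition right_mult :: "('n, 'k) mfps mat \<Rightarrow> (nat \<times> nat \<Rightarrow> ('n, 'k) mfps) \<Rightarrow> nat \<times> nat \<Rightarrow> ('n, 'k) mfps" where
  "right_mult M f = of_mat (to_mat f * M)"

definition twist :: "(nat \<times> nat \<Rightarrow> ('n, 'k) mfps) \<Rightarrow> nat \<times> nat \<Rightarrow> ('n, 'k) mfps" where
  "twist f = of_mat (sign_twist A B (to_mat f))"

lemma left_mult_apply:
  assumes "M \<in> carrier_mat (rank B) (rank B)"
  shows "left_mult M f (i, j) =
    (if i < rank B \<and> j < rank A then \<Sum>l<rank B. M $$ (i, l) * f (l, j) else 0)"
  using assms by (auto simp: left_mult_def of_mat_def scalar_prod_def lessThan_atLeast0 intro!: sum.cong)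

lemma right_mult_apply:
  assumes "M \<in> carrier_mat (rank A) (rank A)"
  shows "right_mult M f (i, j) =
    (if i < rank B \<and> j < rank A then \<Sum>l<rank A. f (i, l) * M $$ (l, j) else 0)"
  using assms by (auto simp: right_mult_def of_mat_def scalar_prod_def lessThan_atLeast0 intro!: sum.cong)

lemma twist_apply:
  "twist f (i, j) =
    (if i < rank B \<and> j < rank A then (-1) ^ (basis_degree B i + basis_degree A j) * f (i, j) else 0)"
  by (simp add: twist_def of_mat_def sign_twist_def)

context
  fixes M :: "('n, 'k) mfps mat"
  assumes M: "M \<in> carrier_mat (rank B) (rank B)"
begin

lemma left_mult_linear:
  "left_mult M (f + g) = left_mult M f + left_mult M g"
  "left_mult M (f - g) = left_mult M f - left_mult M g"
  "left_mult M (- f) = - left_mult M f"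
  "left_mult M (mult_by r f) = mult_by r (left_mult M f)"
  "left_mult M (fn_scale c f) = fn_scale c (left_mult M f)"
  using M by (auto simp: fun_eq_iff left_mult_apply mult_by_def fn_scale_def sum_distrib_left
      distrib_left right_diff_distrib sum.distrib sum_subtractf mult.left_commute sum_negf)

lemma left_mult_compose:
  assumes "M' \<in> carrier_mat (rank B) (rank B)"
  shows "left_mult M (left_mult M' f) = left_mult (M * M') f"
proof -
  have "to_mat (of_mat (M' * to_mat f)) = M' * to_mat f"
    by (rule to_mat_of_mat) (use assms in auto)
  then show ?thesis
    using assoc_mult_mat[OF M assms to_mat_carrier[of f]] by (simp add: left_mult_def)
qed

lemma left_mult_right_mult:
  assumes "M' \<in> carrier_mat (rank A) (rank A)"
  shows "left_mult M (right_mult M' f) = right_mult M' (left_mult M f)"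
proof -
  have "to_mat (of_mat (to_mat f * M')) = to_mat f * M'" "to_mat (of_mat (M * to_mat f)) = M * to_mat f"
    by (rule to_mat_of_mat; use assms M in auto)+
  then show ?thesis
    using assoc_mult_mat[OF M to_mat_carrier[of f] assms] by (simp add: left_mult_def right_mult_def)
qed

lemma left_mult_add:
  assumes "M' \<in> carrier_mat (rank B) (rank B)"
  shows "left_mult (M + M') f = left_mult M f + left_mult M' f"
  using assms M by (auto simp: fun_eq_iff left_mult_apply distrib_right sum.distrib)

lemma twist_left_mult:
  assumes "M \<in> homs B B s"
  shows "twist (left_mult M f) = mult_by ((-1) ^ s) (left_mult M (twist f))"
proof -
  have 1: "to_mat (of_mat (M * to_mat f)) = M * to_mat f" by (rule to_mat_of_mat) (use M in auto)
  have 2: "to_mat (of_mat (sign_twist A B (to_mat f))) = sign_twist A B (to_mat f)" by (rule to_mat_of_mat) simp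
  have "sign_twist A B (M * to_mat f) = (-1) ^ s \<cdot>\<^sub>m (M * sign_twist A B (to_mat f))"
    unfolding sign_twist_mult[OF M to_mat_carrier] sign_twist_homogeneous[OF assms]
    by (rule mult_smult_assoc_mat[OF M sign_twist_carrier])
  then show ?thesis
    using M by (simp add: twist_def left_mult_def 1 2 of_mat_smult)
qed

end

context
  fixes M :: "('n, 'k) mfps mat"
  assumes M: "M \<in> carrier_mat (rank A) (rank A)"
begin

lemma right_mult_linear:
  "right_mult M (f + g) = right_mult M f + right_mult M g"
  "right_mult M (f - g) = right_mult M f - right_mult M g"
  "right_mult M (- f) = - right_mult M f"
  "right_mult M (mult_by r f) = mult_by r (right_mult M f)"
  "right_mult M (fn_scale c f) = fn_scale c (right_mult M f)"
  using M by (auto simp: fun_eq_iff right_mult_apply mult_by_def fn_scale_def sum_distrib_left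
      distrib_right left_diff_distrib sum.distrib sum_subtractf mult.assoc sum_negf)

lemma right_mult_compose:
  assumes "M' \<in> carrier_mat (rank A) (rank A)"
  shows "right_mult M (right_mult M' f) = right_mult (M' * M) f"
proof -
  have "to_mat (of_mat (to_mat f * M')) = to_mat f * M'"
    by (rule to_mat_of_mat) (use assms in auto)
  then show ?thesis
    using assoc_mult_mat[OF to_mat_carrier[of f] assms M] by (simp add: right_mult_def)
qed

lemma twist_right_mult:
  assumes "M \<in> homs A A s"
  shows "twist (right_mult M f) = mult_by ((-1) ^ s) (right_mult M (twist f))"
proof -
  have 1: "to_mat (of_mat (to_mat f * M)) = to_mat f * M" by (rule to_mat_of_mat) (use M in auto)
  have 2: "to_mat (of_mat (sign_twist A B (to_mat f))) = sign_twist A B (to_mat f)" by (rule to_mat_of_mat) simp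
  have "sign_twist A B (to_mat f * M) = (-1) ^ s \<cdot>\<^sub>m (sign_twist A B (to_mat f) * M)"
    unfolding sign_twist_mult[OF to_mat_carrier M] sign_twist_homogeneous[OF assms]
    by (rule mult_smult_distrib[OF sign_twist_carrier M])
  then show ?thesis
    using of_mat_smult[OF mult_carrier_mat[OF sign_twist_carrier M]]
    by (simp add: twist_def right_mult_def 1 2)
qed

end

lemma scalar_mult:
  assumes "f \<in> U"
  shows "left_mult (r \<cdot>\<^sub>m 1\<^sub>m (rank B)) f = mult_by r f" "right_mult (r \<cdot>\<^sub>m 1\<^sub>m (rank A)) f = mult_by r f"
proof -
  have "(r \<cdot>\<^sub>m 1\<^sub>m (rank B)) * to_mat f = r \<cdot>\<^sub>m to_mat f" "to_mat f * (r \<cdot>\<^sub>m 1\<^sub>m (rank A)) = r \<cdot>\<^sub>m to_mat f"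
    by (simp_all add: mult_smult_assoc_mat[of _ "rank B" "rank B" _ "rank A"]
        mult_smult_distrib[of _ "rank B" "rank A" _ "rank A"])
  then show "left_mult (r \<cdot>\<^sub>m 1\<^sub>m (rank B)) f = mult_by r f" "right_mult (r \<cdot>\<^sub>m 1\<^sub>m (rank A)) f = mult_by r f"
    using assms by (simp_all add: left_mult_def right_mult_def of_mat_smult of_mat_to_mat)
qed

lemma twist_linear:
  "twist (f + g) = twist f + twist g" "twist (f - g) = twist f - twist g" "twist (- f) = - twist f"
  "twist (mult_by r f) = mult_by r (twist f)" "twist (fn_scale c f) = fn_scale c (twist f)"
  by (auto simp: fun_eq_iff twist_apply mult_by_def fn_scale_def distrib_left right_diff_distrib
      mult.left_commute)

lemma twist_twist: "f \<in> U \<Longrightarrow> twist (twist f) = f"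
  by (auto simp: fun_eq_iff twist_apply U_def mult.assoc[symmetric] power_add[symmetric])

lemma mult_by_simps:
  "mult_by 1 f = f" "mult_by (- 1) f = - f" "mult_by r (f + g) = mult_by r f + mult_by r g"
  "mult_by r (f - g) = mult_by r f - mult_by r g"
  "mult_by r (- f) = - mult_by r f"
  "mult_by r (mult_by s f) = mult_by (r * s) f"
  "mult_by r (fn_scale c f) = fn_scale c (mult_by r f)"
  by (auto simp: mult_by_def fn_scale_def fun_eq_iff distrib_left right_diff_distrib mult.left_commute
      mult.assoc)

lemma ops_in_U [simp]: "left_mult M f \<in> U" "right_mult M f \<in> U" "twist f \<in> U"
  by (simp_all add: left_mult_def right_mult_def twist_def)

end

locale factorization_pair = hom_space A B
  for A B :: "('n :: finite, 'k :: field) mfps graded_module" +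
  fixes w :: "('n, 'k) mfps"
  assumes mf_A: "matrix_factorization w A" and mf_B: "matrix_factorization w B"
begin

abbreviation "dA \<equiv> differential A"
abbreviation "dB \<equiv> differential B"

lemma dA: "dA \<in> homs A A 1" "dA \<in> carrier_mat (rank A) (rank A)" "dA * dA = w \<cdot>\<^sub>m 1\<^sub>m (rank A)"
  and dB: "dB \<in> homs B B 1" "dB \<in> carrier_mat (rank B) (rank B)" "dB * dB = w \<cdot>\<^sub>m 1\<^sub>m (rank B)"
  using mf_A mf_B by (auto simp: matrix_factorization_def homs_def)

text \<open>On a morphism of degree $s$ the twist is $(-1)^s$, so this is the differential of the complex, for
  all degrees together. The formulas with \<open>left_mult\<close>, \<open>right_mult\<close> and \<open>twist\<close> reduce everything
  below to the commutation rules of these three operators.\<close>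

definition D :: "(nat \<times> nat \<Rightarrow> ('n, 'k) mfps) \<Rightarrow> nat \<times> nat \<Rightarrow> ('n, 'k) mfps" where
  "D f = left_mult dB f - right_mult dA (twist f)"

lemmas op_linear = left_mult_linear[OF dB(2)] right_mult_linear[OF dA(2)] twist_linear

lemma twist_differentials:
  "twist (left_mult dB f) = - left_mult dB (twist f)" "twist (right_mult dA f) = - right_mult dA (twist f)"
  using twist_left_mult[OF dB(2,1)] twist_right_mult[OF dA(2,1)] by (simp_all add: mult_by_simps)

lemma D_in_U: "D f \<in> U"
  unfolding D_def by (intro fn.subspace_diff subspace_U) simp_all

lemma D_linear: "D (f + g) = D f + D g" "D (fn_scale c f) = fn_scale c (D f)"
  by (simp_all add: D_def op_linear fn.scale_right_diff_distrib)

lemma D_mult_by: "D (mult_by r f) = mult_by r (D f)"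
  by (simp add: D_def op_linear mult_by_simps)

lemma D_twist: "f \<in> U \<Longrightarrow> D (twist f) = - twist (D f)"
  by (simp add: D_def op_linear twist_differentials twist_twist)

text \<open>Multiplication by the square of either differential is multiplication by \<open>w\<close>. In $D^2$ these two
  contributions come with opposite signs, and the mixed terms also cancel because the differentials are
  odd.\<close>

lemma D_D:
  assumes "f \<in> U"
  shows "D (D f) = 0"
proof -
  have "left_mult dB (left_mult dB f) = mult_by w f"
    using assms by (simp add: left_mult_compose[OF dB(2) dB(2)] dB(3) scalar_mult)
  moreover have "right_mult dA (right_mult dA f) = mult_by w f"
    using assms by (simp add: right_mult_compose[OF dA(2) dA(2)] dA(3) scalar_mult)
  ultimately show ?thesis
    using assms left_mult_right_mult[OF dB(2) dA(2)]
    by (simp add: D_def op_linear twist_differentials twist_twist)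
qed

sublocale cx: differential_space fn_scale U D
  by unfold_locales (simp_all add: subspace_U D_linear D_in_U D_D)

text \<open>The terms that contain the differential of \<open>A\<close> cancel, because \<open>H\<close> is odd and multiplies on the
  other side.\<close>

lemma odd_homotopy:
  assumes H: "H \<in> homs B B 1" "H * dB + dB * H = r \<cdot>\<^sub>m 1\<^sub>m (rank B)" and f: "f \<in> U"
  shows "mult_by r f = D (left_mult H f) + left_mult H (D f)"
proof -
  have Hc: "H \<in> carrier_mat (rank B) (rank B)" using H by (simp add: homs_def)
  have "left_mult H (left_mult dB f) + left_mult dB (left_mult H f) = mult_by r f"
    using f Hc dB(2) left_mult_add[of "H * dB" "dB * H" f]
    by (simp add: left_mult_compose[OF Hc dB(2)] left_mult_compose[OF dB(2) Hc] H(2) scalar_mult)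
  moreover have "twist (left_mult H f) = - left_mult H (twist f)"
    using twist_left_mult[OF Hc H(1)] by (simp add: mult_by_simps)
  moreover have "left_mult H (right_mult dA (twist f)) = right_mult dA (left_mult H (twist f))"
    by (rule left_mult_right_mult[OF Hc dA(2)])
  ultimately show ?thesis
    by (simp add: D_def op_linear left_mult_linear[OF Hc] algebra_simps)
qed

end

section \<open>Finiteness and the total trace\<close>

(* Entries of a function f on index pairs are addressed as f p; splitting p would destroy that form. *)
declare split_paired_All [simp del]

context factorization_pair
begin

text \<open>The submodule of the complex generated by the multiples of $x_i^a$ with $i \in I$.\<close>

definition power_submodule :: "nat \<Rightarrow> 'n set \<Rightarrow> (nat \<times> nat \<Rightarrow> ('n, 'k) mfps) set" where
  "power_submodule a I = {f \<in> U. \<forall>p. f p \<in> power_ideal a I}"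

lemma subspace_power_submodule: "fn.subspace (power_submodule a I)"
  using subspace_U by (auto simp: fn.subspace_def power_submodule_def fn_scale_def power_ideal_closed)

lemma power_submodule_ops:
  assumes "f \<in> power_submodule a I"
  shows "M \<in> carrier_mat (rank B) (rank B) \<Longrightarrow> left_mult M f \<in> power_submodule a I"
    and "M' \<in> carrier_mat (rank A) (rank A) \<Longrightarrow> right_mult M' f \<in> power_submodule a I"
    and "twist f \<in> power_submodule a I" "mult_by r f \<in> power_submodule a I"
proof -
  have f: "f p \<in> power_ideal a I" for p using assms by (simp add: power_submodule_def)
  show "left_mult M f \<in> power_submodule a I" if "M \<in> carrier_mat (rank B) (rank B)"
    using f by (auto simp: power_submodule_def left_mult_apply[OF that] power_ideal_closed intro!: power_ideal_sum)
  show "right_mult M' f \<in> power_submodule a I" if "M' \<in> carrier_mat (rank A) (rank A)"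
    using f by (auto simp: power_submodule_def right_mult_apply[OF that] power_ideal_closed intro!: power_ideal_sum)
  show "twist f \<in> power_submodule a I"
    using f by (auto simp: power_submodule_def twist_apply power_ideal_closed)
  show "mult_by r f \<in> power_submodule a I"
    using assms f by (auto simp: power_submodule_def mult_by_U) (simp add: mult_by_def power_ideal_closed)
qed

lemma subcomplex_power_submodule: "cx.subcomplex (power_submodule a I)"
  unfolding cx.subcomplex_def
proof (intro conjI ballI)
  show "D f \<in> power_submodule a I" if "f \<in> power_submodule a I" for f
    unfolding D_def using that dA dB
    by (intro fn.subspace_diff[OF subspace_power_submodule] power_submodule_ops) auto
  show "power_submodule a I \<subseteq> U" by (auto simp: power_submodule_def)
qed (rule subspace_power_submodule)

lemma power_submodule_empty: "power_submodule a {} = {0}"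
  by (auto simp: power_submodule_def power_ideal_def U_def fun_eq_iff intro!: mfps_eqI)

definition var_quotient_fn :: "'n \<Rightarrow> nat \<Rightarrow> (nat \<times> nat \<Rightarrow> ('n, 'k) mfps) \<Rightarrow> nat \<times> nat \<Rightarrow> ('n, 'k) mfps" where
  "var_quotient_fn i a f = (\<lambda>p. var_quotient i a (f p))"

lemma var_quotient_fn_U: "f \<in> U \<Longrightarrow> var_quotient_fn i a f \<in> U"
  by (auto simp: U_def var_quotient_fn_def intro!: mfps_eqI)

lemma mult_by_linear: "fn.linear_endo (mult_by r)"
  by (rule fn.linear_endoI) (simp_all add: mult_by_simps)

lemma regular_var_power:
  assumes "i \<notin> I"
  shows "cx.regular_modulo (power_submodule a I) (mult_by (var_power i a)) (var_quotient_fn i a)"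
  unfolding cx.regular_modulo_def
proof (intro conjI ballI)
  show "fn.linear_endo (mult_by (var_power i a))" by (rule mult_by_linear)
  show "fn.linear_endo (var_quotient_fn i a)"
    by (rule fn.linear_endoI) (auto simp: var_quotient_fn_def fn_scale_def fun_eq_iff intro!: mfps_eqI)
  show "var_quotient_fn i a f \<in> power_submodule a I" if "f \<in> power_submodule a I" for f
  proof -
    have "var_quotient_fn i a f p \<in> power_ideal a I" for p
      unfolding power_ideal_def
    proof (intro CollectI allI impI)
      fix m assume "\<forall>j\<in>I. m j < a"
      then have "\<forall>j\<in>I. (m(i := m i + a)) j < a" using assms by auto
      then show "mcoeff (var_quotient_fn i a f p) m = 0"
        using that by (simp add: var_quotient_fn_def power_submodule_def power_ideal_def)
    qed
    then show ?thesis using that by (simp add: power_submodule_def var_quotient_fn_U)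
  qed
  show "var_quotient_fn i a (mult_by (var_power i a) u) = u" for u
    by (simp add: var_quotient_fn_def mult_by_def var_quotient_var_power_mult)
qed (simp_all add: mult_by_U var_quotient_fn_U power_submodule_ops D_mult_by)

text \<open>The terms of \<open>f\<close> divisible by $x_i^a$ form a multiple of $x_i^a$, and the remaining terms already lie
  in the smaller submodule.\<close>

lemma power_submodule_insert:
  "power_submodule a (insert i I) = cx.extend (power_submodule a I) (mult_by (var_power i a))"
proof (intro equalityI subsetI)
  fix f assume f: "f \<in> power_submodule a (insert i I)"
  define u where "u = var_quotient_fn i a f"
  have u: "u \<in> U" using f by (simp add: u_def var_quotient_fn_U power_submodule_def)
  have "f - mult_by (var_power i a) u \<in> U"
    using f u by (intro fn.subspace_diff[OF subspace_U] mult_by_U) (auto simp: power_submodule_def)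
  moreover have "(f - mult_by (var_power i a) u) p \<in> power_ideal a I" for p
    using f by (auto simp: power_ideal_def power_submodule_def mult_by_def u_def var_quotient_fn_def mcoeff_var_power_mult)
  ultimately have "f - mult_by (var_power i a) u \<in> power_submodule a I" by (simp add: power_submodule_def)
  moreover have "f = (f - mult_by (var_power i a) u) + mult_by (var_power i a) u" by simp
  ultimately show "f \<in> cx.extend (power_submodule a I) (mult_by (var_power i a))"
    unfolding cx.extend_def using u by blast
next
  fix f assume "f \<in> cx.extend (power_submodule a I) (mult_by (var_power i a))"
  then obtain n u where f: "f = n + mult_by (var_power i a) u" "n \<in> power_submodule a I" "u \<in> U"
    unfolding cx.extend_def by blast
  then have "n \<in> power_submodule a (insert i I)" by (auto simp: power_submodule_def power_ideal_def)
  moreover have "mult_by (var_power i a) u p \<in> power_ideal a (insert i I)" for p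
    by (auto simp: mult_by_def power_ideal_def mcoeff_var_power_mult)
  ultimately show "f \<in> power_submodule a (insert i I)"
    unfolding f(1) using f(3) subspace_power_submodule mult_by_U by (intro fn.subspace_add) (auto simp: power_submodule_def)
qed

definition elementary :: "(nat \<times> nat) \<times> ('n \<Rightarrow> nat) \<Rightarrow> nat \<times> nat \<Rightarrow> ('n, 'k) mfps" where
  "elementary x = (\<lambda>q. if q = fst x then Abs_mfps (\<lambda>m. if m = snd x then 1 else 0) else 0)"

definition monomial_indices :: "nat \<Rightarrow> ((nat \<times> nat) \<times> ('n \<Rightarrow> nat)) set" where
  "monomial_indices a = ({..<rank B} \<times> {..<rank A}) \<times> {m. \<forall>i. m i < a}"

lemma finite_monomial_indices: "finite (monomial_indices a)"
proof -
  have "{m :: 'n \<Rightarrow> nat. \<forall>i. m i < a} \<subseteq> {m. m \<le> (\<lambda>_. a)}" by (auto simp: le_fun_def less_imp_le)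
  then have "finite {m :: 'n \<Rightarrow> nat. \<forall>i. m i < a}" by (rule finite_subset) simp
  then show ?thesis by (simp add: monomial_indices_def)
qed

text \<open>Modulo all $x_i^a$, a matrix of series is determined by the finitely many coefficients whose
  exponents are all less than $a$.\<close>

lemma monomial_frame:
  assumes "set xs = monomial_indices a" "distinct xs"
  shows "fn.frame U (power_submodule a UNIV) (map (\<lambda>x. (elementary x, \<lambda>f. mcoeff (f (fst x)) (snd x))) xs)"
    (is "fn.frame _ _ ?ps")
  unfolding fn.frame_def
proof (intro conjI ballI)
  fix p assume "p \<in> set ?ps"
  then show "case p of (v, g) \<Rightarrow> v \<in> U \<and> fn.functional_on U (power_submodule a UNIV) g"
    using assms by (auto simp: monomial_indices_def elementary_def U_def fn.functional_on_def power_submodule_def power_ideal_def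
        mcoeff_fn_scale)
next
  fix f assume f: "f \<in> U"
  have "mcoeff (fn.frame_sum (map (\<lambda>x. (elementary x, \<lambda>f. mcoeff (f (fst x)) (snd x))) ys) f q) m =
    (\<Sum>x\<leftarrow>ys. if x = (q, m) then mcoeff (f (fst x)) (snd x) else 0)" for ys q m
    by (induction ys) (auto simp: mcoeff_fn_scale elementary_def)
  also have "(\<Sum>x\<leftarrow>xs. if x = (q, m) then mcoeff (f (fst x)) (snd x) else 0) =
    (if (q, m) \<in> monomial_indices a then mcoeff (f q) m else 0)" for q m
    using assms finite_monomial_indices by (simp add: sum_list_distinct_conv_sum_set)
  finally have fs: "mcoeff (fn.frame_sum ?ps f q) m = (if (q, m) \<in> monomial_indices a then mcoeff (f q) m else 0)"
    for q m .
  show "f - fn.frame_sum ?ps f \<in> power_submodule a UNIV"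
    unfolding power_submodule_def
  proof (intro CollectI conjI allI)
    show "f - fn.frame_sum ?ps f \<in> U"
      using assms f by (intro fn.subspace_diff[OF subspace_U] fn.frame_sum_in[OF subspace_U])
        (auto simp: monomial_indices_def elementary_def U_def)
    fix p
    show "(f - fn.frame_sum ?ps f) p \<in> power_ideal a UNIV"
      using f by (cases p) (auto simp: power_ideal_def fs monomial_indices_def U_def)
  qed
qed

lemma finite_codim_power_submodule: "fn.finite_codim U (power_submodule a UNIV)"
proof -
  obtain xs where "set xs = monomial_indices a" "distinct xs" using finite_distinct_list[OF finite_monomial_indices] by blast
  then show ?thesis
    using fn.finite_codim_if_frame[OF _ monomial_frame] subspace_power_submodule subspace_U
    by (auto simp: fn.subquotient_def power_submodule_def)
qed

text \<open>For $r = \sum_j g_j\,\partial_jw$ take $H = \sum_j g_j\,\partial_j\delta_B$ and differentiate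
  $\delta_B^2 = w$.\<close>

lemma jacobian_homotopy:
  assumes "r \<in> jacobian_ideal w"
  shows "\<exists>H \<in> homs B B 1. H * dB + dB * H = r \<cdot>\<^sub>m 1\<^sub>m (rank B)"
proof -
  obtain g where r: "r = (\<Sum>j\<in>UNIV. g j * mpderiv j w)" using assms by (auto simp: jacobian_ideal_def)
  define H where "H = mat (rank B) (rank B) (\<lambda>(i, l). \<Sum>j\<in>UNIV. g j * mpderiv j (dB $$ (i, l)))"
  have "H \<in> homs B B 1"
    unfolding homs_def
  proof (intro CollectI conjI allI impI)
    fix i j assume ij: "i < rank B" "j < rank B" and nz: "H $$ (i, j) \<noteq> 0"
    have "dB $$ (i, j) \<noteq> 0"
    proof
      assume "dB $$ (i, j) = 0"
      then have "H $$ (i, j) = 0" using ij by (simp add: H_def)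
      then show False using nz by simp
    qed
    then show "basis_degree B i mod 2 = (basis_degree B j + 1) mod 2"
      using dB(1) ij by (auto simp: homs_def)
  qed (simp add: H_def)
  moreover have "H * dB + dB * H = r \<cdot>\<^sub>m 1\<^sub>m (rank B)"
  proof (rule eq_matI)
    fix i m assume "i < dim_row (r \<cdot>\<^sub>m 1\<^sub>m (rank B))" "m < dim_col (r \<cdot>\<^sub>m 1\<^sub>m (rank B))"
    then have im: "i < rank B" "m < rank B" by auto
    have "(\<Sum>l<rank B. dB $$ (i, l) * dB $$ (l, m)) = (dB * dB) $$ (i, m)"
      using im dB(2) by (auto simp: scalar_prod_def lessThan_atLeast0)
    also have "\<dots> = (if i = m then w else 0)" using im by (simp add: dB(3))
    finally have sq: "(\<Sum>l<rank B. dB $$ (i, l) * dB $$ (l, m)) = (if i = m then w else 0)" .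
    have "(H * dB + dB * H) $$ (i, m) =
      (\<Sum>l<rank B. H $$ (i, l) * dB $$ (l, m) + dB $$ (i, l) * H $$ (l, m))"
      using im dB(2) by (auto simp: scalar_prod_def lessThan_atLeast0 H_def sum.distrib)
    also have "\<dots> = (\<Sum>l<rank B. \<Sum>j\<in>UNIV. g j * mpderiv j (dB $$ (i, l) * dB $$ (l, m)))"
    proof (intro sum.cong refl)
      fix l assume "l \<in> {..<rank B}"
      then show "H $$ (i, l) * dB $$ (l, m) + dB $$ (i, l) * H $$ (l, m) =
        (\<Sum>j\<in>UNIV. g j * mpderiv j (dB $$ (i, l) * dB $$ (l, m)))"
        using im by (simp add: H_def mpderiv_mult sum_distrib_left sum_distrib_right
            sum.distrib distrib_left ac_simps)
    qed
    also have "\<dots> = (\<Sum>j\<in>UNIV. g j * mpderiv j (\<Sum>l<rank B. dB $$ (i, l) * dB $$ (l, m)))"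
      by (subst sum.swap) (simp add: mpderiv_sum sum_distrib_left)
    also have "\<dots> = (r \<cdot>\<^sub>m 1\<^sub>m (rank B)) $$ (i, m)"
      using im by (simp add: sq r)
    finally show "(H * dB + dB * H) $$ (i, m) = (r \<cdot>\<^sub>m 1\<^sub>m (rank B)) $$ (i, m)" .
  qed (use dB(2) in \<open>auto simp: H_def\<close>)
  ultimately show ?thesis by blast
qed

text \<open>Starting from the complex modulo all $x_i^a$, which is finite-dimensional, the variables are
  removed from the index set one at a time.\<close>

lemma finite_cohomology:
  assumes "\<And>i. var_power i a \<in> jacobian_ideal w"
  shows "fn.finite_codim (cx.rel_cycles {0}) (cx.rel_boundaries {0})"
proof -
  have "fn.finite_codim (cx.rel_cycles (power_submodule a (UNIV - J))) (cx.rel_boundaries (power_submodule a (UNIV - J)))"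
    if "finite J" for J
    using that
  proof (induction J)
    case empty
    have "fn.finite_codim (cx.rel_cycles (power_submodule a UNIV)) (cx.rel_boundaries (power_submodule a UNIV))"
      by (rule fn.finite_codim_mono[OF finite_codim_power_submodule cx.rel_subquotient(3,2)[OF subcomplex_power_submodule]])
    then show ?case by simp
  next
    case (insert i J)
    let ?I = "UNIV - insert i J"
    obtain H where H: "H \<in> homs B B 1" "H * dB + dB * H = var_power i a \<cdot>\<^sub>m 1\<^sub>m (rank B)"
      using jacobian_homotopy[OF assms] by blast
    have Hc: "H \<in> carrier_mat (rank B) (rank B)" using H by (simp add: homs_def)
    have "insert i ?I = UNIV - J" using insert.hyps by auto
    then have ext: "cx.extend (power_submodule a ?I) (mult_by (var_power i a)) = power_submodule a (UNIV - J)"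
      by (simp add: power_submodule_insert[symmetric])
    show ?case
    proof (rule cx.finite_rel_homology_descends[OF subcomplex_power_submodule regular_var_power])
      show "fn.linear_endo (left_mult H)"
        by (rule fn.linear_endoI) (simp_all add: left_mult_linear[OF Hc])
      show "mult_by (var_power i a) u = D (left_mult H u) + left_mult H (D u)" if "u \<in> U" for u
        by (rule odd_homotopy[OF H that])
    qed (simp_all add: ext insert.IH power_submodule_ops Hc)
  qed
  from this[of UNIV] show ?thesis by (simp add: power_submodule_empty)
qed

end

text \<open>Characteristic zero serves to separate even from odd morphisms by the eigenvalues of \<open>twist\<close>.\<close>

locale equivariant_pair = factorization_pair A B w
  for A B :: "('n :: finite, 'k :: field_char_0) mfps graded_module" and w +
  fixes t :: "'n \<Rightarrow> 'k" and \<alpha> \<beta> :: "('n, 'k) mfps mat"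
  assumes closed_\<alpha>: "closed_morphism A (pullback t A) \<alpha>"
    and closed_\<beta>: "closed_morphism (pullback t B) B \<beta>"
    and t_nz: "t i \<noteq> 0"
begin

lemma alpha: "\<alpha> \<in> homs A A 0" "\<alpha> \<in> carrier_mat (rank A) (rank A)"
    "map_mat (mscale t) dA * \<alpha> = \<alpha> * dA"
  and beta: "\<beta> \<in> homs B B 0" "\<beta> \<in> carrier_mat (rank B) (rank B)"
    "dB * \<beta> = \<beta> * map_mat (mscale t) dB"
proof -
  show a: "\<alpha> \<in> homs A A 0" "\<alpha> \<in> carrier_mat (rank A) (rank A)"
    and b: "\<beta> \<in> homs B B 0" "\<beta> \<in> carrier_mat (rank B) (rank B)"
    using closed_\<alpha> closed_\<beta>
    by (auto simp: closed_morphism_def cocycles_def homs_def rank_pullback)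
  have one: "(1 :: ('n, 'k) mfps) \<cdot>\<^sub>m X = X" for X by (rule eq_matI) auto
  have eq: "X = Y" if "X - (-1) ^ 0 \<cdot>\<^sub>m Y = 0\<^sub>m p p" "X \<in> carrier_mat p p" "Y \<in> carrier_mat p p"
    for X Y :: "('n, 'k) mfps mat" and p
    using that(1) unfolding power_0 one by (rule minus_eq_0_mat) (rule that)+
  show "map_mat (mscale t) dA * \<alpha> = \<alpha> * dA"
  proof (rule eq)
    show "map_mat (mscale t) dA * \<alpha> - (-1) ^ 0 \<cdot>\<^sub>m (\<alpha> * dA) = 0\<^sub>m (rank A) (rank A)"
      using closed_\<alpha> by (simp only: closed_morphism_def cocycles_def hom_diff_def rank_pullback mem_Collect_eq)
  qed (use a dA(2) in auto)
  show "dB * \<beta> = \<beta> * map_mat (mscale t) dB"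
  proof (rule eq)
    show "dB * \<beta> - (-1) ^ 0 \<cdot>\<^sub>m (\<beta> * map_mat (mscale t) dB) = 0\<^sub>m (rank B) (rank B)"
      using closed_\<beta> by (simp only: closed_morphism_def cocycles_def hom_diff_def rank_pullback mem_Collect_eq)
  qed (use b dB(2) in auto)
qed

lemmas alpha_beta_linear = left_mult_linear[OF beta(2)] right_mult_linear[OF alpha(2)]

definition scale_vars :: "(nat \<times> nat \<Rightarrow> ('n, 'k) mfps) \<Rightarrow> nat \<times> nat \<Rightarrow> ('n, 'k) mfps" where
  "scale_vars f = (\<lambda>p. mscale t (f p))"

lemma scale_vars_simps:
  "scale_vars (f + g) = scale_vars f + scale_vars g" "scale_vars (f - g) = scale_vars f - scale_vars g"
  "scale_vars (fn_scale c f) = fn_scale c (scale_vars f)"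
  "scale_vars (mult_by r f) = mult_by (mscale t r) (scale_vars f)"
  "scale_vars (twist f) = twist (scale_vars f)"
proof -
  have "mscale t (a - b) = mscale t a - mscale t b" for a b :: "('n, 'k) mfps"
    by (rule mfps_eqI) (simp add: mscale.rep_eq right_diff_distrib)
  then show "scale_vars (f - g) = scale_vars f - scale_vars g" by (simp add: scale_vars_def fun_eq_iff)
  show "scale_vars (twist f) = twist (scale_vars f)"
    using mscale_hom(3)[of t]
    by (auto simp: scale_vars_def twist_apply mscale_sign fun_eq_iff)
  show "scale_vars (fn_scale c f) = fn_scale c (scale_vars f)"
    by (simp add: scale_vars_def fn_scale_apply mscale_hom(4) fun_eq_iff)
qed (simp_all add: scale_vars_def mult_by_apply mscale_hom(1,2) fun_eq_iff)

lemma scale_vars_mult: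
  "M \<in> carrier_mat (rank B) (rank B) \<Longrightarrow>
    scale_vars (left_mult M f) = left_mult (map_mat (mscale t) M) (scale_vars f)"
  "M' \<in> carrier_mat (rank A) (rank A) \<Longrightarrow>
    scale_vars (right_mult M' f) = right_mult (map_mat (mscale t) M') (scale_vars f)"
  by (auto simp: scale_vars_def fun_eq_iff left_mult_apply right_mult_apply mscale_hom mscale_sum
      intro!: sum.cong)

definition T :: "(nat \<times> nat \<Rightarrow> ('n, 'k) mfps) \<Rightarrow> nat \<times> nat \<Rightarrow> ('n, 'k) mfps" where
  "T f = left_mult \<beta> (right_mult \<alpha> (scale_vars f))"

text \<open>The twist inserts the sign by which the supertrace differs from the trace.\<close>

definition S :: "(nat \<times> nat \<Rightarrow> ('n, 'k) mfps) \<Rightarrow> nat \<times> nat \<Rightarrow> ('n, 'k) mfps" where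
  "S f = twist (T f)"

lemma T_linear: "T (f + g) = T f + T g" "T (fn_scale c f) = fn_scale c (T f)"
  by (simp_all add: T_def scale_vars_simps alpha_beta_linear)

lemma T_in_U [simp]: "T f \<in> U"
  by (simp add: T_def)

lemma twist_alpha_beta:
  "twist (left_mult \<beta> g) = left_mult \<beta> (twist g)" "twist (right_mult \<alpha> g) = right_mult \<alpha> (twist g)"
  using twist_left_mult[OF beta(2,1)] twist_right_mult[OF alpha(2,1)] by (simp_all add: mult_by_simps)

lemma T_twist: "T (twist f) = twist (T f)"
  by (simp add: T_def scale_vars_simps twist_alpha_beta)

text \<open>Closedness of \<open>\<alpha>\<close> and \<open>\<beta>\<close> is what moves the differentials past them; the pullback has already
  replaced the entries of the differentials by their images under \<open>mscale t\<close>.\<close>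

lemma T_D: "T (D f) = D (T f)"
proof -
  let ?f = "scale_vars f" and ?tA = "map_mat (mscale t) dA" and ?tB = "map_mat (mscale t) dB"
  have c: "?tA \<in> carrier_mat (rank A) (rank A)" "?tB \<in> carrier_mat (rank B) (rank B)"
    using dA(2) dB(2) by auto
  have "T (D f) = left_mult \<beta> (right_mult \<alpha> (left_mult ?tB ?f)) - left_mult \<beta> (right_mult \<alpha> (right_mult ?tA (twist ?f)))"
    by (simp add: T_def D_def scale_vars_simps scale_vars_mult(1)[OF dB(2)]
        scale_vars_mult(2)[OF dA(2)] alpha_beta_linear)
  also have "left_mult \<beta> (right_mult \<alpha> (left_mult ?tB ?f)) = left_mult dB (T f)"
    by (simp add: T_def left_mult_right_mult[OF c(2) alpha(2), symmetric]
        left_mult_compose[OF beta(2) c(2)] left_mult_compose[OF dB(2) beta(2)] beta(3))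
  also have "left_mult \<beta> (right_mult \<alpha> (right_mult ?tA (twist ?f))) = right_mult dA (twist (T f))"
    by (simp add: T_def twist_alpha_beta right_mult_compose[OF alpha(2) c(1)] alpha(3)
        left_mult_right_mult[OF beta(2) dA(2), symmetric] right_mult_compose[OF dA(2) alpha(2)])
  finally show ?thesis by (simp only: D_def)
qed

lemma S_anticommuting: "cx.anticommuting S"
  unfolding cx.anticommuting_def
proof (intro conjI ballI)
  show "fn.linear_endo S" by (rule fn.linear_endoI) (simp_all add: S_def T_linear twist_linear)
qed (simp_all add: S_def T_D D_twist)

lemma S_power_submodule: "f \<in> power_submodule a I \<Longrightarrow> S f \<in> power_submodule a I"
proof -
  assume f: "f \<in> power_submodule a I"
  have "mscale t 0 = (0 :: ('n, 'k) mfps)" by (simp add: mscale_hom)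
  then have "scale_vars f \<in> power_submodule a I" using f by (auto simp: power_submodule_def scale_vars_def U_def power_ideal_closed)
  then show ?thesis unfolding S_def T_def by (intro power_submodule_ops alpha beta)
qed

lemma S_var: "S (mult_by (var_power i 1) f) = fn_scale (t i) (mult_by (var_power i 1) (S f))"
  unfolding S_def T_def scale_vars_simps mscale_hom(5)
  by (simp add: fn_scale_eq mult_by_simps alpha_beta_linear twist_linear)

text \<open>Modulo the maximal ideal the elementary matrices form a basis, and the diagonal coefficient of \<open>S\<close>
  at the elementary matrix of index $(i,j)$ is $\pm\beta_{ii}\alpha_{jj}$ with the product of the signs
  of the two basis vectors.\<close>

lemma residue_trace:
  "fn.qtrace U (power_submodule 1 UNIV) S = residue_supertrace A \<alpha> * residue_supertrace B \<beta>"
proof -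
  obtain xs where xs: "set xs = monomial_indices 1" "distinct xs" using finite_distinct_list[OF finite_monomial_indices] by blast
  have sq: "fn.subquotient U (power_submodule 1 UNIV)"
    using subspace_power_submodule subspace_U by (auto simp: fn.subquotient_def power_submodule_def)
  have pr: "fn.preserves S U (power_submodule 1 UNIV)"
    using S_anticommuting S_power_submodule by (auto simp: fn.preserves_def cx.anticommuting_def)
  let ?c = "\<lambda>i j. (-1) ^ basis_degree B i * mresidue (\<beta> $$ (i, i)) * ((-1) ^ basis_degree A j * mresidue (\<alpha> $$ (j, j)))"
  have entry: "mcoeff (S (elementary ((i, j), \<lambda>_. 0)) (i, j)) (\<lambda>_. 0) = ?c i j"
    if ij: "i < rank B" "j < rank A" for i j
  proof -
    let ?u = "elementary ((i, j), \<lambda>_. 0)"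
    have u: "scale_vars ?u (k, l) = (if k = i \<and> l = j then 1 else 0)" for k l
      by (auto simp: scale_vars_def elementary_def mscale_hom mscale.rep_eq mcoeff_one intro!: mfps_eqI)
    have "right_mult \<alpha> (scale_vars ?u) (k, j) = (if k = i then \<alpha> $$ (j, j) else 0)" if "k < rank B" for k
      using ij that by (simp add: right_mult_apply[OF alpha(2)] u if_distrib[of "\<lambda>x. x * _"] cong: if_cong)
    then have "T ?u (i, j) = \<beta> $$ (i, i) * \<alpha> $$ (j, j)"
      using ij by (simp add: T_def left_mult_apply[OF beta(2)] if_distrib[of "\<lambda>x. _ * x"] cong: if_cong)
    then have Su: "S ?u (i, j) = (-1) ^ (basis_degree B i + basis_degree A j) * (\<beta> $$ (i, i) * \<alpha> $$ (j, j))"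
      using ij by (simp add: S_def twist_apply)
    have sign: "mresidue ((-1) ^ d * f) = (-1) ^ d * mresidue f" for d and f :: "('n, 'k) mfps"
      by (simp add: minus_one_power_iff mresidue_hom(2))
    have "mcoeff (S ?u (i, j)) (\<lambda>_. 0) = (-1) ^ (basis_degree B i + basis_degree A j) *
        (mresidue (\<beta> $$ (i, i)) * mresidue (\<alpha> $$ (j, j)))"
      by (simp only: mresidue_def[symmetric] Su sign) (simp only: mresidue_hom(1))
    then show ?thesis by (simp add: power_add)
  qed
  have "fn.qtrace U (power_submodule 1 UNIV) S = (\<Sum>x\<in>monomial_indices 1. mcoeff (S (elementary x) (fst x)) (snd x))"
    unfolding fn.qtrace_eq[OF sq pr monomial_frame[OF xs]] fn.frame_trace_def
    using xs by (simp add: o_def sum_list_distinct_conv_sum_set)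
  also have "monomial_indices 1 = (\<lambda>p. (p, \<lambda>_. 0)) ` ({..<rank B} \<times> {..<rank A})" by (auto simp: monomial_indices_def)
  also have "(\<Sum>x\<in>\<dots>. mcoeff (S (elementary x) (fst x)) (snd x)) =
    (\<Sum>p\<in>{..<rank B} \<times> {..<rank A}. mcoeff (S (elementary (p, \<lambda>_. 0)) p) (\<lambda>_. 0))"
    by (subst sum.reindex) (auto simp: inj_on_def)
  also have "\<dots> = (\<Sum>i<rank B. \<Sum>j<rank A. mcoeff (S (elementary ((i, j), \<lambda>_. 0)) (i, j)) (\<lambda>_. 0))"
    unfolding sum.cartesian_product by (intro sum.cong) auto
  also have "\<dots> = (\<Sum>i<rank B. \<Sum>j<rank A. ?c i j)"
    by (intro sum.cong refl entry) auto
  also have "\<dots> = residue_supertrace B \<beta> * residue_supertrace A \<alpha>"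
    unfolding supertrace_residue[OF alpha(2)] supertrace_residue[OF beta(2)]
    by (rule sum_product[symmetric])
  finally show ?thesis by (simp only: mult.commute)
qed

text \<open>The variables are divided out one at a time, each contributing its factor; at the end the complex is
  finite-dimensional and the trace on cohomology is the trace on the complex.\<close>

lemma total_trace:
  assumes "fn.finite_codim (cx.rel_cycles {0}) (cx.rel_boundaries {0})"
  shows "(\<Prod>i\<in>UNIV. 1 - t i) * fn.qtrace (cx.rel_cycles {0}) (cx.rel_boundaries {0}) S =
    residue_supertrace A \<alpha> * residue_supertrace B \<beta>"
proof -
  have "fn.finite_codim (cx.rel_cycles (power_submodule 1 I)) (cx.rel_boundaries (power_submodule 1 I)) \<and>
    fn.qtrace (cx.rel_cycles (power_submodule 1 I)) (cx.rel_boundaries (power_submodule 1 I)) S =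
      (\<Prod>i\<in>I. 1 - t i) * fn.qtrace (cx.rel_cycles {0}) (cx.rel_boundaries {0}) S"
    if "finite I" for I
    using that
  proof (induction I)
    case empty
    then show ?case using assms by (simp only: power_submodule_empty prod.empty mult_1 simp_thms)
  next
    case (insert i I)
    note step = cx.rel_trace_extend[OF subcomplex_power_submodule regular_var_power[OF insert.hyps(2)]
        S_anticommuting S_power_submodule t_nz S_var conjunct1[OF insert.IH]]
    show ?case
      using step insert.hyps insert.IH by (simp add: power_submodule_insert mult.assoc)
  qed
  from this[of UNIV] have
    "fn.qtrace (cx.rel_cycles (power_submodule 1 UNIV)) (cx.rel_boundaries (power_submodule 1 UNIV)) S =
      (\<Prod>i\<in>UNIV. 1 - t i) * fn.qtrace (cx.rel_cycles {0}) (cx.rel_boundaries {0}) S"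
    by simp
  then show ?thesis
    using cx.hopf_trace[OF subcomplex_power_submodule S_anticommuting S_power_submodule finite_codim_power_submodule] residue_trace
    by simp
qed

end

section \<open>The grading of the cohomology\<close>

context equivariant_pair
begin

definition even_part :: "(nat \<times> nat \<Rightarrow> ('n, 'k) mfps) \<Rightarrow> nat \<times> nat \<Rightarrow> ('n, 'k) mfps" where
  "even_part f = fn_scale (1 / 2) (f + twist f)"

abbreviation "Z \<equiv> cx.rel_cycles {0}"
abbreviation "B\<^sub>0 \<equiv> cx.rel_boundaries {0}"

text \<open>The degree is read off from the twist, so that no separate grading has to be carried along.\<close>

definition degree_part :: "nat \<Rightarrow> (nat \<times> nat \<Rightarrow> ('n, 'k) mfps) set \<Rightarrow> (nat \<times> nat \<Rightarrow> ('n, 'k) mfps) set" where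
  "degree_part s W = {f \<in> W. twist f = fn_scale ((-1) ^ s) f}"

lemma fn_scale_sign: "fn_scale 1 f = f" "fn_scale (- 1) f = - f"
  using fn.scale_one by (auto simp: fn.scale_minus_left)

lemma mult_by_sign: "mult_by ((-1) ^ s) f = fn_scale ((-1) ^ s) f"
  by (cases "even s") (simp_all add: fn_scale_sign mult_by_simps)

lemma self_negative_zero:
  fixes x :: "('n, 'k) mfps"
  assumes "- x = x"
  shows "x = 0"
proof (rule mfps_eqI)
  fix m
  have "- mcoeff x m = mcoeff x m"
    using arg_cong[OF assms, of "\<lambda>f. mcoeff f m"] by (simp only: mcoeff_simps)
  then have "2 * mcoeff x m = 0" by (simp add: neg_eq_iff_add_eq_0)
  then show "mcoeff x m = mcoeff 0 m" by simp
qed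

text \<open>An entry is multiplied by the parity of its place, so a matrix is homogeneous of degree $s$ exactly
  if it lies in the eigenspace of the twist for $(-1)^s$.\<close>

lemma homs_iff:
  "\<phi> \<in> homs A B s \<longleftrightarrow> \<phi> \<in> carrier_mat (rank B) (rank A) \<and> twist (of_mat \<phi>) = fn_scale ((-1) ^ s) (of_mat \<phi>)"
proof -
  have par: "x mod 2 = (y + s) mod 2 \<longleftrightarrow> (even (x + y) = even s)" for x y :: nat by presburger
  have sgn: "(-1) ^ d * x = mconst ((-1) ^ s) * x \<longleftrightarrow> x \<noteq> 0 \<longrightarrow> even d = even s"
    for d and x :: "('n, 'k) mfps"
    using self_negative_zero[of x] fn_scale_sign(2)[of "\<lambda>_. x"]
    by (auto simp: minus_one_power_iff fn_scale_def fun_eq_iff mconst_hom)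
  have "twist (of_mat \<phi>) = fn_scale ((-1) ^ s) (of_mat \<phi>) \<longleftrightarrow> (\<forall>i<rank B. \<forall>j<rank A.
    (-1) ^ (basis_degree B i + basis_degree A j) * \<phi> $$ (i, j) = mconst ((-1) ^ s) * \<phi> $$ (i, j))"
    unfolding fun_eq_iff split_paired_All by (auto simp: twist_apply of_mat_def fn_scale_apply)
  then show ?thesis unfolding sgn by (auto simp: homs_def par)
qed

lemma hom_diff_to_mat:
  assumes f: "f \<in> U" and tw: "twist f = fn_scale ((-1) ^ s) f"
  shows "hom_diff A B s (to_mat f) = to_mat (D f)"
proof -
  have "to_mat (left_mult dB f) = dB * to_mat f"
    unfolding left_mult_def by (rule to_mat_of_mat) (use dB(2) in auto)
  moreover have "to_mat (right_mult dA (twist f)) = to_mat (twist f) * dA"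
    unfolding right_mult_def by (rule to_mat_of_mat) (use dA(2) in auto)
  moreover have "to_mat (twist f) = (-1) ^ s \<cdot>\<^sub>m to_mat f"
    unfolding tw mult_by_sign[symmetric] to_mat_linear ..
  moreover have "((-1) ^ s \<cdot>\<^sub>m to_mat f) * dA = (-1) ^ s \<cdot>\<^sub>m (to_mat f * dA)"
    by (rule mult_smult_assoc_mat[OF to_mat_carrier dA(2)])
  ultimately show ?thesis by (simp add: D_def to_mat_linear hom_diff_def)
qed

lemma D_sign: "u \<in> U \<Longrightarrow> twist u = fn_scale c u \<Longrightarrow> twist (D u) = fn_scale (- c) (D u)"
  using D_twist[of u] by (simp add: D_linear fn.scale_minus_left)

lemma cocycles_to_mat: "to_mat ` degree_part s Z = cocycles A B s"
proof (intro equalityI subsetI)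
  fix \<phi> assume "\<phi> \<in> to_mat ` degree_part s Z"
  then obtain f where f: "\<phi> = to_mat f" "f \<in> U" "D f = 0" "twist f = fn_scale ((-1) ^ s) f"
    by (auto simp: degree_part_def cx.rel_cycles_def)
  then show "\<phi> \<in> cocycles A B s"
    by (simp add: cocycles_def homs_iff of_mat_to_mat hom_diff_to_mat to_mat_linear)
next
  fix \<phi> assume "\<phi> \<in> cocycles A B s"
  then have \<phi>: "\<phi> \<in> carrier_mat (rank B) (rank A)" "twist (of_mat \<phi>) = fn_scale ((-1) ^ s) (of_mat \<phi>)"
    "hom_diff A B s \<phi> = 0\<^sub>m (rank B) (rank A)" by (auto simp: cocycles_def homs_iff)
  have "to_mat (D (of_mat \<phi>)) = to_mat 0"
    using hom_diff_to_mat[OF of_mat_in_U \<phi>(2)] \<phi>(3) by (simp only: to_mat_of_mat[OF \<phi>(1)] to_mat_linear)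
  then have "of_mat (to_mat (D (of_mat \<phi>))) = of_mat (to_mat 0)" by simp
  then have "D (of_mat \<phi>) = 0" using fn.subspace_0[OF subspace_U] by (simp only: of_mat_to_mat D_in_U)
  then show "\<phi> \<in> to_mat ` degree_part s Z"
    using \<phi> by (intro image_eqI[of _ _ "of_mat \<phi>"]) (auto simp: to_mat_of_mat degree_part_def cx.rel_cycles_def)
qed

text \<open>A coboundary of degree $s$ may come from a cochain \<open>u\<close> with components of both degrees. Projecting
  \<open>u\<close> to degree $s + 1$ does not change its differential.\<close>

lemma coboundaries_to_mat: "to_mat ` degree_part s B\<^sub>0 = coboundaries A B s"
proof (intro equalityI subsetI)
  fix \<phi> assume "\<phi> \<in> coboundaries A B s"
  then obtain \<psi> where \<psi>: "\<psi> \<in> carrier_mat (rank B) (rank A)" "twist (of_mat \<psi>) = fn_scale ((-1) ^ (s + 1)) (of_mat \<psi>)"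
    "\<phi> = hom_diff A B (s + 1) \<psi>" by (auto simp: coboundaries_def homs_iff)
  have "\<phi> = to_mat (D (of_mat \<psi>))"
    using hom_diff_to_mat[OF of_mat_in_U \<psi>(2)] \<psi>(3) by (simp only: to_mat_of_mat[OF \<psi>(1)])
  moreover have "twist (D (of_mat \<psi>)) = fn_scale ((-1) ^ s) (D (of_mat \<psi>))"
    using D_sign[OF of_mat_in_U \<psi>(2)] by simp
  moreover have "D (of_mat \<psi>) \<in> B\<^sub>0" by (force simp: cx.rel_boundaries_def)
  ultimately show "\<phi> \<in> to_mat ` degree_part s B\<^sub>0" by (auto simp: degree_part_def)
next
  fix \<phi> assume "\<phi> \<in> to_mat ` degree_part s B\<^sub>0"
  then obtain u where u: "u \<in> U" "\<phi> = to_mat (D u)" "twist (D u) = fn_scale ((-1) ^ s) (D u)"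
    by (auto simp: degree_part_def cx.rel_boundaries_def)
  \<comment> \<open>the component of \<open>u\<close> of degree $s + 1$\<close>
  define v where "v = fn_scale (1 / 2) (u + fn_scale ((-1) ^ (s + 1)) (twist u))"
  have sq: "(-1) ^ s * (-1) ^ s = (1 :: 'k)" by (simp add: power_add[symmetric])
  have v: "v \<in> U"
    unfolding v_def using u by (intro fn.subspace_scale fn.subspace_add subspace_U) simp_all
  have tv: "twist v = fn_scale ((-1) ^ (s + 1)) v"
    using u(1) sq by (simp add: v_def twist_linear twist_twist fn.scale_right_distrib algebra_simps)
  have "D (fn_scale ((-1) ^ (s + 1)) (twist u)) = fn_scale ((-1) ^ (s + 1)) (- twist (D u))"
    by (simp only: D_linear D_twist[OF u(1)])
  also have "\<dots> = fn_scale ((-1) ^ s) (twist (D u))" by (simp add: fn.scale_minus_left)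
  also have "\<dots> = D u" by (simp only: u(3) fn.scale_scale sq fn_scale_sign)
  finally have "D v = fn_scale (1 / 2) (D u + D u)" by (simp only: v_def D_linear)
  also have "D u + D u = fn_scale 2 (D u)"
    using fn.scale_left_distrib[of 1 1 "D u"] by (simp add: fn_scale_sign)
  finally have "D v = D u" by simp
  then have "\<phi> = hom_diff A B (s + 1) (to_mat v)" using hom_diff_to_mat[OF v tv] u by simp
  moreover have "to_mat v \<in> homs A B (s + 1)" using v tv by (simp add: homs_iff of_mat_to_mat)
  ultimately show "\<phi> \<in> coboundaries A B s" by (auto simp: coboundaries_def)
qed

lemma subcomplex_zero: "cx.subcomplex {0}"
  using subcomplex_power_submodule[of 0 "{}"] by (simp only: power_submodule_empty)

lemma subquotient_ZB: "fn.subquotient Z B\<^sub>0"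
  by (rule cx.rel_subquotient(1)[OF subcomplex_zero])

lemma linear_endos: "fn.linear_endo T" "fn.linear_endo S" "fn.linear_endo twist"
  by (rule fn.linear_endoI; simp add: S_def T_linear twist_linear)+

lemma T_zero: "T 0 = 0"
  by (rule module_hom.zero[OF linear_endos(1)])

lemma T_preserves: "fn.preserves T Z B\<^sub>0"
  using linear_endos(1)
  by (auto simp: fn.preserves_def cx.rel_cycles_def cx.rel_boundaries_def T_D[symmetric] T_zero)
    (metis T_D T_in_U)

lemma twist_preserves: "fn.preserves twist Z B\<^sub>0"
proof -
  have "twist (D u) = D (- twist u)" "- twist u \<in> U" if "u \<in> U" for u
    using D_twist[OF that] fn.subspace_neg[OF subspace_U] by (simp_all add: cx.D.neg)
  then have "twist (D u) \<in> B\<^sub>0" if "u \<in> U" for u using that unfolding cx.rel_boundaries_def by force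
  then show ?thesis
    using linear_endos(3) D_twist module_hom.zero[OF linear_endos(3)]
    by (auto simp: fn.preserves_def cx.rel_cycles_def cx.rel_boundaries_def)
qed

lemma S_preserves: "fn.preserves S Z B\<^sub>0"
  using linear_endos(2) T_preserves twist_preserves by (auto simp: fn.preserves_def S_def)

lemma preserves_degree_part:
  assumes "fn.preserves F Z B\<^sub>0" "\<And>f. f \<in> U \<Longrightarrow> F (twist f) = twist (F f)"
  shows "fn.preserves F (degree_part s Z) (degree_part s B\<^sub>0)"
proof -
  have Z: "f \<in> U" if "f \<in> Z" for f using that by (simp add: cx.rel_cycles_def)
  have B: "f \<in> U" if "f \<in> B\<^sub>0" for f using that subquotient_ZB Z by (auto simp: fn.subquotient_def)
  have "twist (F f) = fn_scale c (F f)" if "f \<in> U" "twist f = fn_scale c f" for f c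
    using assms(2)[OF that(1)] that(2) module_hom.scale[OF fn.preservesD(1)[OF assms(1)], of c f] by simp
  then show ?thesis
    using assms(1) Z B by (auto simp: fn.preserves_def degree_part_def)
qed

lemma subquotient_degree_part: "fn.subquotient (degree_part s Z) (degree_part s B\<^sub>0)"
proof -
  have "fn.subspace (degree_part s W)" if "fn.subspace W" for W
    unfolding fn.subspace_def
  proof (intro conjI ballI allI)
    show "0 \<in> degree_part s W"
      using fn.subspace_0[OF that] module_hom.zero[OF linear_endos(3)] by (simp add: degree_part_def)
    show "f + g \<in> degree_part s W" if "f \<in> degree_part s W" "g \<in> degree_part s W" for f g
      using that fn.subspace_add[OF \<open>fn.subspace W\<close>]
      by (simp add: degree_part_def twist_linear fn.scale_right_distrib)
    show "fn_scale c f \<in> degree_part s W" if "f \<in> degree_part s W" for c f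
      using that fn.subspace_scale[OF \<open>fn.subspace W\<close>]
      by (simp add: degree_part_def twist_linear mult.commute)
  qed
  then show ?thesis using subquotient_ZB by (auto simp: fn.subquotient_def degree_part_def)
qed

lemma finite_degree_part:
  assumes "fn.finite_codim Z B\<^sub>0"
  shows "fn.finite_codim (degree_part s Z) (degree_part s B\<^sub>0)"
  by (rule fn.finite_codim_pullback[OF subquotient_degree_part subquotient_ZB fn.linear_endo_ident _ _ assms])
    (auto simp: degree_part_def)

lemma cohomology_trace:
  assumes "fn.finite_codim Z B\<^sub>0"
  shows "vs_trace (cohomology A B s)
      (quotient_map (cocycle_space A B s) (coboundaries A B s) (twisted_action t \<alpha> \<beta>)) =
    fn.qtrace (degree_part s Z) (degree_part s B\<^sub>0) T"
proof -
  have ZU: "f \<in> U" if "f \<in> degree_part s Z" for f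
    using that by (simp add: degree_part_def cx.rel_cycles_def)
  interpret P: quotient_presentation fn_scale "cocycle_space A B s" "degree_part s Z" "degree_part s B\<^sub>0" to_mat
  proof unfold_locales
    show "inj_on to_mat (degree_part s Z)" by (rule inj_on_inverseI[of _ of_mat]) (simp add: ZU of_mat_to_mat)
  qed (simp_all add: subquotient_degree_part cocycle_space_def cocycles_to_mat to_mat_linear)
  have T: "twisted_action t \<alpha> \<beta> (to_mat f) = to_mat (T f)" for f
  proof -
    have 1: "to_mat (of_mat (to_mat (scale_vars f) * \<alpha>)) = to_mat (scale_vars f) * \<alpha>"
      by (rule to_mat_of_mat) (use alpha(2) in auto)
    have "to_mat (T f) = \<beta> * (to_mat (scale_vars f) * \<alpha>)"
      unfolding T_def left_mult_def right_mult_def 1 by (rule to_mat_of_mat) (use alpha(2) beta(2) in auto)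
    moreover have "to_mat (scale_vars f) = map_mat (mscale t) (to_mat f)"
      by (auto simp: scale_vars_def intro!: eq_matI)
    ultimately show ?thesis by (simp add: twisted_action_def)
  qed
  have "vs_trace P.quot (quotient_map (cocycle_space A B s) (to_mat ` degree_part s B\<^sub>0) (twisted_action t \<alpha> \<beta>)) =
    fn.qtrace (degree_part s Z) (degree_part s B\<^sub>0) T"
    using T_preserves T_twist by (intro P.vs_trace_quot finite_degree_part assms preserves_degree_part T)
  then show ?thesis by (simp only: P.quot_def coboundaries_to_mat cohomology_def)
qed

text \<open>The trace of \<open>S\<close> splits into the traces on the two eigenspaces of the twist, where \<open>S\<close> is $T$
  and $-T$.\<close>

lemma cohomology_supertrace_eq:
  assumes fin: "fn.finite_codim Z B\<^sub>0"
  shows "cohomology_supertrace A B (twisted_action t \<alpha> \<beta>) = fn.qtrace Z B\<^sub>0 S"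
proof -
  have ZU: "f \<in> U" if "f \<in> Z" for f using that by (simp add: cx.rel_cycles_def)
  have S_twist: "S (twist f) = twist (S f)" for f by (simp add: S_def T_twist)
  have ST: "fn.qtrace (degree_part s Z) (degree_part s B\<^sub>0) S =
    (-1) ^ s * fn.qtrace (degree_part s Z) (degree_part s B\<^sub>0) T" for s
  proof -
    have 0: "0 \<in> degree_part s B\<^sub>0"
      using subquotient_degree_part by (auto simp: fn.subquotient_def dest: fn.subspace_0)
    have "1 * fn.qtrace (degree_part s Z) (degree_part s B\<^sub>0) S =
      (-1) ^ s * fn.qtrace (degree_part s Z) (degree_part s B\<^sub>0) T"
    proof (rule fn.qtrace_iso[OF subquotient_degree_part subquotient_degree_part fn.linear_endo_ident
          _ _ _ finite_degree_part[OF fin] preserves_degree_part[OF S_preserves]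
          preserves_degree_part[OF T_preserves]])
      show "\<exists>z\<in>degree_part s Z. y - z \<in> degree_part s B\<^sub>0" if "y \<in> degree_part s Z" for y
        using that 0 by (intro bexI[of _ y]) auto
      show "fn_scale 1 (S z) - fn_scale ((-1) ^ s) (T z) \<in> degree_part s B\<^sub>0" if "z \<in> degree_part s Z" for z
      proof -
        have "S z = fn_scale ((-1) ^ s) (T z)"
          using that by (simp add: S_def T_twist[symmetric] degree_part_def T_linear)
        then show ?thesis using 0 by (simp add: fn_scale_sign)
      qed
    qed (simp_all add: T_twist S_twist)
    then show ?thesis by simp
  qed
  have he: "fn.preserves even_part Z B\<^sub>0"
  proof -
    have "fn.linear_endo even_part"
      by (rule fn.linear_endoI) (simp_all add: even_part_def twist_linear fn.scale_right_distrib mult.commute)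
    moreover have "even_part f \<in> W" if "f \<in> W" "fn.subspace W" "\<And>f. f \<in> W \<Longrightarrow> twist f \<in> W" for f W
      unfolding even_part_def using that by (intro fn.subspace_scale fn.subspace_add) auto
    ultimately show ?thesis
      using subquotient_ZB twist_preserves by (auto simp: fn.preserves_def fn.subquotient_def)
  qed
  have two: "f + f = fn_scale 2 f" for f :: "nat \<times> nat \<Rightarrow> ('n, 'k) mfps"
    using fn.scale_left_distrib[of 1 1 f] by (simp add: fn_scale_sign)
  have he_fix: "even_part f = f \<longleftrightarrow> twist f = f" for f
  proof
    assume "even_part f = f"
    then have "fn_scale 2 (even_part f) = f + f" using two by simp
    then show "twist f = f" by (simp add: even_part_def fn_scale_sign)
  next
    assume "twist f = f"
    then have "even_part f = fn_scale (1/2) (fn_scale 2 f)" by (simp only: even_part_def two)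
    then show "even_part f = f" by (simp add: fn_scale_sign)
  qed
  have he_zero: "even_part f = 0 \<longleftrightarrow> twist f = - f" for f
    by (simp add: even_part_def eq_neg_iff_add_eq_0 add.commute)
  have idem: "even_part (even_part z) = even_part z" if "z \<in> Z" for z
    unfolding he_fix using twist_twist[OF ZU[OF that]] by (simp add: even_part_def twist_linear add.commute)
  have "even_part (S z) = S (even_part z)" for z
    using module_hom.add[OF linear_endos(2)] module_hom.scale[OF linear_endos(2)]
    by (simp add: even_part_def S_twist)
  then have split: "fn.qtrace Z B\<^sub>0 S = fn.qtrace {z \<in> Z. even_part z = z} {b \<in> B\<^sub>0. even_part b = b} S +
      fn.qtrace {z \<in> Z. even_part z = 0} {b \<in> B\<^sub>0. even_part b = 0} S"
    by (intro fn.qtrace_eigenspaces[OF subquotient_ZB fin S_preserves he idem]) auto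
  have parts: "{z \<in> W. even_part z = z} = degree_part 0 W" "{z \<in> W. even_part z = 0} = degree_part 1 W" for W
    by (simp_all add: degree_part_def he_fix he_zero fn_scale_sign)
  show ?thesis
    unfolding split parts ST cohomology_supertrace_def cohomology_trace[OF fin] by simp
qed

end

theorem theorem0p1:
  fixes w :: "('n :: finite, 'k :: field_char_0) mfps"
    and t :: "'n \<Rightarrow> 'k"
    and A B :: "('n, 'k) mfps graded_module"
    and \<alpha> \<beta> :: "('n, 'k) mfps mat"
  assumes "isolated_singularity w"
    and "\<And>i. t i \<noteq> 0"
    and "mscale t w = w"
    and "\<And>i. t i \<noteq> 1"
    and "matrix_factorization w A"
    and "matrix_factorization w B"
    and "closed_morphism A (pullback t A) \<alpha>"
    and "closed_morphism (pullback t B) B \<beta>"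
  shows "cohomology_supertrace A B (twisted_action t \<alpha> \<beta>) =
    residue_supertrace A \<alpha> * residue_supertrace B \<beta> * (\<Prod>i\<in>UNIV. inverse (1 - t i))"
proof -
  interpret equivariant_pair A B w t \<alpha> \<beta>
    using assms by unfold_locales auto
  obtain a where "\<And>i. var_power i a \<in> jacobian_ideal w"
    using isolated_singularity_var_power[OF assms(1)] by blast
  then have fin: "fn.finite_codim Z B\<^sub>0" by (rule finite_cohomology)
  have "(\<Prod>i\<in>UNIV. 1 - t i) \<noteq> 0" using assms(4) by simp
  moreover have "(\<Prod>i\<in>UNIV. inverse (1 - t i)) = inverse (\<Prod>i\<in>UNIV. 1 - t i)"
    using prod_inversef[of "\<lambda>i. 1 - t i" UNIV] by (simp add: o_def)
  moreover have "p * q * inverse p = q" if "p \<noteq> 0" for p q :: 'k using that by simp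
  ultimately show ?thesis
    unfolding cohomology_supertrace_eq[OF fin] total_trace[OF fin, symmetric] by metis
qed

end
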